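(* Assume: (a) $A:\mathcal H\rightrightarrows\mathcal H$ is maximally monotone, and there is $\beta>0$ such that for every $x\in\mathcal H$ the map $\xi\mapsto B(x,\xi)$ is $m_x$-measurable and $\beta$-Lipschitz; (b) there is $\theta>0$ such that for every $x\in\mathcal H$ and $m_x$-almost every $\xi\in\Xi$, $\theta\|B(y,\xi)-B(z,\xi)\|^2\le\langle B(y,\xi)-B(z,\xi),y-z\rangle$ for all $y,z\in\mathcal H$; (c) there is $\tau>0$ such that $\mathbb W_1(m_x,m_y)\le\tau\|x-y\|$ for all $x,y\in\mathcal H$; (d) there is $L>0$ such that for every $x\in\mathcal H$ and $m_x$-almost every $\xi\in\Xi$, the map $y\mapsto B(y,\xi)$ is $L$-Lipschitz continuous on $\mathcal H$. Let $\gamma\in(0,2\theta)$ and assume that the parameter $\lambda:[t_0,\infty)\to(0,\infty)$ is bounded away from zero, i.e. $\inf_{t\ge t_0}\lambda(t)>0$. Furthermore, suppose that (e) either $A$ is uniformly monotone with a continuous, strictly increasing modulus $\phi:[0,\infty)\to[0,\infty)$ with $\phi(0)=0$, $t\mapsto\phi(t)/t$ non-decreasing on $(0,\infty)$ and $\phi(t)>\beta\tau t^2$ for all $t>0$; or $A$ is $\mu_A$-strongly monotone for some $\mu_A>0$ with $\beta\tau/\mu_A<1$. Then, for any initial conditions $(x_0,u_0)\in\mathcal H\times\mathcal H$, the dynamical system $$\ddot x(t)+\nu(t)\dot x(t)+T^{m_{\bar x}}_{\lambda(t),\gamma}(x(t))+\omega\frac{d}{dt}\left(T^{m_{\bar x}}_{\lambda(t),\gamma}(x(t))\right)+E^{\bar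 x}_{\lambda(t),\gamma}(x(t))+\omega\frac{d}{dt}\left(E^{\bar x}_{\lambda(t),\gamma}(x(t))\right)=0$$ admits a unique strong global solution $x:[t_0,\infty)\to\mathcal H$ satisfying $x(t_0)=x_0$ and $\dot x(t_0)=u_0$.
   Context: $\mathcal H$ is a real Hilbert space, $\Xi$ a Polish space (with its complete metric), $(m_x)_{x\in\mathcal H}$ a family of probability measures on $\Xi$, $A:\mathcal H\rightrightarrows\mathcal H$ a set-valued operator, $B:\mathcal H\times\Xi\to\mathcal H$ single-valued. $t_0>0$, $\omega\ge0$, and $\nu:[t_0,\infty)\to(0,\infty)$ is the viscous damping function. For a probability measure $m$ on $\Xi$, $B_m(y)=\mathbb E_{\xi\sim m}[B(y,\xi)]$; $J_{\gamma A}=(\mathrm{Id}+\gamma A)^{-1}$; and for $\lambda,\gamma>0$, $T^{m}_{\lambda,\gamma}(x)=\frac1\lambda[x-J_{\gamma A}(x-\gamma B_m(x))]$. An equilibrium is a point $\bar x$ with $0\in A(\bar x)+B_{m_{\bar x}}(\bar x)$; under the assumptions it exists and is unique, and $\bar x$ denotes it. The gap function is $E^{\bar x}_{\lambda,\gamma}(x)=T^{m_x}_{\lambda,\gamma}(x)-T^{m_{\bar x}}_{\lambda,\gamma}(x)$. $\mathbb W_1(m_1,m_2)=\sup_h|\mathbb E_{\xi\sim m_1}[h(\xi)]-\mathbb E_{\eta\sim m_2}[h(\eta)]|$ over $1$-Lipschitz $h:\Xi\to\mathbb R$. $A$ is uniformly monotone with modulus $\phi$ (increasing, $\phi(0)=0$,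 $\phi(t)\to\infty$ as $t\to\infty$) if $\langle x-y,u-v\rangle\ge\phi(\|x-y\|)$ whenever $u\in A(x)$, $v\in A(y)$; it is $\mu_A$-strongly monotone if this holds with $\phi(t)=\mu_At^2$. A strong global solution is a function $x\in W^{2,1}_{\mathrm{loc}}([t_0,\infty);\mathcal H)$ (i.e. $x$ and $\dot x$ are absolutely continuous on compact intervals) for which the equation holds for almost every $t\ge t_0$.
   Formalization: Added regularity, without which the claim fails: ν is integrable on each [t0,T], λ is Lebesgue measurable, and, if ω>0, λ is absolutely continuous on compact intervals (e.g. ν(t)=1/(t−t0) for t>t0 admits no strong solution when u0≠0). *)

theory Defs
  imports "HOL-Probability.Probability"
begin

text \<open>
  A real Hilbert space is a type of class \<open>{real_inner, complete_space}\<close>; separability is not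
  assumed. A set-valued operator is a function \<open>'a \<Rightarrow> 'a set\<close>.
\<close>

section \<open>Vector-valued expectations\<close>

text \<open>
  The library's Bochner integral requires a second countable target. The following is the same
  definition without that requirement, so that it applies to non-separable Hilbert spaces; the
  lemma below records that nothing else has changed.
\<close>

definition has_expectation ::
    "'b measure \<Rightarrow> ('b \<Rightarrow> 'a::real_normed_vector) \<Rightarrow> 'a \<Rightarrow> bool" where
  "has_expectation M f v \<longleftrightarrow>
     f \<in> borel_measurable M \<and>
     (\<exists>s. (\<forall>i. Bochner_Integration.simple_bochner_integrable M (s i)) \<and>
          (\<lambda>i. \<integral>\<^sup>+\<xi>. ennreal (norm (f \<xi> - s i \<xi>)) \<partial>M) \<longlonglongrightarrow> 0 \<and>
          (\<lambda>i. Bochner_Integration.simple_bochner_integral M (s i)) \<longlonglongrightarrow> v)"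

definition vexpectation :: "'b measure \<Rightarrow> ('b \<Rightarrow> 'a::real_normed_vector) \<Rightarrow> 'a" where
  "vexpectation M f = (THE v. has_expectation M f v)"

lemma has_expectation_iff_has_bochner_integral:
  fixes f :: "'b \<Rightarrow> 'a::{real_normed_vector, second_countable_topology}"
  shows "has_expectation M f v \<longleftrightarrow> has_bochner_integral M f v"
  unfolding has_expectation_def has_bochner_integral.simps by auto

section \<open>The first Wasserstein distance\<close>

text \<open>
  The supremum only makes sense if every 1-Lipschitz function has an expectation, whereas the
  library assigns the integral 0 to non-integrable functions. We therefore let the distance be
  infinite in that case; finiteness of \<open>wasserstein1 M N\<close> thus entails that \<open>M\<close> and \<open>N\<close> have
  finite first moments.
\<close>

definition wasserstein1 :: "'b::metric_space measure \<Rightarrow> 'b measure \<Rightarrow> ennreal" where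
  "wasserstein1 M N =
     (SUP h\<in>{h :: 'b \<Rightarrow> real. 1-lipschitz_on UNIV h}.
        if integrable M h \<and> integrable N h
        then ennreal \<bar>(\<integral>\<xi>. h \<xi> \<partial>M) - (\<integral>\<eta>. h \<eta> \<partial>N)\<bar>
        else \<infinity>)"

section \<open>Monotone operators\<close>

definition monotone_operator :: "('a::real_inner \<Rightarrow> 'a set) \<Rightarrow> bool" where
  "monotone_operator A \<longleftrightarrow> (\<forall>x y. \<forall>u\<in>A x. \<forall>v\<in>A y. 0 \<le> (x - y) \<bullet> (u - v))"

definition maximally_monotone :: "('a::real_inner \<Rightarrow> 'a set) \<Rightarrow> bool" where
  "maximally_monotone A \<longleftrightarrow>
     monotone_operator A \<and>
     (\<forall>A'. monotone_operator A' \<and> (\<forall>x. A x \<subseteq> A' x) \<longrightarrow> A' = A)"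

definition uniformly_monotone :: "('a::real_inner \<Rightarrow> 'a set) \<Rightarrow> (real \<Rightarrow> real) \<Rightarrow> bool" where
  "uniformly_monotone A \<phi> \<longleftrightarrow>
     mono_on {0..} \<phi> \<and> \<phi> 0 = 0 \<and> filterlim \<phi> at_top at_top \<and>
     (\<forall>x y. \<forall>u\<in>A x. \<forall>v\<in>A y. \<phi> (norm (x - y)) \<le> (x - y) \<bullet> (u - v))"

definition strongly_monotone :: "('a::real_inner \<Rightarrow> 'a set) \<Rightarrow> real \<Rightarrow> bool" where
  "strongly_monotone A \<mu> \<longleftrightarrow> uniformly_monotone A (\<lambda>t. \<mu> * t\<^sup>2)"

text \<open>For maximally monotone \<open>A\<close> and \<open>\<gamma> > 0\<close> the point described below exists uniquely.\<close>

definition resolvent :: "real \<Rightarrow> ('a::real_vector \<Rightarrow> 'a set) \<Rightarrow> 'a \<Rightarrow> 'a" where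
  "resolvent \<gamma> A x = (THE y. \<exists>u\<in>A y. x = y + \<gamma> *\<^sub>R u)"

section \<open>Decision-dependent equilibria\<close>

definition mean_map ::
    "('a \<Rightarrow> 'b \<Rightarrow> 'a::real_normed_vector) \<Rightarrow> 'b measure \<Rightarrow> 'a \<Rightarrow> 'a" where
  "mean_map B M y = vexpectation M (\<lambda>\<xi>. B y \<xi>)"

definition is_equilibrium ::
    "('a \<Rightarrow> 'a set) \<Rightarrow> ('a \<Rightarrow> 'b \<Rightarrow> 'a::real_normed_vector) \<Rightarrow> ('a \<Rightarrow> 'b measure) \<Rightarrow> 'a \<Rightarrow> bool" where
  "is_equilibrium A B m x \<longleftrightarrow> (\<exists>u\<in>A x. 0 = u + mean_map B (m x) x)"

definition equilibrium ::
    "('a \<Rightarrow> 'a set) \<Rightarrow> ('a \<Rightarrow> 'b \<Rightarrow> 'a::real_normed_vector) \<Rightarrow> ('a \<Rightarrow> 'b measure) \<Rightarrow> 'a" where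
  "equilibrium A B m = (THE x. is_equilibrium A B m x)"

definition T_op ::
    "('a \<Rightarrow> 'a set) \<Rightarrow> ('a \<Rightarrow> 'b \<Rightarrow> 'a::real_normed_vector) \<Rightarrow> 'b measure \<Rightarrow>
      real \<Rightarrow> real \<Rightarrow> 'a \<Rightarrow> 'a" where
  "T_op A B M lam \<gamma> x =
     (1 / lam) *\<^sub>R (x - resolvent \<gamma> A (x - \<gamma> *\<^sub>R mean_map B M x))"

definition gap ::
    "('a \<Rightarrow> 'a set) \<Rightarrow> ('a \<Rightarrow> 'b \<Rightarrow> 'a::real_normed_vector) \<Rightarrow> ('a \<Rightarrow> 'b measure) \<Rightarrow>
      'a \<Rightarrow> real \<Rightarrow> real \<Rightarrow> 'a \<Rightarrow> 'a" where
  "gap A B m xbar lam \<gamma> x = T_op A B (m x) lam \<gamma> x - T_op A B (m xbar) lam \<gamma> x"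

section \<open>Strong global solutions\<close>

definition absolutely_continuous_on_interval ::
    "(real \<Rightarrow> 'a::real_normed_vector) \<Rightarrow> real \<Rightarrow> real \<Rightarrow> bool" where
  "absolutely_continuous_on_interval f a b \<longleftrightarrow>
     (\<forall>\<epsilon>>0. \<exists>\<delta>>0. \<forall>(n::nat) l r.
        (\<forall>i<n. a \<le> l i \<and> l i \<le> r i \<and> r i \<le> b) \<and>
        (\<forall>i<n. \<forall>j<n. i \<noteq> j \<longrightarrow> {l i<..<r i} \<inter> {l j<..<r j} = {}) \<and>
        (\<Sum>i<n. r i - l i) < \<delta>
        \<longrightarrow> (\<Sum>i<n. norm (f (r i) - f (l i))) < \<epsilon>)"

definition locally_absolutely_continuous ::
    "real \<Rightarrow> (real \<Rightarrow> 'a::real_normed_vector) \<Rightarrow> bool" where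
  "locally_absolutely_continuous t0 f \<longleftrightarrow>
     (\<forall>a b. t0 \<le> a \<and> a \<le> b \<longrightarrow> absolutely_continuous_on_interval f a b)"

text \<open>
  The function \<open>v\<close> is the derivative of \<open>x\<close>, and \<open>a\<close>, \<open>p\<close>, \<open>q\<close> are the values of the second
  derivative of \<open>x\<close> and of the two time derivatives in the equation; all of them are required to
  exist, except that for \<open>\<omega> = 0\<close> the terms with factor \<open>\<omega>\<close> are absent from the equation.
  Derivatives are one-sided at \<open>t0\<close>, and only values on \<open>{t0..}\<close> matter.
\<close>

definition strong_global_solution ::
    "real \<Rightarrow> real \<Rightarrow> (real \<Rightarrow> real) \<Rightarrow> (real \<Rightarrow> real) \<Rightarrow> real \<Rightarrow>
      ('a \<Rightarrow> 'a set) \<Rightarrow> ('a \<Rightarrow> 'b \<Rightarrow> 'a::real_normed_vector) \<Rightarrow> ('a \<Rightarrow> 'b measure) \<Rightarrow> 'a \<Rightarrow>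
      (real \<Rightarrow> 'a) \<Rightarrow> bool" where
  "strong_global_solution t0 \<omega> \<nu> lam \<gamma> A B m xbar x \<longleftrightarrow>
     (\<exists>v. (\<forall>t\<ge>t0. (x has_vector_derivative v t) (at t within {t0..})) \<and>
          locally_absolutely_continuous t0 x \<and>
          locally_absolutely_continuous t0 v \<and>
          (AE t in lebesgue. t0 \<le> t \<longrightarrow>
             (\<exists>a p q.
                (v has_vector_derivative a) (at t within {t0..}) \<and>
                (\<omega> \<noteq> 0 \<longrightarrow>
                   ((\<lambda>s. T_op A B (m xbar) (lam s) \<gamma> (x s)) has_vector_derivative p)
                     (at t within {t0..}) \<and>
                   ((\<lambda>s. gap A B m xbar (lam s) \<gamma> (x s)) has_vector_derivative q)
                     (at t within {t0..})) \<and>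
                a + \<nu> t *\<^sub>R v t
                  + T_op A B (m xbar) (lam t) \<gamma> (x t) + \<omega> *\<^sub>R p
                  + gap A B m xbar (lam t) \<gamma> (x t) + \<omega> *\<^sub>R q = 0)))"

definition solves_initial_value_problem ::
    "real \<Rightarrow> real \<Rightarrow> (real \<Rightarrow> real) \<Rightarrow> (real \<Rightarrow> real) \<Rightarrow> real \<Rightarrow>
      ('a \<Rightarrow> 'a set) \<Rightarrow> ('a \<Rightarrow> 'b \<Rightarrow> 'a::real_normed_vector) \<Rightarrow> ('a \<Rightarrow> 'b measure) \<Rightarrow> 'a \<Rightarrow>
      'a \<Rightarrow> 'a \<Rightarrow> (real \<Rightarrow> 'a) \<Rightarrow> bool" where
  "solves_initial_value_problem t0 \<omega> \<nu> lam \<gamma> A B m xbar x0 u0 x \<longleftrightarrow>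
     strong_global_solution t0 \<omega> \<nu> lam \<gamma> A B m xbar x \<and>
     x t0 = x0 \<and> (x has_vector_derivative u0) (at t0 within {t0..})"

end

theory Submission
  imports Defs
begin

text \<open>
  Along a trajectory the two terms of the system combine to
  \<open>T\<^bsub>m xbar\<^esub> + E = T\<^bsub>m x\<^esub>\<close>, so with
  \<open>R x = x - J(x - \<gamma> B\<^bsub>m x\<^esub>(x))\<close> and \<open>\<Gamma>(t) = R(x(t)) / lam t\<close> the equation reads
  \<open>x'' + \<nu> x' + \<Gamma> + \<omega> \<Gamma>' = 0\<close>. The derivative of \<open>\<Gamma>\<close> disappears if \<open>w = x' + \<omega> \<Gamma>\<close>
  is taken as the second unknown: the pair \<open>(x, w)\<close> satisfies

    \<open>x' = w - \<omega> \<Gamma>\<close>,   \<open>w' = (\<omega> \<nu> - 1) \<Gamma> - \<nu> w\<close>.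

  This is a first order system whose right-hand side is Lipschitz in the state, with a modulus that
  is locally integrable in time. In a norm weighted by an exponential of the integrated modulus,
  the Picard operator halves distances, which gives exactly one continuous global solution of the
  integral equation (\<open>fixed_point_exists\<close>, \<open>fixed_point_unique\<close>).

  The residual \<open>R\<close> is Lipschitz for two reasons. The resolvent of a maximally monotone operator is
  everywhere defined and nonexpansive (\<open>Minty_surjectivity\<close>, \<open>resolvent_nonexpansive\<close>), and the
  mean \<open>B\<^bsub>m\<^esub>(y)\<close> depends Lipschitz continuously on the point \<open>y\<close> and, through the Wasserstein
  distance, on the measure \<open>m\<close> (\<open>mean_map_lipschitz\<close>).

  It remains to pass between the integral equation and the equation almost everywhere. From the
  former to the latter, if \<open>\<omega> \<noteq> 0\<close> then each of the two terms \<open>T\<close> and \<open>E\<close> must be differentiable at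
  almost every time. Along the trajectory they are absolutely continuous, and a function of bounded variation
  with values in a Hilbert space is differentiable almost everywhere
  (\<open>bounded_variation_ae_differentiable\<close>). That proof looks at the directions of the chords of the
  graph: a chord whose direction deviates from that of the chord over a larger interval costs arc
  length, so short chords with oscillating directions can only sit over a null set. In the other
  direction, an absolutely continuous function is recovered from its almost everywhere defined
  derivative (\<open>absolutely_continuous_fundamental_theorem\<close>).
\<close>

section \<open>Resolvents of maximally monotone operators\<close>

lemma convex_hull_induct_affine:
  assumes "z \<in> convex hull S" and "\<And>s. s \<in> S \<Longrightarrow> (0::real) \<le> g s"
    and affine: "\<And>a b v. g ((1 - v) *\<^sub>R a + v *\<^sub>R b) = (1 - v) * g a + v * g b"
  shows "0 \<le> g z"
proof -
  have "convex {z. 0 \<le> g z}"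
    unfolding convex_alt by (auto simp: affine)
  then have "convex hull S \<subseteq> {z. 0 \<le> g z}" using assms(2) by (intro hull_minimal) auto
  then show ?thesis using assms(1) by auto
qed

text \<open>
  The inequality \<open>C + C' \<ge> X \<bullet> U' + X' \<bullet> U\<close> is monotonicity when both triples come from the graph, and
  it is affine in each triple separately. So it extends to the hull in one variable and then in the
  other; the diagonal is the claim.
\<close>

lemma monotone_graph_hull:
  assumes A: "monotone_operator A"
    and z: "(X, U, C) \<in> convex hull {(x, u, x \<bullet> u) | x u. u \<in> A x}"
  shows "X \<bullet> U \<le> (C::real)"
proof -
  let ?S = "{(x, u, x \<bullet> u) | x u. u \<in> A x}"
  have 1: "0 \<le> C + x \<bullet> u - X \<bullet> u - x \<bullet> U" if "(X, U, C) \<in> convex hull ?S" "u \<in> A x" for X U C x u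
  proof -
    have "0 \<le> (\<lambda>(X, U, C). C + x \<bullet> u - X \<bullet> u - x \<bullet> U) (X, U, C)"
    proof (rule convex_hull_induct_affine[OF that(1)])
      fix s assume "s \<in> ?S"
      then obtain x' u' where s: "s = (x', u', x' \<bullet> u')" "u' \<in> A x'" by auto
      have "0 \<le> (x' - x) \<bullet> (u' - u)"
        using A that(2) s(2) unfolding monotone_operator_def by blast
      then show "0 \<le> (\<lambda>(X, U, C). C + x \<bullet> u - X \<bullet> u - x \<bullet> U) s"
        using s by (simp add: inner_diff_left inner_diff_right inner_commute)
    next
      fix a b v
      show "(\<lambda>(X, U, C). C + x \<bullet> u - X \<bullet> u - x \<bullet> U) ((1 - v) *\<^sub>R a + v *\<^sub>R b) =
          (1 - v) * (\<lambda>(X, U, C). C + x \<bullet> u - X \<bullet> u - x \<bullet> U) a + v * (\<lambda>(X, U, C). C + x \<bullet> u - X \<bullet> u - x \<bullet> U) b"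
        by (cases a; cases b) (simp add: inner_add_left inner_add_right algebra_simps)
    qed
    then show ?thesis by simp
  qed
  have 2: "0 \<le> C + C' - X \<bullet> U' - X' \<bullet> U"
    if h: "(X, U, C) \<in> convex hull ?S" "(X', U', C') \<in> convex hull ?S" for X U C X' U' C'
  proof -
    have "0 \<le> (\<lambda>(X', U', C'). C + C' - X \<bullet> U' - X' \<bullet> U) (X', U', C')"
    proof (rule convex_hull_induct_affine[OF h(2)])
      fix s assume "s \<in> ?S"
      then obtain x' u' where s: "s = (x', u', x' \<bullet> u')" "u' \<in> A x'" by auto
      show "0 \<le> (\<lambda>(X', U', C'). C + C' - X \<bullet> U' - X' \<bullet> U) s"
        using s 1[OF h(1) s(2)] by simp
    next
      fix a b v
      show "(\<lambda>(X', U', C'). C + C' - X \<bullet> U' - X' \<bullet> U) ((1 - v) *\<^sub>R a + v *\<^sub>R b) =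
          (1 - v) * (\<lambda>(X', U', C'). C + C' - X \<bullet> U' - X' \<bullet> U) a + v * (\<lambda>(X', U', C'). C + C' - X \<bullet> U' - X' \<bullet> U) b"
        by (cases a; cases b) (simp add: inner_add_left inner_add_right algebra_simps)
    qed
    then show ?thesis by simp
  qed
  show ?thesis using 2[OF z z] by (simp add: inner_commute)
qed

text \<open>
  Each pair of the graph confines \<open>y\<close> to a closed ball, and a common point of all these balls is
  found by minimisation. On the convex hull of the triples \<open>(x, u, x \<bullet> u)\<close> the function
  \<open>\<parallel>(X - U)/2\<parallel>\<^sup>2 + C\<close> is bounded below by \<open>\<parallel>(X + U)/2\<parallel>\<^sup>2 \<ge> 0\<close>, because \<open>C \<ge> X \<bullet> U\<close>, and it is
  strongly convex in \<open>Y = (X - U)/2\<close>. Hence \<open>Y\<close> converges along a minimising sequence, and the first order condition at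
  the limit \<open>y\<close>, taken in the direction of a point of the graph, is the condition on \<open>y\<close>.
\<close>

lemma monotonically_related_point:
  fixes A :: "'a::{real_inner, complete_space} \<Rightarrow> 'a set"
  assumes A: "monotone_operator A"
  obtains y where "\<And>x u. u \<in> A x \<Longrightarrow> 0 \<le> (x - y) \<bullet> (u + y)"
proof (cases "\<exists>x u. u \<in> A x")
  case False
  then show ?thesis using that by blast
next
  case True
  define S where "S = convex hull {(x, u, x \<bullet> u) | x u. u \<in> A x}"
  have cS: "convex S" unfolding S_def by simp
  have ne: "S \<noteq> {}" using True unfolding S_def by auto
  define Y where "Y = (\<lambda>(X, U, C::real). (1/2) *\<^sub>R (X - U) :: 'a)"
  define f where "f = (\<lambda>z. (norm (Y z))\<^sup>2 + snd (snd z))"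
  have f_nn: "0 \<le> f z" if "z \<in> S" for z
  proof -
    obtain X U C where z: "z = (X, U, C)" by (cases z)
    have "X \<bullet> U \<le> C" using monotone_graph_hull[OF A] that z unfolding S_def by blast
    moreover have "0 \<le> (X + U) \<bullet> (X + U)" by simp
    ultimately show ?thesis
      unfolding f_def Y_def z power2_norm_eq_inner
      by (simp add: inner_diff_left inner_diff_right inner_add_left inner_add_right inner_commute)
        (simp add: field_simps)
  qed
  have f_comb: "f ((1 - s) *\<^sub>R z + s *\<^sub>R z') = (1 - s) * f z + s * f z' - s * (1 - s) * (norm (Y z - Y z'))\<^sup>2"
    for s z z'
  proof -
    have Yc: "Y ((1 - s) *\<^sub>R z + s *\<^sub>R z') = (1 - s) *\<^sub>R Y z + s *\<^sub>R Y z'"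
      unfolding Y_def by (cases z; cases z') (simp add: scaleR_right_diff_distrib scaleR_right_distrib)
    show ?thesis unfolding f_def Yc power2_norm_eq_inner
      by (simp add: inner_diff_left inner_diff_right inner_add_left inner_add_right inner_commute
          power2_eq_square) (simp add: algebra_simps)
  qed
  define d where "d = Inf (f ` S)"
  have bdd: "bdd_below (f ` S)" using f_nn by (meson bdd_belowI2)
  have d_le: "d \<le> f z" if "z \<in> S" for z
    unfolding d_def using that bdd by (simp add: cInf_lower)
  have d_nn: "0 \<le> d" unfolding d_def using f_nn ne by (intro cInf_greatest) auto
  have "\<exists>z\<in>S. f z < d + 1 / Suc n" for n
  proof -
    have "Inf (f ` S) < d + 1 / Suc n" unfolding d_def by simp
    then show ?thesis using cInf_lessD[of "f ` S"] ne by auto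
  qed
  then obtain z where z: "\<And>n::nat. z n \<in> S" "\<And>n. f (z n) < d + 1 / Suc n" by metis
  have close: "(norm (Y (z i) - Y (z j)))\<^sup>2 \<le> 2 / Suc i + 2 / Suc j" for i j
  proof -
    have "(1 - 1/2) *\<^sub>R z i + (1/2) *\<^sub>R z j \<in> S"
      by (rule convexD[OF cS z(1) z(1)]) auto
    then have "d \<le> f ((1 - 1/2) *\<^sub>R z i + (1/2) *\<^sub>R z j)" by (rule d_le)
    also have "\<dots> = (1/2) * f (z i) + (1/2) * f (z j) - (1/4) * (norm (Y (z i) - Y (z j)))\<^sup>2"
      unfolding f_comb by simp
    also have "\<dots> \<le> (1/2) * (d + 1 / Suc i) + (1/2) * (d + 1 / Suc j) - (1/4) * (norm (Y (z i) - Y (z j)))\<^sup>2"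
      using z(2)[of i] z(2)[of j] by (intro diff_right_mono add_mono mult_left_mono) auto
    finally have *: "d \<le> (1/2) * (d + 1 / Suc i) + (1/2) * (d + 1 / Suc j) - (1/4) * (norm (Y (z i) - Y (z j)))\<^sup>2" .
    have "n \<le> 2 * p + 2 * q" if "d \<le> (1/2) * (d + p) + (1/2) * (d + q) - (1/4) * n" for n p q :: real
      using that by (simp add: field_simps)
    from this[OF *] show ?thesis by simp
  qed
  have "Cauchy (\<lambda>n. Y (z n))"
  proof (rule CauchyI)
    fix e :: real assume e: "0 < e"
    obtain N where N: "4 / real (Suc N) < e\<^sup>2"
      using reals_Archimedean[of "e\<^sup>2 / 4"] e by (auto simp: inverse_eq_divide field_simps)
    have "norm (Y (z i) - Y (z j)) < e" if "i \<ge> N" "j \<ge> N" for i j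
    proof -
      have "2 / real (Suc i) \<le> 2 / real (Suc N)" "2 / real (Suc j) \<le> 2 / real (Suc N)"
        using that by (auto intro!: divide_left_mono)
      then have "(norm (Y (z i) - Y (z j)))\<^sup>2 < e\<^sup>2" using close[of i j] N by linarith
      then show ?thesis using e by (simp add: power_less_imp_less_base)
    qed
    then show "\<exists>M. \<forall>m\<ge>M. \<forall>n\<ge>M. norm (Y (z m) - Y (z n)) < e" by blast
  qed
  then obtain y where y: "(\<lambda>n. Y (z n)) \<longlonglongrightarrow> y"
    using Cauchy_convergent_iff convergent_def by blast
  have fz: "(\<lambda>n. f (z n)) \<longlonglongrightarrow> d"
  proof (rule tendsto_sandwich[of "\<lambda>n. d" _ _ "\<lambda>n. d + 1 / Suc n"])
    show "(\<lambda>n. d + 1 / real (Suc n)) \<longlonglongrightarrow> d"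
      using tendsto_add[OF tendsto_const[of d] LIMSEQ_inverse_real_of_nat] by (simp add: inverse_eq_divide)
    show "\<forall>\<^sub>F n in sequentially. d \<le> f (z n)" by (intro always_eventually allI d_le z(1))
    show "\<forall>\<^sub>F n in sequentially. f (z n) \<le> d + 1 / real (Suc n)"
      by (intro always_eventually allI less_imp_le z(2))
  qed simp
  show ?thesis
  proof (rule that)
    fix x u assume u: "u \<in> A x"
    define p where "p = (x, u, x \<bullet> u)"
    have p: "p \<in> S" unfolding S_def p_def using u by (intro hull_inc) auto
    \<comment> \<open>Moving from the minimising sequence by a fraction \<open>s\<close> towards \<open>p\<close> cannot go below the infimum.\<close>
    have key: "0 \<le> f p - d - (1 - s) * (norm (y - Y p))\<^sup>2" if s: "0 < s" "s \<le> 1" for s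
    proof -
      have "d \<le> (1 - s) * f (z n) + s * f p - s * (1 - s) * (norm (Y (z n) - Y p))\<^sup>2" for n
      proof -
        have "(1 - s) *\<^sub>R z n + s *\<^sub>R p \<in> S"
          using convexD[OF cS z(1) p, of "1 - s" s] s by simp
        then show ?thesis using d_le[of "(1 - s) *\<^sub>R z n + s *\<^sub>R p"] unfolding f_comb by simp
      qed
      moreover have "(\<lambda>n. (1 - s) * f (z n) + s * f p - s * (1 - s) * (norm (Y (z n) - Y p))\<^sup>2)
          \<longlonglongrightarrow> (1 - s) * d + s * f p - s * (1 - s) * (norm (y - Y p))\<^sup>2"
        by (intro tendsto_intros fz y)
      ultimately have "d \<le> (1 - s) * d + s * f p - s * (1 - s) * (norm (y - Y p))\<^sup>2"
        by (intro LIMSEQ_le_const) auto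
      then have "0 \<le> s * (f p - d - (1 - s) * (norm (y - Y p))\<^sup>2)" by (simp add: algebra_simps)
      then show ?thesis using s by (simp add: zero_le_mult_iff)
    qed
    have "0 \<le> f p - d - (norm (y - Y p))\<^sup>2"
    proof (rule ccontr)
      assume "\<not> ?thesis"
      then have neg: "f p - d - (norm (y - Y p))\<^sup>2 < 0" by simp
      have "((\<lambda>s. f p - d - (1 - s) * (norm (y - Y p))\<^sup>2) \<longlongrightarrow> f p - d - (1 - 0) * (norm (y - Y p))\<^sup>2) (at_right 0)"
        by (intro tendsto_intros)
      moreover have "eventually (\<lambda>s. 0 \<le> f p - d - (1 - s) * (norm (y - Y p))\<^sup>2) (at_right 0)"
        using eventually_at_right_real[of 0 1, OF zero_less_one]
      proof eventually_elim
        fix s :: real assume "s \<in> {0<..<1}"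
        then show "0 \<le> f p - d - (1 - s) * (norm (y - Y p))\<^sup>2" by (intro key) auto
      qed
      ultimately have "0 \<le> f p - d - (1 - 0) * (norm (y - Y p))\<^sup>2"
        by (intro tendsto_lowerbound) auto
      then show False using neg by simp
    qed
    then have "0 \<le> f p - (norm (y - Y p))\<^sup>2" using d_nn by simp
    then show "0 \<le> (x - y) \<bullet> (u + y)"
      unfolding f_def Y_def p_def power2_norm_eq_inner
      by (simp add: inner_diff_left inner_diff_right inner_add_left inner_add_right inner_commute)
  qed
qed

text \<open>
  Solving \<open>x \<in> y + \<gamma> A y\<close> amounts to finding \<open>y\<close> such that \<open>(y, (x - y)/\<gamma>)\<close> is monotonically related
  to the graph of \<open>A\<close>, since by maximality such a pair already belongs to the graph.
\<close>

theorem Minty_surjectivity: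
  fixes A :: "'a::{real_inner, complete_space} \<Rightarrow> 'a set"
  assumes A: "maximally_monotone A" and \<gamma>: "0 < \<gamma>"
  obtains y u where "u \<in> A y" "x = y + \<gamma> *\<^sub>R u"
proof -
  have mono: "0 \<le> (x - y) \<bullet> (u - v)" if "u \<in> A x" "v \<in> A y" for x y u v
    using A that unfolding maximally_monotone_def monotone_operator_def by blast
  \<comment> \<open>Rescaling and translating the values reduces to \<open>\<gamma> = 1\<close> and \<open>x = 0\<close>.\<close>
  define A' where "A' = (\<lambda>y. (\<lambda>u. \<gamma> *\<^sub>R u - x) ` A y)"
  have "monotone_operator A'"
    unfolding monotone_operator_def A'_def
  proof (clarify)
    fix a b u v assume "u \<in> A a" "v \<in> A b"
    then have "0 \<le> \<gamma> * ((a - b) \<bullet> (u - v))" using mono \<gamma> by simp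
    then show "0 \<le> (a - b) \<bullet> (\<gamma> *\<^sub>R u - x - (\<gamma> *\<^sub>R v - x))"
      by (simp add: scaleR_diff_right[symmetric])
  qed
  then obtain y where y: "\<And>a u. u \<in> A' a \<Longrightarrow> 0 \<le> (a - y) \<bullet> (u + y)"
    using monotonically_related_point by blast
  define w where "w = (1 / \<gamma>) *\<^sub>R (x - y)"
  have rel: "0 \<le> (a - y) \<bullet> (u - w)" if "u \<in> A a" for a u
  proof -
    have "0 \<le> (a - y) \<bullet> (\<gamma> *\<^sub>R u - x + y)" using y[of "\<gamma> *\<^sub>R u - x" a] that unfolding A'_def by auto
    also have "\<gamma> *\<^sub>R u - x + y = \<gamma> *\<^sub>R (u - w)" unfolding w_def using \<gamma> by (simp add: algebra_simps)
    finally show ?thesis using \<gamma> by (simp add: zero_le_mult_iff)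
  qed
  define A'' where "A'' = (\<lambda>a. if a = y then insert w (A a) else A a)"
  have sub: "\<forall>x. A x \<subseteq> A'' x" unfolding A''_def by auto
  have "monotone_operator A''"
    unfolding monotone_operator_def
  proof (intro allI ballI)
    fix a b u v assume "u \<in> A'' a" "v \<in> A'' b"
    then have "u \<in> A a \<or> (a = y \<and> u = w)" "v \<in> A b \<or> (b = y \<and> v = w)"
      unfolding A''_def by (auto split: if_splits)
    moreover have "(y - b) \<bullet> (w - v) = (b - y) \<bullet> (v - w)"
      by (metis inner_minus_left inner_minus_right minus_diff_eq minus_minus)
    ultimately show "0 \<le> (a - b) \<bullet> (u - v)" using mono rel by auto
  qed
  with sub have "A'' = A" using A unfolding maximally_monotone_def by blast
  moreover have "w \<in> A'' y" unfolding A''_def by simp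
  ultimately have "w \<in> A y" by simp
  moreover have "x = y + \<gamma> *\<^sub>R w" unfolding w_def using \<gamma> by simp
  ultimately show ?thesis by (rule that)
qed

lemma monotone_resolvent_contraction:
  assumes "monotone_operator A" "0 < \<gamma>" "u \<in> A y" "u' \<in> A y'"
  shows "norm (y - y') \<le> norm ((y + \<gamma> *\<^sub>R u) - (y' + \<gamma> *\<^sub>R u'))"
proof -
  have "0 \<le> (y - y') \<bullet> (u - u')"
    using assms unfolding monotone_operator_def by blast
  then have "0 \<le> \<gamma> * ((y - y') \<bullet> (u - u'))" using assms(2) by simp
  then have "(norm (y - y'))\<^sup>2 \<le> (y - y') \<bullet> (y - y') + \<gamma> * ((y - y') \<bullet> (u - u'))"
    by (simp add: power2_norm_eq_inner)
  also have "\<dots> = (y - y') \<bullet> ((y + \<gamma> *\<^sub>R u) - (y' + \<gamma> *\<^sub>R u'))"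
    by (simp add: inner_diff_right inner_add_right algebra_simps)
  also have "\<dots> \<le> norm (y - y') * norm ((y + \<gamma> *\<^sub>R u) - (y' + \<gamma> *\<^sub>R u'))"
    by (rule norm_cauchy_schwarz)
  finally show ?thesis
    by (metis mult_le_cancel_left_pos norm_ge_zero norm_eq_zero power2_eq_square order.order_iff_strict)
qed

lemma resolvent_nonexpansive:
  fixes A :: "'a::{real_inner, complete_space} \<Rightarrow> 'a set"
  assumes A: "maximally_monotone A" and \<gamma>: "0 < \<gamma>"
  shows "norm (resolvent \<gamma> A x - resolvent \<gamma> A x') \<le> norm (x - x')"
proof -
  have mono: "monotone_operator A" using A unfolding maximally_monotone_def by blast
  have res: "\<exists>u\<in>A (resolvent \<gamma> A x). x = resolvent \<gamma> A x + \<gamma> *\<^sub>R u" for x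
    unfolding resolvent_def
  proof (rule theI')
    show "\<exists>!y. \<exists>u\<in>A y. x = y + \<gamma> *\<^sub>R u"
    proof (rule ex_ex1I)
      show "\<exists>y. \<exists>u\<in>A y. x = y + \<gamma> *\<^sub>R u" using Minty_surjectivity[OF A \<gamma>] by metis
    next
      fix y y' assume "\<exists>u\<in>A y. x = y + \<gamma> *\<^sub>R u" "\<exists>u\<in>A y'. x = y' + \<gamma> *\<^sub>R u"
      then obtain u u' where *: "u \<in> A y" "x = y + \<gamma> *\<^sub>R u" "u' \<in> A y'" "x = y' + \<gamma> *\<^sub>R u'" by blast
      have "norm (y - y') \<le> norm ((y + \<gamma> *\<^sub>R u) - (y' + \<gamma> *\<^sub>R u'))"
        by (rule monotone_resolvent_contraction[OF mono \<gamma> *(1,3)])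
      then show "y = y'" unfolding *(2,4)[symmetric] by simp
    qed
  qed
  obtain u u' where "u \<in> A (resolvent \<gamma> A x)" "x = resolvent \<gamma> A x + \<gamma> *\<^sub>R u"
     "u' \<in> A (resolvent \<gamma> A x')" "x' = resolvent \<gamma> A x' + \<gamma> *\<^sub>R u'" using res by blast
  then show ?thesis using monotone_resolvent_contraction[OF mono \<gamma>] by metis
qed

section \<open>Expectations of Lipschitz maps\<close>

lemma simple_bochner_integrable_iff_simple_function:
  assumes "finite_measure M"
  shows "Bochner_Integration.simple_bochner_integrable M s \<longleftrightarrow> simple_function M s"
  using assms finite_measure.emeasure_finite[OF assms]
  by (auto simp: Bochner_Integration.simple_bochner_integrable.simps)

text \<open>
  In a nonseparable space the difference of two measurable maps may fail to be measurable. A simple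
  map takes finitely many values, so the difference can be treated value by value.
\<close>

lemma borel_measurable_norm_diff_simple:
  fixes f :: "'b \<Rightarrow> 'a::real_normed_vector"
  assumes f: "f \<in> borel_measurable M" and s: "simple_function M s"
  shows "(\<lambda>\<xi>. norm (f \<xi> - s \<xi>)) \<in> borel_measurable M"
proof (rule measurable_compose_countable'[where I = "s ` space M" and g = s])
  show "countable (s ` space M)" using s by (simp add: simple_function_def countable_finite)
  show "s \<in> measurable M (count_space (s ` space M))"
    using s by (simp add: simple_function_def measurable_count_space_eq2)
next
  fix c :: 'a
  have "(\<lambda>v. norm (v - c)) \<in> borel_measurable borel"
    by (intro borel_measurable_continuous_onI continuous_intros)
  from measurable_compose[OF f this] show "(\<lambda>\<xi>. norm (f \<xi> - c)) \<in> borel_measurable M" .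
qed

lemma nn_integral_simple_diff_le:
  fixes f :: "'b \<Rightarrow> 'a::real_normed_vector"
  assumes f: "f \<in> borel_measurable M" and fin: "finite_measure M"
    and s: "simple_function M s" and t: "simple_function M t"
  shows "ennreal (norm (Bochner_Integration.simple_bochner_integral M s - Bochner_Integration.simple_bochner_integral M t))
    \<le> (\<integral>\<^sup>+\<xi>. norm (f \<xi> - s \<xi>) \<partial>M) + (\<integral>\<^sup>+\<xi>. norm (f \<xi> - t \<xi>) \<partial>M)"
proof -
  note sb = simple_bochner_integrable_iff_simple_function[OF fin]
  have st: "Bochner_Integration.simple_bochner_integrable M s" "Bochner_Integration.simple_bochner_integrable M t"
    using s t sb by auto
  have d: "Bochner_Integration.simple_bochner_integrable M (\<lambda>x. s x - t x)"
    using Bochner_Integration.simple_bochner_integrable_compose2[of "(-)" M s t] st by simp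
  have dn: "Bochner_Integration.simple_bochner_integrable M (\<lambda>x. norm (s x - t x))"
    using Bochner_Integration.simple_bochner_integrable_compose2[of "\<lambda>x y. norm (x - y)" M s t] st by simp
  have "ennreal (norm (Bochner_Integration.simple_bochner_integral M s - Bochner_Integration.simple_bochner_integral M t))
      \<le> ennreal (Bochner_Integration.simple_bochner_integral M (\<lambda>x. norm (s x - t x)))"
    unfolding Bochner_Integration.simple_bochner_integral_diff[OF st, symmetric]
    by (intro ennreal_leI Bochner_Integration.simple_bochner_integral_norm_bound d)
  also have "\<dots> = (\<integral>\<^sup>+x. norm (s x - t x) \<partial>M)"
    by (intro Bochner_Integration.simple_bochner_integral_eq_nn_integral dn) simp
  also have "\<dots> \<le> (\<integral>\<^sup>+x. ennreal (norm (f x - s x)) + ennreal (norm (f x - t x)) \<partial>M)"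
  proof (intro nn_integral_mono)
    fix x
    have "norm (s x - t x) \<le> norm (f x - s x) + norm (f x - t x)"
      by (metis norm_minus_commute norm_diff_triangle_le order_refl)
    then show "ennreal (norm (s x - t x)) \<le> ennreal (norm (f x - s x)) + ennreal (norm (f x - t x))"
      by (simp flip: ennreal_plus)
  qed
  also have "\<dots> = (\<integral>\<^sup>+\<xi>. norm (f \<xi> - s \<xi>) \<partial>M) + (\<integral>\<^sup>+\<xi>. norm (f \<xi> - t \<xi>) \<partial>M)"
    using borel_measurable_norm_diff_simple[OF f s] borel_measurable_norm_diff_simple[OF f t]
    by (intro nn_integral_add) auto
  finally show ?thesis .
qed

text \<open>
  Testing against vectors reduces all later statements about expectations in the Hilbert space to
  real integrals.
\<close>

lemma has_expectation_inner:
  fixes f :: "'b \<Rightarrow> 'a::real_inner"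
  assumes "has_expectation M f v" and fin: "finite_measure M"
  shows "has_bochner_integral M (\<lambda>\<xi>. f \<xi> \<bullet> y) (v \<bullet> y)"
proof -
  obtain s where f: "f \<in> borel_measurable M"
    and s: "\<And>i. Bochner_Integration.simple_bochner_integrable M (s i)"
    and lim: "(\<lambda>i. \<integral>\<^sup>+\<xi>. ennreal (norm (f \<xi> - s i \<xi>)) \<partial>M) \<longlonglongrightarrow> 0"
    and v: "(\<lambda>i. Bochner_Integration.simple_bochner_integral M (s i)) \<longlonglongrightarrow> v"
    using assms(1) unfolding has_expectation_def by blast
  have ss: "simple_function M (s i)" for i
    using s simple_bochner_integrable_iff_simple_function[OF fin] by blast
  show ?thesis
  proof (rule has_bochner_integral.intros[where s = "\<lambda>i \<xi>. s i \<xi> \<bullet> y"])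
    have "(\<lambda>v. v \<bullet> y) \<in> borel_measurable borel"
      by (intro borel_measurable_continuous_onI continuous_intros)
    from measurable_compose[OF f this] show "(\<lambda>\<xi>. f \<xi> \<bullet> y) \<in> borel_measurable M" .
    show "Bochner_Integration.simple_bochner_integrable M (\<lambda>\<xi>. s i \<xi> \<bullet> y)" for i
      using Bochner_Integration.simple_bochner_integrable_compose2[of "\<lambda>a b. a \<bullet> y" M "s i" "s i"] s by simp
    have "Bochner_Integration.simple_bochner_integral M (\<lambda>\<xi>. s i \<xi> \<bullet> y)
        = Bochner_Integration.simple_bochner_integral M (s i) \<bullet> y" for i
      using Bochner_Integration.simple_bochner_integral_linear[OF _ s, of "\<lambda>a. a \<bullet> y"]
        bounded_linear.linear[OF bounded_linear_inner_left] by blast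
    then show "(\<lambda>i. Bochner_Integration.simple_bochner_integral M (\<lambda>\<xi>. s i \<xi> \<bullet> y)) \<longlonglongrightarrow> v \<bullet> y"
      using tendsto_inner[OF v tendsto_const] by simp
    show "(\<lambda>i. \<integral>\<^sup>+ \<xi>. ennreal (norm (f \<xi> \<bullet> y - s i \<xi> \<bullet> y)) \<partial>M) \<longlonglongrightarrow> 0"
    proof (rule tendsto_sandwich[of "\<lambda>_. 0" _ _ "\<lambda>i. ennreal (norm y) * (\<integral>\<^sup>+\<xi>. ennreal (norm (f \<xi> - s i \<xi>)) \<partial>M)"])
      show "\<forall>\<^sub>F i in sequentially. (\<integral>\<^sup>+ \<xi>. ennreal (norm (f \<xi> \<bullet> y - s i \<xi> \<bullet> y)) \<partial>M)
          \<le> ennreal (norm y) * (\<integral>\<^sup>+\<xi>. ennreal (norm (f \<xi> - s i \<xi>)) \<partial>M)"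
      proof (intro always_eventually allI)
        fix i
        have "(\<integral>\<^sup>+ \<xi>. ennreal (norm (f \<xi> \<bullet> y - s i \<xi> \<bullet> y)) \<partial>M)
            \<le> (\<integral>\<^sup>+\<xi>. ennreal (norm y) * ennreal (norm (f \<xi> - s i \<xi>)) \<partial>M)"
        proof (intro nn_integral_mono)
          fix \<xi>
          have "norm (f \<xi> \<bullet> y - s i \<xi> \<bullet> y) \<le> norm y * norm (f \<xi> - s i \<xi>)"
            by (metis Cauchy_Schwarz_ineq2 inner_diff_left mult.commute real_norm_def)
          then show "ennreal (norm (f \<xi> \<bullet> y - s i \<xi> \<bullet> y)) \<le> ennreal (norm y) * ennreal (norm (f \<xi> - s i \<xi>))"
            by (simp add: ennreal_mult[symmetric] ennreal_leI)
        qed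
        also have "\<dots> = ennreal (norm y) * (\<integral>\<^sup>+\<xi>. ennreal (norm (f \<xi> - s i \<xi>)) \<partial>M)"
          using borel_measurable_norm_diff_simple[OF f ss] by (intro nn_integral_cmult) auto
        finally show "(\<integral>\<^sup>+ \<xi>. ennreal (norm (f \<xi> \<bullet> y - s i \<xi> \<bullet> y)) \<partial>M)
            \<le> ennreal (norm y) * (\<integral>\<^sup>+\<xi>. ennreal (norm (f \<xi> - s i \<xi>)) \<partial>M)" .
      qed
      have "(\<lambda>i. ennreal (norm y) * (\<integral>\<^sup>+\<xi>. ennreal (norm (f \<xi> - s i \<xi>)) \<partial>M)) \<longlonglongrightarrow> ennreal (norm y) * 0"
        by (intro ennreal_tendsto_cmult lim) simp
      then show "(\<lambda>i. ennreal (norm y) * (\<integral>\<^sup>+\<xi>. ennreal (norm (f \<xi> - s i \<xi>)) \<partial>M)) \<longlonglongrightarrow> 0" by simp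
    qed auto
  qed
qed

lemma has_expectation_unique:
  fixes f :: "'b \<Rightarrow> 'a::real_inner"
  assumes "has_expectation M f v" "has_expectation M f w" and fin: "finite_measure M"
  shows "v = w"
proof -
  have "v \<bullet> (v - w) = w \<bullet> (v - w)"
    using has_expectation_inner[OF assms(1) fin] has_expectation_inner[OF assms(2) fin]
    by (metis has_bochner_integral_eq)
  then have "(v - w) \<bullet> (v - w) = 0" by (simp add: inner_diff_left)
  then show ?thesis by simp
qed

lemma vexpectation_eq:
  fixes f :: "'b \<Rightarrow> 'a::real_inner"
  assumes "has_expectation M f v" "finite_measure M"
  shows "vexpectation M f = v"
  unfolding vexpectation_def using has_expectation_unique[OF _ assms(1) assms(2)] assms(1) by blast

text \<open>
  The integrals of the approximating simple maps form a Cauchy sequence, because they differ by at most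
  the sum of the two approximation errors; completeness provides the expectation.
\<close>

lemma has_expectationI_approx:
  fixes f :: "'b \<Rightarrow> 'a::{real_normed_vector, complete_space}"
  assumes f: "f \<in> borel_measurable M" and fin: "finite_measure M"
    and approx: "\<And>e. 0 < e \<Longrightarrow> \<exists>s. simple_function M s \<and> (\<integral>\<^sup>+\<xi>. ennreal (norm (f \<xi> - s \<xi>)) \<partial>M) \<le> ennreal e"
  shows "\<exists>v. has_expectation M f v"
proof -
  note sb = simple_bochner_integrable_iff_simple_function[OF fin]
  have "\<exists>s. simple_function M s \<and> (\<integral>\<^sup>+\<xi>. ennreal (norm (f \<xi> - s \<xi>)) \<partial>M) \<le> ennreal (1 / Suc n)" for n
    by (rule approx) simp
  then obtain s where s: "\<And>n. simple_function M (s n)"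
      "\<And>n. (\<integral>\<^sup>+\<xi>. ennreal (norm (f \<xi> - s n \<xi>)) \<partial>M) \<le> ennreal (1 / Suc n)" by metis
  let ?I = "\<lambda>n. Bochner_Integration.simple_bochner_integral M (s n)"
  have close: "norm (?I i - ?I j) \<le> 1 / Suc i + 1 / Suc j" for i j
  proof -
    have "ennreal (norm (?I i - ?I j)) \<le> ennreal (1 / Suc i) + ennreal (1 / Suc j)"
      using nn_integral_simple_diff_le[OF f fin s(1) s(1), of i j] s(2)[of i] s(2)[of j]
      by (meson add_mono order_trans)
    then show ?thesis by (simp flip: ennreal_plus)
  qed
  have "Cauchy ?I"
  proof (rule CauchyI)
    fix e :: real assume e: "0 < e"
    obtain N where N: "2 / real (Suc N) < e"
      using reals_Archimedean[of "e / 2"] e by (auto simp: inverse_eq_divide field_simps)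
    have "norm (?I i - ?I j) < e" if "i \<ge> N" "j \<ge> N" for i j
    proof -
      have "1 / real (Suc i) \<le> 1 / real (Suc N)" "1 / real (Suc j) \<le> 1 / real (Suc N)"
        using that by (auto intro!: divide_left_mono)
      then show ?thesis using close[of i j] N by linarith
    qed
    then show "\<exists>M. \<forall>m\<ge>M. \<forall>n\<ge>M. norm (?I m - ?I n) < e" by blast
  qed
  then obtain v where v: "?I \<longlonglongrightarrow> v"
    using Cauchy_convergent_iff convergent_def by blast
  have "(\<lambda>n. ennreal (1 / Suc n)) \<longlonglongrightarrow> ennreal 0"
    using LIMSEQ_inverse_real_of_nat by (intro tendsto_ennrealI) (simp add: inverse_eq_divide)
  then have lim: "(\<lambda>n. ennreal (1 / Suc n)) \<longlonglongrightarrow> 0" by simp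
  have "(\<lambda>n. \<integral>\<^sup>+\<xi>. ennreal (norm (f \<xi> - s n \<xi>)) \<partial>M) \<longlonglongrightarrow> 0"
    by (rule tendsto_sandwich[OF _ _ tendsto_const lim]) (intro always_eventually allI zero_le s(2))+
  then have "has_expectation M f v"
    unfolding has_expectation_def using f s(1) sb v by blast
  then show ?thesis ..
qed

text \<open>
  The space of \<open>\<xi>\<close> has a countable dense sequence. Replacing \<open>\<xi>\<close> by the first member of the sequence
  within distance \<open>r\<close> changes \<open>f\<close> by at most \<open>\<beta> r\<close>, and cutting off all but finitely many indices
  leaves a simple map. The error of the cut-off is the integral of \<open>\<parallel>f\<parallel>\<close> over shrinking sets, which
  tends to 0 because \<open>\<parallel>f\<parallel> / \<beta>\<close> is 1-Lipschitz and hence integrable.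
\<close>

lemma lipschitz_has_expectation:
  fixes f :: "'b::polish_space \<Rightarrow> 'a::{real_inner, complete_space}"
  assumes prob: "prob_space M" and sets: "sets M = sets borel"
    and lip: "\<beta>-lipschitz_on UNIV f" and \<beta>: "0 < \<beta>"
    and mom: "\<And>h :: 'b \<Rightarrow> real. 1-lipschitz_on UNIV h \<Longrightarrow> integrable M h"
  shows "\<exists>v. has_expectation M f v"
proof -
  interpret prob_space M by fact
  have sp: "space M = UNIV" using sets_eq_imp_space_eq[OF sets] by simp
  have fc: "continuous_on UNIV f" using lip by (rule lipschitz_on_continuous_on)
  have f: "f \<in> borel_measurable M"
    using borel_measurable_continuous_onI[OF fc] measurable_cong_sets[OF sets refl] by blast
  have int_norm: "integrable M (\<lambda>\<xi>. norm (f \<xi>))"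
  proof -
    have "1-lipschitz_on UNIV (\<lambda>\<xi>. norm (f \<xi>) / \<beta>)"
    proof (rule lipschitz_onI)
      fix x y :: 'b
      have "\<bar>norm (f x) - norm (f y)\<bar> \<le> \<beta> * dist x y"
        using norm_triangle_ineq3[of "f x" "f y"] lipschitz_onD[OF lip, of x y] by (simp add: dist_norm)
      then show "dist (norm (f x) / \<beta>) (norm (f y) / \<beta>) \<le> 1 * dist x y"
        using \<beta> by (simp add: dist_real_def divide_simps mult.commute flip: diff_divide_distrib)
    qed simp
    from integrable_mult_right[OF mom[OF this], of \<beta>] show ?thesis using \<beta> by simp
  qed
  obtain D :: "'b set" where D: "countable D" "\<And>X. open X \<Longrightarrow> X \<noteq> {} \<Longrightarrow> \<exists>d\<in>D. d \<in> X"
    by (rule countable_dense_setE) blast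
  have Dne: "D \<noteq> {}" using D(2)[of UNIV] by auto
  define d where "d = from_nat_into D"
  have dense: "\<exists>k. dist \<xi> (d k) < r" if "0 < r" for \<xi> r
  proof -
    have "\<exists>x\<in>D. x \<in> ball \<xi> r" by (rule D(2)) (use that in auto)
    then obtain x where x: "x \<in> D" "x \<in> ball \<xi> r" by blast
    have "d (to_nat_on D x) = x" unfolding d_def by (rule from_nat_into_to_nat_on[OF D(1) x(1)])
    then show ?thesis using x(2) by (intro exI[of _ "to_nat_on D x"]) simp
  qed
  show ?thesis
  proof (rule has_expectationI_approx[OF f finite_measure_axioms])
    fix e :: real assume e: "0 < e"
    define r where "r = e / (2 * \<beta>)"
    have r: "0 < r" unfolding r_def using e \<beta> by simp
    define k where "k = (\<lambda>\<xi>. LEAST k. dist \<xi> (d k) < r)"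
    have k: "dist \<xi> (d (k \<xi>)) < r" for \<xi>
      unfolding k_def by (rule LeastI_ex) (rule dense[OF r])
    have km: "k \<in> measurable M (count_space UNIV)"
      unfolding k_def
    proof (rule measurable_Least)
      fix i
      have "{\<xi>. dist \<xi> (d i) < r} \<in> sets borel"
        by (intro borel_open open_Collect_less continuous_intros)
      then show "(\<lambda>\<xi>. dist \<xi> (d i) < r) \<in> measurable M (count_space UNIV)"
        by (simp add: pred_def sp sets)
    qed
    define s where "s = (\<lambda>n \<xi>. if k \<xi> < n then f (d (k \<xi>)) else 0)"
    have s: "simple_function M (s n)" for n
    proof -
      have sub: "range (s n) \<subseteq> insert 0 ((\<lambda>i. f (d i)) ` {..<n})" unfolding s_def by auto
      have "finite (range (s n))" by (rule finite_subset[OF sub]) auto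
      moreover have "s n -` {x} \<inter> space M \<in> sets M" for x
      proof -
        have eq: "s n -` {x} \<inter> space M = k -` {i. (if i < n then f (d i) else 0) = x} \<inter> space M"
          unfolding s_def by auto
        show ?thesis unfolding eq by (rule measurable_sets[OF km]) simp
      qed
      ultimately show ?thesis unfolding simple_function_def sp by simp
    qed
    have km': "{\<xi>. n \<le> k \<xi>} \<in> sets M" for n
    proof -
      have "k -` {n..} \<inter> space M \<in> sets M" using measurable_sets[OF km] by simp
      moreover have "k -` {n..} \<inter> space M = {\<xi>. n \<le> k \<xi>}" using sp by auto
      ultimately show ?thesis by simp
    qed
    have "(\<lambda>n. \<integral>\<xi>. indicator {\<xi>. n \<le> k \<xi>} \<xi> * norm (f \<xi>) \<partial>M) \<longlonglongrightarrow> (\<integral>\<xi>. 0 \<partial>M)"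
    proof (rule integral_dominated_convergence[where w = "\<lambda>\<xi>. norm (f \<xi>)"])
      show "AE \<xi> in M. (\<lambda>n. indicator {\<xi>. n \<le> k \<xi>} \<xi> * norm (f \<xi>)) \<longlonglongrightarrow> 0"
      proof (rule AE_I2)
        fix \<xi>
        have "eventually (\<lambda>n. indicator {\<xi>. n \<le> k \<xi>} \<xi> * norm (f \<xi>) = 0) sequentially"
          using eventually_gt_at_top[of "k \<xi>"] by eventually_elim auto
        then show "(\<lambda>n. indicator {\<xi>. n \<le> k \<xi>} \<xi> * norm (f \<xi>)) \<longlonglongrightarrow> 0"
          by (rule tendsto_eventually)
      qed
      show "AE \<xi> in M. norm (indicator {\<xi>. n \<le> k \<xi>} \<xi> * norm (f \<xi>)) \<le> norm (f \<xi>)" for n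
        by (auto split: split_indicator)
      show "(\<lambda>\<xi>. indicator {\<xi>. n \<le> k \<xi>} \<xi> * norm (f \<xi>)) \<in> borel_measurable M" for n
        using borel_measurable_integrable[OF int_norm] km' by (intro borel_measurable_times) auto
    qed (use int_norm in auto)
    then have "(\<lambda>n. \<integral>\<xi>. indicator {\<xi>. n \<le> k \<xi>} \<xi> * norm (f \<xi>) \<partial>M) \<longlonglongrightarrow> 0" by simp
    from order_tendstoD(2)[OF this, of "e / 2"] e
    obtain n where n: "(\<integral>\<xi>. indicator {\<xi>. n \<le> k \<xi>} \<xi> * norm (f \<xi>) \<partial>M) < e / 2"
      by (auto simp: eventually_sequentially)
    have int_i: "integrable M (\<lambda>\<xi>. indicator {\<xi>. n \<le> k \<xi>} \<xi> * norm (f \<xi>))"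
      using integrable_real_mult_indicator[OF km' int_norm, of n] by (simp add: mult.commute)
    have "(\<integral>\<^sup>+\<xi>. ennreal (norm (f \<xi> - s n \<xi>)) \<partial>M)
        \<le> (\<integral>\<^sup>+\<xi>. ennreal (e / 2 + indicator {\<xi>. n \<le> k \<xi>} \<xi> * norm (f \<xi>)) \<partial>M)"
    proof (intro nn_integral_mono ennreal_leI)
      fix \<xi>
      have "norm (f \<xi> - f (d (k \<xi>))) \<le> \<beta> * dist \<xi> (d (k \<xi>))"
        using lipschitz_onD[OF lip, of \<xi> "d (k \<xi>)"] by (simp add: dist_norm)
      also have "\<dots> \<le> \<beta> * r" using k[of \<xi>] \<beta> by (intro mult_left_mono) auto
      also have "\<dots> = e / 2" unfolding r_def using \<beta> by simp
      finally show "norm (f \<xi> - s n \<xi>) \<le> e / 2 + indicator {\<xi>. n \<le> k \<xi>} \<xi> * norm (f \<xi>)"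
        unfolding s_def using e by (auto split: split_indicator)
    qed
    also have "\<dots> = ennreal (\<integral>\<xi>. e / 2 + indicator {\<xi>. n \<le> k \<xi>} \<xi> * norm (f \<xi>) \<partial>M)"
      using e int_i by (intro nn_integral_eq_integral) auto
    also have "(\<integral>\<xi>. e / 2 + indicator {\<xi>. n \<le> k \<xi>} \<xi> * norm (f \<xi>) \<partial>M)
        = e / 2 + (\<integral>\<xi>. indicator {\<xi>. n \<le> k \<xi>} \<xi> * norm (f \<xi>) \<partial>M)"
      using int_i by (simp add: prob_space)
    also have "ennreal (e / 2 + (\<integral>\<xi>. indicator {\<xi>. n \<le> k \<xi>} \<xi> * norm (f \<xi>) \<partial>M)) \<le> ennreal e"
      using n by (intro ennreal_leI) simp
    finally show "\<exists>s. simple_function M s \<and> (\<integral>\<^sup>+\<xi>. ennreal (norm (f \<xi> - s \<xi>)) \<partial>M) \<le> ennreal e"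
      using s by blast
  qed
qed

section \<open>Lipschitz dependence of the residual\<close>

lemma wasserstein1_leD:
  assumes "wasserstein1 M N \<le> ennreal r" and "0 \<le> r" and "1-lipschitz_on UNIV h"
  shows "integrable M h" "integrable N h" "\<bar>(\<integral>\<xi>. h \<xi> \<partial>M) - (\<integral>\<eta>. h \<eta> \<partial>N)\<bar> \<le> r"
proof -
  have le: "(if integrable M h \<and> integrable N h
      then ennreal \<bar>(\<integral>\<xi>. h \<xi> \<partial>M) - (\<integral>\<eta>. h \<eta> \<partial>N)\<bar> else \<infinity>) \<le> ennreal r"
    by (rule order_trans[OF _ assms(1)], unfold wasserstein1_def, rule SUP_upper) (use assms(3) in simp)
  then show 1: "integrable M h" "integrable N h" by (auto split: if_splits simp: top_unique)
  show "\<bar>(\<integral>\<xi>. h \<xi> \<partial>M) - (\<integral>\<eta>. h \<eta> \<partial>N)\<bar> \<le> r"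
    using le 1 assms(2) by simp
qed

lemma has_expectation_diff_le:
  fixes f g :: "'b \<Rightarrow> 'a::real_inner"
  assumes "prob_space M" and f: "has_expectation M f v" and g: "has_expectation M g w"
    and le: "AE \<xi> in M. norm (f \<xi> - g \<xi>) \<le> C"
  shows "norm (v - w) \<le> C"
proof (cases "v = w")
  case True
  interpret prob_space M by fact
  have "AE \<xi> in M. 0 \<le> C" using le by eventually_elim (metis norm_ge_zero order_trans)
  then show ?thesis using True by simp
next
  case False
  interpret prob_space M by fact
  define u where "u = v - w"
  have "has_bochner_integral M (\<lambda>\<xi>. f \<xi> \<bullet> u - g \<xi> \<bullet> u) (v \<bullet> u - w \<bullet> u)"
    using has_expectation_inner[OF f finite_measure_axioms] has_expectation_inner[OF g finite_measure_axioms]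
    by (rule has_bochner_integral_diff)
  then have i: "integrable M (\<lambda>\<xi>. f \<xi> \<bullet> u - g \<xi> \<bullet> u)"
      and e: "(\<integral>\<xi>. f \<xi> \<bullet> u - g \<xi> \<bullet> u \<partial>M) = u \<bullet> u"
    unfolding has_bochner_integral_iff u_def by (auto simp: inner_diff_left)
  have "(\<integral>\<xi>. f \<xi> \<bullet> u - g \<xi> \<bullet> u \<partial>M) \<le> (\<integral>\<xi>. C * norm u \<partial>M)"
  proof (intro integral_mono_AE i)
    show "AE \<xi> in M. f \<xi> \<bullet> u - g \<xi> \<bullet> u \<le> C * norm u"
      using le
    proof eventually_elim
      fix \<xi> assume "norm (f \<xi> - g \<xi>) \<le> C"
      then have "norm (f \<xi> - g \<xi>) * norm u \<le> C * norm u" by (intro mult_right_mono) auto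
      then show "f \<xi> \<bullet> u - g \<xi> \<bullet> u \<le> C * norm u"
        using norm_cauchy_schwarz[of "f \<xi> - g \<xi>" u] by (simp add: inner_diff_left)
    qed
  qed simp
  then have "norm u * norm u \<le> C * norm u"
    unfolding e by (simp add: prob_space power2_norm_eq_inner[symmetric] power2_eq_square)
  then show ?thesis using False unfolding u_def by simp
qed

text \<open>
  For \<open>u = v - w\<close>, the function \<open>f \<bullet> u / (\<beta> \<parallel>u\<parallel>)\<close> is 1-Lipschitz, so it competes in the supremum
  that defines the distance; its means differ by \<open>\<parallel>v - w\<parallel> / \<beta>\<close>.
\<close>

lemma has_expectation_wasserstein1_le:
  fixes f :: "'b::metric_space \<Rightarrow> 'a::real_inner"
  assumes "finite_measure M" "finite_measure N"
    and M: "has_expectation M f v" and N: "has_expectation N f w"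
    and lip: "\<beta>-lipschitz_on UNIV f" and \<beta>: "0 < \<beta>"
    and W: "wasserstein1 M N \<le> ennreal r" and r: "0 \<le> r"
  shows "norm (v - w) \<le> \<beta> * r"
proof (cases "v = w")
  case True
  then show ?thesis using \<beta> r by simp
next
  case False
  define u where "u = v - w"
  have u: "0 < norm u" using False unfolding u_def by simp
  have bu: "0 < \<beta> * norm u" using u \<beta> by simp
  define h where "h = (\<lambda>\<xi>. (f \<xi> \<bullet> u) / (\<beta> * norm u))"
  have "1-lipschitz_on UNIV h"
  proof (rule lipschitz_onI)
    fix x y :: 'b
    have "\<bar>(f x - f y) \<bullet> u\<bar> \<le> norm (f x - f y) * norm u" by (rule Cauchy_Schwarz_ineq2)
    also have "\<dots> \<le> (\<beta> * dist x y) * norm u"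
      using lipschitz_onD[OF lip, of x y] by (intro mult_right_mono) (auto simp: dist_norm)
    finally have "\<bar>f x \<bullet> u - f y \<bullet> u\<bar> \<le> dist x y * (\<beta> * norm u)" by (simp add: inner_diff_left mult_ac)
    then show "dist (h x) (h y) \<le> 1 * dist x y"
      unfolding h_def dist_real_def diff_divide_distrib[symmetric] abs_divide abs_of_pos[OF bu]
      using bu by (simp add: pos_divide_le_eq)
  qed simp
  from wasserstein1_leD(3)[OF W r this]
  have "\<bar>(\<integral>\<xi>. h \<xi> \<partial>M) - (\<integral>\<eta>. h \<eta> \<partial>N)\<bar> \<le> r" .
  moreover have "(\<integral>\<xi>. h \<xi> \<partial>M) = (v \<bullet> u) / (\<beta> * norm u)" "(\<integral>\<xi>. h \<xi> \<partial>N) = (w \<bullet> u) / (\<beta> * norm u)"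
    using has_expectation_inner[OF M assms(1), of u] has_expectation_inner[OF N assms(2), of u]
    unfolding h_def has_bochner_integral_iff by simp_all
  moreover have "(u \<bullet> u) / (\<beta> * norm u) = (v \<bullet> u) / (\<beta> * norm u) - (w \<bullet> u) / (\<beta> * norm u)"
    by (simp add: u_def inner_diff_left diff_divide_distrib)
  ultimately have "(u \<bullet> u) / (\<beta> * norm u) \<le> r" by linarith
  then have "u \<bullet> u \<le> r * (\<beta> * norm u)" using bu by (simp add: pos_divide_le_eq)
  then have "norm u * norm u \<le> (\<beta> * r) * norm u"
    by (simp add: power2_norm_eq_inner[symmetric] power2_eq_square mult_ac)
  then show ?thesis using u unfolding u_def by simp
qed

text \<open>
  The measure is compared with itself first: \<open>wasserstein1 (m x) (m x)\<close> is finite, so all Lipschitz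
  functions are integrable and the expectations exist.
\<close>

lemma mean_map_lipschitz:
  fixes B :: "'a::{real_inner, complete_space} \<Rightarrow> 'b::polish_space \<Rightarrow> 'a"
    and m :: "'a \<Rightarrow> 'b measure"
  assumes m: "\<And>x. prob_space (m x)" "\<And>x. sets (m x) = sets borel"
    and \<beta>: "0 < \<beta>" "\<And>x. \<beta>-lipschitz_on UNIV (B x)"
    and \<tau>: "0 \<le> \<tau>" "\<And>x y. wasserstein1 (m x) (m y) \<le> ennreal (\<tau> * norm (x - y))"
    and L: "\<And>x. AE \<xi> in m x. L-lipschitz_on UNIV (\<lambda>y. B y \<xi>)"
  shows "norm (mean_map B (m x) y - mean_map B (m x') y') \<le> L * norm (y - y') + \<beta> * (\<tau> * norm (x - x'))"
proof -
  have fin: "finite_measure (m x)" for x using m(1)[of x] by (rule prob_space.finite_measure)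
  have mom: "integrable (m x) h" if "1-lipschitz_on UNIV h" for x and h :: "'b \<Rightarrow> real"
    by (rule wasserstein1_leD(1)[OF \<tau>(2)[of x x] mult_nonneg_nonneg[OF \<tau>(1) norm_ge_zero] that])
  have E: "has_expectation (m x) (B y) (mean_map B (m x) y)" for x y
  proof -
    obtain v where v: "has_expectation (m x) (B y) v"
      using lipschitz_has_expectation[OF m(1,2) \<beta>(2,1) mom] by blast
    then show ?thesis unfolding mean_map_def using vexpectation_eq[OF v fin] by simp
  qed
  have 1: "norm (mean_map B (m x) y - mean_map B (m x) y') \<le> L * norm (y - y')"
  proof (rule has_expectation_diff_le[OF m(1) E E])
    show "AE \<xi> in m x. norm (B y \<xi> - B y' \<xi>) \<le> L * norm (y - y')"
      using L[of x]
    proof eventually_elim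
      fix \<xi> assume "L-lipschitz_on UNIV (\<lambda>y. B y \<xi>)"
      from lipschitz_onD[OF this, of y y'] show "norm (B y \<xi> - B y' \<xi>) \<le> L * norm (y - y')"
        by (simp add: dist_norm)
    qed
  qed
  have 2: "norm (mean_map B (m x) y' - mean_map B (m x') y') \<le> \<beta> * (\<tau> * norm (x - x'))"
    by (rule has_expectation_wasserstein1_le[OF fin fin E E \<beta>(2,1) \<tau>(2)]) (use \<tau>(1) in simp)
  show ?thesis
    using norm_diff_triangle_le[OF 1 2] .
qed

lemma forward_backward_residual_lipschitz:
  fixes A :: "'a::{real_inner, complete_space} \<Rightarrow> 'a set"
  assumes A: "maximally_monotone A" and \<gamma>: "0 < \<gamma>"
    and G: "\<And>x x'. norm (G x - G x') \<le> K * norm (x - x')"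
  shows "norm ((x - resolvent \<gamma> A (x - \<gamma> *\<^sub>R G x)) - (x' - resolvent \<gamma> A (x' - \<gamma> *\<^sub>R G x')))
     \<le> (2 + \<gamma> * K) * norm (x - x')"
proof -
  let ?J = "resolvent \<gamma> A"
  have "norm (?J (x - \<gamma> *\<^sub>R G x) - ?J (x' - \<gamma> *\<^sub>R G x')) \<le> norm ((x - \<gamma> *\<^sub>R G x) - (x' - \<gamma> *\<^sub>R G x'))"
    by (rule resolvent_nonexpansive[OF A \<gamma>])
  also have "(x - \<gamma> *\<^sub>R G x) - (x' - \<gamma> *\<^sub>R G x') = (x - x') - \<gamma> *\<^sub>R (G x - G x')"
    by (simp add: algebra_simps)
  also have "norm \<dots> \<le> norm (x - x') + \<gamma> * norm (G x - G x')"
    using norm_triangle_ineq4[of "x - x'" "\<gamma> *\<^sub>R (G x - G x')"] \<gamma> by simp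
  also have "\<dots> \<le> norm (x - x') + \<gamma> * (K * norm (x - x'))"
    using G \<gamma> by (intro add_left_mono mult_left_mono) auto
  finally have *: "norm (?J (x - \<gamma> *\<^sub>R G x) - ?J (x' - \<gamma> *\<^sub>R G x')) \<le> (1 + \<gamma> * K) * norm (x - x')"
    by (simp add: algebra_simps)
  have "norm ((x - x') - (?J (x - \<gamma> *\<^sub>R G x) - ?J (x' - \<gamma> *\<^sub>R G x'))) \<le> norm (x - x') + (1 + \<gamma> * K) * norm (x - x')"
    using norm_triangle_ineq4[of "x - x'"] * by (meson add_left_mono order_trans)
  then show ?thesis by (simp add: algebra_simps)
qed

section \<open>Almost everywhere differentiability\<close>

text \<open>
  The Vitali covering argument in the form used below: a set is null if, for every \<open>e\<close>, almost all of
  it is finely covered by intervals of a kind (\<open>Q\<close>) of which disjoint ones have total length at most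
  \<open>e\<close>. By Vitali's theorem countably many disjoint intervals of the kind cover the set up to a null
  set.
\<close>

lemma Vitali_negligible:
  fixes S :: "real set"
  assumes cover: "\<And>e. 0 < e \<Longrightarrow> \<exists>N Q. negligible N \<and>
     (\<forall>x\<in>S - N. \<forall>\<delta>>0. \<exists>l r. l < r \<and> l \<le> x \<and> x \<le> r \<and> r - l < \<delta> \<and> Q l r) \<and>
     (\<forall>\<D>. finite \<D> \<longrightarrow> pairwise disjnt \<D> \<longrightarrow> (\<forall>K\<in>\<D>. \<exists>l r. l < r \<and> K = {l..r} \<and> Q l r)
        \<longrightarrow> (\<Sum>K\<in>\<D>. Sup K - Inf K) \<le> e)"
  shows "negligible S"
  unfolding negligible_outer_le
proof (intro allI impI)
  fix e :: real assume "0 < e"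
  from cover[OF this] obtain N Q where N: "negligible N"
    and Q: "\<And>x \<delta>. x \<in> S - N \<Longrightarrow> 0 < \<delta> \<Longrightarrow> \<exists>l r. l < r \<and> l \<le> x \<and> x \<le> r \<and> r - l < \<delta> \<and> Q l r"
    and le: "\<And>\<D>. finite \<D> \<Longrightarrow> pairwise disjnt \<D> \<Longrightarrow> (\<forall>K\<in>\<D>. \<exists>l r. l < r \<and> K = {l..r} \<and> Q l r)
        \<Longrightarrow> (\<Sum>K\<in>\<D>. Sup K - Inf K) \<le> e"
    by blast
  define I where "I = {p::real\<times>real. fst p < snd p \<and> Q (fst p) (snd p)}"
  define c where "c = (\<lambda>p::real\<times>real. (fst p + snd p) / 2)"
  define \<rho> where "\<rho> = (\<lambda>p::real\<times>real. (snd p - fst p) / 2)"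
  have cb: "cball (c p) (\<rho> p) = {fst p..snd p}" for p
    unfolding cball_eq_atLeastAtMost c_def \<rho>_def by (simp add: field_simps)
  obtain C where C: "countable C" "C \<subseteq> I"
      "pairwise (\<lambda>i j. disjnt (cball (c i) (\<rho> i)) (cball (c j) (\<rho> j))) C"
      "negligible ((S - N) - (\<Union>i\<in>C. cball (c i) (\<rho> i)))"
  proof (rule Vitali_covering_theorem_cballs[of I \<rho> "S - N" c])
    show "0 < \<rho> i" if "i \<in> I" for i using that unfolding I_def \<rho>_def by simp
  next
    fix x \<delta> :: real assume "x \<in> S - N" "0 < \<delta>"
    then obtain l r where "l < r" "l \<le> x" "x \<le> r" "r - l < \<delta>" "Q l r" using Q by blast
    then show "\<exists>i. i \<in> I \<and> x \<in> cball (c i) (\<rho> i) \<and> \<rho> i < \<delta>"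
      unfolding cb by (intro exI[of _ "(l, r)"]) (auto simp: I_def \<rho>_def)
  qed blast
  define U where "U = (\<Union>p\<in>C. {fst p..snd p})"
  have fin: "measure lebesgue (\<Union>p\<in>C'. {fst p..snd p}) \<le> e" if C': "C' \<subseteq> C" "finite C'" for C'
  proof -
    have inj: "inj_on (\<lambda>p. {fst p..snd p}) C'"
    proof (rule inj_onI)
      fix p q assume "p \<in> C'" "q \<in> C'" "{fst p..snd p} = {fst q..snd q}"
      then show "p = q" using C' C(2) unfolding I_def by (force simp: prod_eq_iff Icc_eq_Icc)
    qed
    have "measure lebesgue (\<Union>p\<in>C'. {fst p..snd p}) \<le> (\<Sum>p\<in>C'. measure lebesgue {fst p..snd p})"
      using C'(2) by (intro measure_UNION_le) auto
    also have "\<dots> = (\<Sum>p\<in>C'. snd p - fst p)"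
      using C' C(2) unfolding I_def by (intro sum.cong refl) auto
    also have "\<dots> = (\<Sum>p\<in>C'. Sup {fst p..snd p} - Inf {fst p..snd p})"
      using C' C(2) unfolding I_def by (intro sum.cong refl) auto
    also have "\<dots> = (\<Sum>K\<in>(\<lambda>p. {fst p..snd p}) ` C'. Sup K - Inf K)"
      by (simp add: sum.reindex[OF inj])
    also have "\<dots> \<le> e"
    proof (rule le)
      show "pairwise disjnt ((\<lambda>p. {fst p..snd p}) ` C')"
        using pairwise_subset[OF C(3) C'(1)] unfolding cb by (auto simp: pairwise_def)
      show "\<forall>K\<in>(\<lambda>p. {fst p..snd p}) ` C'. \<exists>l r. l < r \<and> K = {l..r} \<and> Q l r"
        using C' C(2) unfolding I_def by blast
    qed (use C' in simp)
    finally show ?thesis .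
  qed
  have U: "U \<in> lmeasurable" "measure lebesgue U \<le> e"
    unfolding U_def
    using fmeasurable_UN_bound[of C "\<lambda>p. {fst p..snd p}" lebesgue e]
      measure_UN_bound[of C "\<lambda>p. {fst p..snd p}" lebesgue e] C(1) fin by auto
  have Z: "negligible (N \<union> (S - N - U))"
    using N C(4) unfolding U_def cb by (rule negligible_Un)
  show "\<exists>T. S \<subseteq> T \<and> T \<in> lmeasurable \<and> measure lebesgue T \<le> e"
  proof (intro exI conjI)
    show "S \<subseteq> U \<union> (N \<union> (S - N - U))" by blast
    show "U \<union> (N \<union> (S - N - U)) \<in> lmeasurable"
      using U(1) negligible_imp_measurable[OF Z] by (rule fmeasurable.Un)
    have "measure lebesgue (U \<union> (N \<union> (S - N - U))) \<le> measure lebesgue U + measure lebesgue (N \<union> (S - N - U))"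
      using U(1) negligible_imp_measurable[OF Z] by (intro measure_Un_le) (auto simp: fmeasurableD)
    then show "measure lebesgue (U \<union> (N \<union> (S - N - U))) \<le> e"
      using U(2) negligible_imp_measure0[OF Z] by simp
  qed
qed

definition increment :: "(real \<Rightarrow> 'a::real_vector) \<Rightarrow> real set \<Rightarrow> 'a" where
  "increment f K = f (Sup K) - f (Inf K)"

lemma increment_Icc [simp]: "l \<le> r \<Longrightarrow> increment f {l..r} = f r - f l"
  by (simp add: increment_def)

lemma division_of_real_interval:
  assumes "d division_of S" "K \<in> d"
  obtains l r :: real where "l \<le> r" "K = {l..r}"
proof -
  obtain l r where "K = cbox l r" "K \<noteq> {}" using division_ofD[OF assms(1)] assms(2) by metis
  then show ?thesis using that[of l r] by auto
qed

lemma sum_increment_division: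
  fixes f :: "real \<Rightarrow> 'a::real_normed_vector"
  assumes "a \<le> b" and d: "d division_of {a..b}"
  shows "(\<Sum>K\<in>d. increment f K) = f b - f a"
proof -
  have t: "(\<lambda>K. (Inf K, K)) ` d tagged_division_of {a..b}"
  proof (rule tagged_division_ofI)
    show "finite ((\<lambda>K. (Inf K, K)) ` d)" using division_ofD(1)[OF d] by simp
    fix x K assume xK: "(x, K) \<in> (\<lambda>K. (Inf K, K)) ` d"
    then have K: "K \<in> d" "x = Inf K" by auto
    obtain l r where lr: "l \<le> r" "K = {l..r}" by (rule division_of_real_interval[OF d K(1)])
    show "x \<in> K" using K(2) lr by simp
    show "K \<subseteq> {a..b}" using division_ofD(2)[OF d K(1)] .
    show "\<exists>a b. K = cbox a b" using lr by auto
  next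
    fix x1 K1 x2 K2 assume "(x1, K1) \<in> (\<lambda>K. (Inf K, K)) ` d" "(x2, K2) \<in> (\<lambda>K. (Inf K, K)) ` d" "(x1, K1) \<noteq> (x2, K2)"
    then show "interior K1 \<inter> interior K2 = {}" using division_ofD(5)[OF d, of K1 K2] by auto
  next
    have "{K. \<exists>x. (x, K) \<in> (\<lambda>K. (Inf K, K)) ` d} = d" by auto
    then show "\<Union> {K. \<exists>x. (x, K) \<in> (\<lambda>K. (Inf K, K)) ` d} = {a..b}"
      using division_ofD(6)[OF d] by simp
  qed
  have "(\<Sum>(x, K)\<in>(\<lambda>K. (Inf K, K)) ` d. f (Sup K) - f (Inf K)) = f b - f a"
    by (rule additive_tagged_division_1[OF assms(1) t])
  moreover have "inj_on (\<lambda>K. (Inf K, K)) d" by (auto simp: inj_on_def)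
  ultimately show ?thesis by (simp add: sum.reindex increment_def)
qed

lemma pairwise_disjnt_imp_nonoverlapping:
  "pairwise disjnt \<D> \<Longrightarrow> pairwise (\<lambda>K K'. interior K \<inter> interior K' = {}) \<D>"
  unfolding pairwise_def disjnt_def using interior_subset by blast

lemma sum_increment_mono_le:
  fixes \<phi> :: "real \<Rightarrow> real"
  assumes mono: "\<And>s t. a \<le> s \<Longrightarrow> s \<le> t \<Longrightarrow> t \<le> b \<Longrightarrow> \<phi> s \<le> \<phi> t"
    and fin: "finite \<D>" and disj: "pairwise (\<lambda>K K'. interior K \<inter> interior K' = {}) \<D>" and ab: "a \<le> b"
    and iv: "\<And>K. K \<in> \<D> \<Longrightarrow> \<exists>l r. l \<le> r \<and> K = {l..r} \<and> a \<le> l \<and> r \<le> b"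
  shows "(\<Sum>K\<in>\<D>. increment \<phi> K) \<le> \<phi> b - \<phi> a"
proof -
  have p: "\<D> division_of \<Union>\<D>"
  proof (rule division_ofI)
    fix K assume "K \<in> \<D>"
    with iv obtain l r where "l \<le> r" "K = {l..r}" by blast
    then show "K \<noteq> {}" "\<exists>a b. K = cbox a b" by auto
  next
    fix K1 K2 assume "K1 \<in> \<D>" "K2 \<in> \<D>" "K1 \<noteq> K2"
    then show "interior K1 \<inter> interior K2 = {}" using disj unfolding pairwise_def by blast
  qed (use fin in auto)
  have "\<Union>\<D> \<subseteq> cbox a b" using iv by fastforce
  then obtain q where q: "\<D> \<subseteq> q" "q division_of cbox a b"
    using partial_division_extend_interval[OF p] by blast
  have "0 \<le> increment \<phi> K" if Kq: "K \<in> q" for K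
  proof -
    obtain l r where lr: "l \<le> r" "K = {l..r}" by (rule division_of_real_interval[OF q(2) Kq])
    have "K \<subseteq> {a..b}" using division_ofD(2)[OF q(2) Kq] by simp
    then show ?thesis using lr mono[of l r] by simp
  qed
  then have "(\<Sum>K\<in>\<D>. increment \<phi> K) \<le> (\<Sum>K\<in>q. increment \<phi> K)"
    using q division_ofD(1)[OF q(2)] by (intro sum_mono2) auto
  also have "\<dots> = \<phi> b - \<phi> a" using sum_increment_division[OF ab] q(2) by simp
  finally show ?thesis .
qed

text \<open>
  The function \<open>W\<close> is the supremum of the lengths of inscribed polygons up to time \<open>t\<close>. Its increments
  dominate those of \<open>F\<close> because a polygon up to \<open>s\<close> can be prolonged by a chord.
\<close>

lemma arc_length_function:
  fixes F :: "real \<Rightarrow> 'a::real_normed_vector"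
  assumes ab: "a \<le> b" and bv: "\<And>d. d division_of {a..b} \<Longrightarrow> (\<Sum>K\<in>d. norm (increment F K)) \<le> V"
  obtains W :: "real \<Rightarrow> real" where
    "\<And>s t. a \<le> s \<Longrightarrow> s \<le> t \<Longrightarrow> t \<le> b \<Longrightarrow> norm (F t - F s) \<le> W t - W s"
    "\<And>e. 0 < e \<Longrightarrow> \<exists>d. d division_of {a..b} \<and> W b - W a < (\<Sum>K\<in>d. norm (increment F K)) + e"
proof -
  define len where "len = (\<lambda>d. \<Sum>K\<in>d. norm (increment F K))"
  define X where "X = (\<lambda>t. len ` {d. d division_of {a..t}})"
  define W where "W = (\<lambda>t. Sup (X t))"
  have ext: "\<exists>d'. d' division_of {a..t} \<and> len d' = len d + norm (F t - F s)"
    if h: "d division_of {a..s}" "a \<le> s" "s < t" for d s t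
  proof (intro exI conjI)
    have nin: "{s..t} \<notin> d" using division_ofD(2)[OF h(1), of "{s..t}"] h(2,3) by auto
    have "insert {s..t} d = {{s..t}} \<union> d" by simp
    moreover have "{{s..t}} \<union> d division_of ({s..t} \<union> {a..s})"
    proof (rule division_disjoint_union[OF _ h(1)])
      show "{{s..t}} division_of {s..t}" using division_of_self[of s t] h(3) by simp
    qed (auto simp: interior_atLeastAtMost_real)
    moreover have "{s..t} \<union> {a..s} = {a..t}" using h by auto
    ultimately show "insert {s..t} d division_of {a..t}" by simp
    show "len (insert {s..t} d) = len d + norm (F t - F s)"
      unfolding len_def using nin division_ofD(1)[OF h(1)] h(3) by (simp add: add.commute)
  qed
  have ne: "X t \<noteq> {}" if "a \<le> t" for t
  proof -
    have "{{a..t}} division_of {a..t}" using division_of_self[of a t] that by simp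
    then show ?thesis unfolding X_def by blast
  qed
  have bdd: "bdd_above (X t)" if t: "a \<le> t" "t \<le> b" for t
  proof (rule bdd_aboveI)
    fix x assume "x \<in> X t"
    then obtain d where d: "d division_of {a..t}" "x = len d" unfolding X_def by blast
    show "x \<le> V"
    proof (cases "t = b")
      case True
      then show ?thesis using d bv unfolding len_def by blast
    next
      case False
      then obtain d' where "d' division_of {a..b}" "len d' = len d + norm (F b - F t)"
        using ext[OF d(1) t(1), of b] t(2) by auto
      then show ?thesis using bv[of d'] d(2) unfolding len_def by (smt (verit) norm_ge_zero)
    qed
  qed
  show ?thesis
  proof (rule that)
    fix s t assume st: "a \<le> s" "s \<le> t" "t \<le> b"
    show "norm (F t - F s) \<le> W t - W s"
    proof (cases "s = t")
      case False
      have "W s \<le> W t - norm (F t - F s)"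
        unfolding W_def
      proof (rule cSup_least[OF ne[OF st(1)]])
        fix x assume "x \<in> X s"
        then obtain d where d: "d division_of {a..s}" "x = len d" unfolding X_def by blast
        obtain d' where d': "d' division_of {a..t}" "len d' = len d + norm (F t - F s)"
          using ext[OF d(1) st(1)] False st(2) by force
        have "len d' \<le> Sup (X t)"
          using d'(1) st by (intro cSup_upper bdd) (auto simp: X_def)
        then show "x \<le> Sup (X t) - norm (F t - F s)" using d' d by simp
      qed
      then show ?thesis by simp
    qed simp
  next
    fix e :: real assume e: "0 < e"
    have "\<exists>x\<in>X b. W b - e < x"
      using less_cSup_iff[OF ne[OF ab] bdd[OF ab order_refl], of "W b - e"] e unfolding W_def by auto
    then obtain d where d: "d division_of {a..b}" "W b - e < len d" unfolding X_def by blast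
    have "{{a..a}} division_of {a..a}" using division_of_self[of a a] by simp
    then have "len {{a..a}} \<in> X a" unfolding X_def by blast
    then have "len {{a..a}} \<le> W a" unfolding W_def using ab by (intro cSup_upper bdd) auto
    then have "0 \<le> W a" unfolding len_def by (simp add: increment_def)
    then show "\<exists>d. d division_of {a..b} \<and> W b - W a < (\<Sum>K\<in>d. norm (increment F K)) + e"
      using d unfolding len_def by (intro exI[of _ d]) auto
  qed
qed

text \<open>
  The length a vector loses when projected to a direction is quadratic in the angle. This uniform
  convexity is where the inner product enters the differentiability theorem.
\<close>

lemma norm_minus_inner_unit:
  fixes w e :: "'a::real_inner"
  assumes "norm e = 1"
  shows "norm w - w \<bullet> e = norm w * (norm (sgn w - e))\<^sup>2 / 2"
proof (cases "w = 0")
  case False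
  have ee: "e \<bullet> e = 1" using assms by (simp add: dot_square_norm)
  have ss: "sgn w \<bullet> sgn w = 1" using False by (simp add: dot_square_norm norm_sgn)
  have w: "w = norm w *\<^sub>R sgn w" using False by (simp add: sgn_div_norm)
  have "w \<bullet> e = norm w * (sgn w \<bullet> e)" by (subst w) simp
  then show ?thesis
    unfolding power2_norm_eq_inner
    by (simp add: inner_diff_left inner_diff_right ee ss inner_commute algebra_simps)
qed simp

lemma sum_UNION_le:
  fixes g :: "'b \<Rightarrow> real"
  assumes "finite P" and "\<And>I. I \<in> P \<Longrightarrow> finite (A I)" and "\<And>I x. I \<in> P \<Longrightarrow> x \<in> A I \<Longrightarrow> 0 \<le> g x"
  shows "sum g (\<Union>I\<in>P. A I) \<le> (\<Sum>I\<in>P. sum g (A I))"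
  using assms
proof (induction P rule: finite_induct)
  case (insert I P)
  have "finite (\<Union>I\<in>P. A I)" using insert by auto
  then have "sum g (A I \<union> (\<Union>I\<in>P. A I)) = sum g (A I) + sum g (\<Union>I\<in>P. A I) - sum g (A I \<inter> (\<Union>I\<in>P. A I))"
    using insert by (intro sum_Un) auto
  moreover have "0 \<le> sum g (A I \<inter> (\<Union>I\<in>P. A I))" using insert by (intro sum_nonneg) auto
  ultimately show ?case using insert by fastforce
qed simp

text \<open>
  Take a partition \<open>P\<close> whose polygon has almost the full arc length. On a piece \<open>I\<close> of it, the arc
  length minus the component of \<open>F\<close> in the direction of the chord of \<open>I\<close> is a nondecreasing function
  of time whose total increase is the arc length lost on \<open>I\<close>. A chord over a subinterval that deviates
  from that direction by \<open>\<eta>/2\<close> accounts for at least \<open>\<eta>\<^sup>2/8\<close> times the length of the subinterval in this increase. So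
  disjoint intervals with such chords have small total length, and Vitali's theorem applies: where
  directions of arbitrarily short chords differ by \<open>\<eta>\<close>, one of them deviates from the direction over
  \<open>I\<close> by \<open>\<eta>/2\<close>. The expansion hypothesis bounds lengths of intervals by lengths of chords; it holds
  for graphs.
\<close>

lemma chord_direction_oscillation_negligible:
  fixes F :: "real \<Rightarrow> 'a::real_inner"
  assumes ab: "a \<le> b" and bv: "\<And>d. d division_of {a..b} \<Longrightarrow> (\<Sum>K\<in>d. norm (increment F K)) \<le> V"
    and expand: "\<And>s t. a \<le> s \<Longrightarrow> s \<le> t \<Longrightarrow> t \<le> b \<Longrightarrow> t - s \<le> norm (F t - F s)"
    and \<eta>: "0 < \<eta>"
  shows "negligible {x \<in> {a<..<b}. \<forall>\<delta>>0. \<exists>l r l' r'.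
      a \<le> l \<and> l < r \<and> r \<le> b \<and> l \<le> x \<and> x \<le> r \<and> r - l < \<delta> \<and>
      a \<le> l' \<and> l' < r' \<and> r' \<le> b \<and> l' \<le> x \<and> x \<le> r' \<and> r' - l' < \<delta> \<and>
      \<eta> \<le> norm (sgn (F r - F l) - sgn (F r' - F l'))}" (is "negligible ?S")
proof (rule Vitali_negligible)
  fix e :: real assume e: "0 < e"
  obtain W where W: "\<And>s t. a \<le> s \<Longrightarrow> s \<le> t \<Longrightarrow> t \<le> b \<Longrightarrow> norm (F t - F s) \<le> W t - W s"
    and approx: "\<And>e. 0 < e \<Longrightarrow> \<exists>d. d division_of {a..b} \<and> W b - W a < (\<Sum>K\<in>d. norm (increment F K)) + e"
    using arc_length_function[OF ab bv] by blast
  \<comment> \<open>The total increase allowed, so that \<open>\<eta>\<^sup>2/8\<close> times the total length is at most \<open>\<epsilon>\<close>.\<close>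
  define \<epsilon> where "\<epsilon> = e * \<eta>\<^sup>2 / 8"
  have \<epsilon>: "0 < \<epsilon>" unfolding \<epsilon>_def using e \<eta> by simp
  obtain P where P: "P division_of {a..b}" and Pe: "W b - W a < (\<Sum>K\<in>P. norm (increment F K)) + \<epsilon>"
    using approx[OF \<epsilon>] by blast
  \<comment> \<open>Away from the end points of the partition, short intervals stay inside one piece.\<close>
  define N where "N = (\<Union>I\<in>P. {Inf I, Sup I})"
  define Q where "Q = (\<lambda>l r. \<exists>I\<in>P. {l..r} \<subseteq> I \<and> \<eta> / 2 \<le> norm (sgn (F r - F l) - sgn (increment F I)))"
  have finP: "finite P" using division_ofD(1)[OF P] .
  have PI: "\<exists>c d. a \<le> c \<and> c \<le> d \<and> d \<le> b \<and> I = {c..d}" if IP: "I \<in> P" for I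
  proof -
    obtain c d where cd: "c \<le> d" "I = {c..d}" by (rule division_of_real_interval[OF P IP])
    have "I \<subseteq> {a..b}" using division_ofD(2)[OF P IP] .
    then show ?thesis using cd by auto
  qed
  show "\<exists>N Q. negligible N \<and>
     (\<forall>x\<in>?S - N. \<forall>\<delta>>0. \<exists>l r. l < r \<and> l \<le> x \<and> x \<le> r \<and> r - l < \<delta> \<and> Q l r) \<and>
     (\<forall>\<D>. finite \<D> \<longrightarrow> pairwise disjnt \<D> \<longrightarrow> (\<forall>K\<in>\<D>. \<exists>l r. l < r \<and> K = {l..r} \<and> Q l r)
        \<longrightarrow> (\<Sum>K\<in>\<D>. Sup K - Inf K) \<le> e)"
  proof (rule exI[of _ N], rule exI[of _ Q], intro conjI ballI allI impI)
    show "negligible N" unfolding N_def using finP by (intro negligible_finite) auto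
  next
    fix x \<delta> :: real assume x: "x \<in> ?S - N" and \<delta>: "0 < \<delta>"
    then have xab: "a < x" "x < b" by auto
    then have "x \<in> \<Union>P" using division_ofD(6)[OF P] by simp
    then obtain I where I: "I \<in> P" "x \<in> I" by blast
    obtain c d where cd: "a \<le> c" "c \<le> d" "d \<le> b" "I = {c..d}" using PI[OF I(1)] by blast
    have "x \<noteq> c" "x \<noteq> d" using x I(1) cd unfolding N_def by auto
    then have cxd: "c < x" "x < d" using I(2) cd by auto
    define \<delta>' where "\<delta>' = min \<delta> (min (x - c) (d - x))"
    have "0 < \<delta>'" unfolding \<delta>'_def using \<delta> cxd by simp
    then obtain l r l' r' where lr: "l < r" "l \<le> x" "x \<le> r" "r - l < \<delta>'"
        and lr': "l' < r'" "l' \<le> x" "x \<le> r'" "r' - l' < \<delta>'"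
        and far: "\<eta> \<le> norm (sgn (F r - F l) - sgn (F r' - F l'))"
      using x by blast
    have sub: "{l..r} \<subseteq> I" "{l'..r'} \<subseteq> I" "r - l < \<delta>" "r' - l' < \<delta>"
      using lr lr' unfolding \<delta>'_def cd(4) by auto
    have "norm (sgn (F r - F l) - sgn (F r' - F l')) \<le> norm (sgn (F r - F l) - sgn (increment F I))
        + norm (sgn (F r' - F l') - sgn (increment F I))"
      using norm_triangle_ineq4[of "sgn (F r - F l) - sgn (increment F I)" "sgn (F r' - F l') - sgn (increment F I)"]
      by simp
    then have "\<eta> / 2 \<le> norm (sgn (F r - F l) - sgn (increment F I)) \<or>
        \<eta> / 2 \<le> norm (sgn (F r' - F l') - sgn (increment F I))"
      using far by linarith
    then have "Q l r \<or> Q l' r'" unfolding Q_def using I(1) sub by blast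
    then show "\<exists>l r. l < r \<and> l \<le> x \<and> x \<le> r \<and> r - l < \<delta> \<and> Q l r"
      using lr(1-3) lr'(1-3) sub(3,4) by blast
  next
    fix \<D> :: "real set set"
    assume fin: "finite \<D>" and disj: "pairwise disjnt \<D>"
      and iv: "\<forall>K\<in>\<D>. \<exists>l r. l < r \<and> K = {l..r} \<and> Q l r"
    have fin_sub: "finite {K \<in> \<D>. R K}" and disj_sub: "pairwise disjnt {K \<in> \<D>. R K}" for R
      using fin pairwise_subset[OF disj] by auto
    define h where "h = (\<lambda>I K. K \<subseteq> I \<and> \<eta> / 2 \<le> norm (sgn (increment F K) - sgn (increment F I)))"
    have each: "\<eta>\<^sup>2 / 8 * (\<Sum>K\<in>{K\<in>\<D>. h I K}. Sup K - Inf K) \<le> increment W I - norm (increment F I)"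
      if IP: "I \<in> P" for I
    proof -
      obtain c d where cd: "a \<le> c" "c \<le> d" "d \<le> b" "I = {c..d}" using PI[OF IP] by blast
      define e' where "e' = sgn (increment F I)"
      define \<phi> where "\<phi> = (\<lambda>t. W t - F t \<bullet> e')"
      have e'1: "norm e' \<le> 1" unfolding e'_def by (simp add: norm_sgn)
      have mono: "\<phi> s \<le> \<phi> t" if "c \<le> s" "s \<le> t" "t \<le> d" for s t
      proof -
        have "(F t - F s) \<bullet> e' \<le> norm (F t - F s) * norm e'" by (rule norm_cauchy_schwarz)
        also have "\<dots> \<le> norm (F t - F s) * 1" using e'1 by (intro mult_left_mono) auto
        also have "\<dots> \<le> W t - W s" using W[of s t] that cd by simp
        finally show ?thesis unfolding \<phi>_def by (simp add: inner_diff_left)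
      qed
      have lower: "\<eta>\<^sup>2 / 8 * (Sup K - Inf K) \<le> increment \<phi> K" if KD: "K \<in> \<D>" and hK: "h I K" for K
      proof -
        obtain l r where lr: "l < r" "K = {l..r}" using iv KD by blast
        have clr: "c \<le> l" "r \<le> d" using hK lr cd unfolding h_def by auto
        have Fpos: "0 < norm (F r - F l)" using expand[of l r] lr(1) clr cd by linarith
        have "c < d" using lr clr by linarith
        then have "0 < norm (F d - F c)" using expand[of c d] cd by linarith
        then have "norm e' = 1" unfolding e'_def cd(4) using cd(2) by (auto simp: norm_sgn)
        then have eq: "norm (F r - F l) - (F r - F l) \<bullet> e' = norm (F r - F l) * (norm (sgn (F r - F l) - e'))\<^sup>2 / 2"
          by (rule norm_minus_inner_unit)
        have "(\<eta> / 2)\<^sup>2 \<le> (norm (sgn (F r - F l) - e'))\<^sup>2"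
          using hK \<eta> lr unfolding h_def e'_def by (intro power_mono) auto
        then have "(r - l) * (\<eta> / 2)\<^sup>2 \<le> norm (F r - F l) * (norm (sgn (F r - F l) - e'))\<^sup>2"
          using expand[of l r] lr(1) clr cd by (intro mult_mono) auto
        then have "\<eta>\<^sup>2 / 8 * (r - l) \<le> norm (F r - F l) - (F r - F l) \<bullet> e'"
          unfolding eq by (simp add: power2_eq_square field_simps)
        also have "\<dots> \<le> (W r - W l) - (F r - F l) \<bullet> e'"
          using W[of l r] lr(1) clr cd by simp
        also have "\<dots> = increment \<phi> K"
          unfolding \<phi>_def lr(2) using lr(1) by (simp add: inner_diff_left)
        finally show ?thesis using lr by simp
      qed
      have "\<eta>\<^sup>2 / 8 * (\<Sum>K\<in>{K\<in>\<D>. h I K}. Sup K - Inf K) \<le> (\<Sum>K\<in>{K\<in>\<D>. h I K}. increment \<phi> K)"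
        unfolding sum_distrib_left using lower by (intro sum_mono) auto
      also have "\<dots> \<le> \<phi> d - \<phi> c"
      proof (rule sum_increment_mono_le[OF mono fin_sub pairwise_disjnt_imp_nonoverlapping[OF disj_sub] cd(2)])
        fix K assume "K \<in> {K \<in> \<D>. h I K}"
        then obtain l r where "l < r" "K = {l..r}" "K \<subseteq> {c..d}"
          using iv unfolding h_def cd(4) by blast
        then show "\<exists>l r. l \<le> r \<and> K = {l..r} \<and> c \<le> l \<and> r \<le> d"
          by (intro exI[of _ l] exI[of _ r]) auto
      qed auto
      also have "\<dots> = increment W I - increment F I \<bullet> sgn (increment F I)"
        unfolding \<phi>_def e'_def cd(4) using cd(2) by (simp add: inner_diff_left)
      also have "increment F I \<bullet> sgn (increment F I) = norm (increment F I)"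
        by (cases "increment F I = 0") (simp_all add: sgn_div_norm dot_square_norm power2_eq_square)
      finally show ?thesis .
    qed
    have nn: "0 \<le> Sup K - Inf K" if KD: "K \<in> \<D>" for K
    proof -
      obtain l r where "l < r" "K = {l..r}" using iv KD by blast
      then show ?thesis by simp
    qed
    have sub: "\<D> \<subseteq> (\<Union>I\<in>P. {K\<in>\<D>. h I K})"
    proof
      fix K assume KD: "K \<in> \<D>"
      then obtain l r where lr: "l < r" "K = {l..r}" "Q l r" using iv by blast
      then obtain I where I: "I \<in> P" "{l..r} \<subseteq> I" "\<eta> / 2 \<le> norm (sgn (F r - F l) - sgn (increment F I))"
        unfolding Q_def by blast
      then have "h I K" unfolding h_def using lr by simp
      then show "K \<in> (\<Union>I\<in>P. {K\<in>\<D>. h I K})" using I(1) KD by blast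
    qed
    have "(\<Sum>K\<in>\<D>. Sup K - Inf K) \<le> (\<Sum>K\<in>(\<Union>I\<in>P. {K\<in>\<D>. h I K}). Sup K - Inf K)"
      using sub fin finP nn by (intro sum_mono2) auto
    also have "\<dots> \<le> (\<Sum>I\<in>P. \<Sum>K\<in>{K\<in>\<D>. h I K}. Sup K - Inf K)"
      using fin finP nn by (intro sum_UNION_le) auto
    finally have "\<eta>\<^sup>2 / 8 * (\<Sum>K\<in>\<D>. Sup K - Inf K) \<le> (\<Sum>I\<in>P. \<eta>\<^sup>2 / 8 * (\<Sum>K\<in>{K\<in>\<D>. h I K}. Sup K - Inf K))"
      unfolding sum_distrib_left[symmetric] using \<eta> by (intro mult_left_mono) auto
    also have "\<dots> \<le> (\<Sum>I\<in>P. increment W I - norm (increment F I))"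
      using each by (intro sum_mono) auto
    also have "\<dots> = (W b - W a) - (\<Sum>I\<in>P. norm (increment F I))"
      unfolding sum_subtractf using sum_increment_division[OF ab P, of W] by simp
    also have "\<dots> \<le> \<epsilon>" using Pe by simp
    also have "\<epsilon> = \<eta>\<^sup>2 / 8 * e" unfolding \<epsilon>_def by simp
    finally have le: "\<eta>\<^sup>2 / 8 * (\<Sum>K\<in>\<D>. Sup K - Inf K) \<le> \<eta>\<^sup>2 / 8 * e" .
    have "0 < \<eta>\<^sup>2 / 8" using \<eta> by simp
    from mult_left_le_imp_le[OF le this] show "(\<Sum>K\<in>\<D>. Sup K - Inf K) \<le> e" .
  qed
qed

text \<open>
  Disjoint intervals over which the slope is at least \<open>M\<close> have total length at most the variation
  divided by \<open>M\<close>.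
\<close>

lemma infinite_slope_negligible:
  fixes f :: "real \<Rightarrow> 'a::real_normed_vector"
  assumes ab: "a \<le> b" and bv: "\<And>d. d division_of {a..b} \<Longrightarrow> (\<Sum>K\<in>d. norm (increment f K)) \<le> V"
  shows "negligible {x \<in> {a<..<b}. \<forall>M \<delta>. 0 < \<delta> \<longrightarrow> (\<exists>l r. a \<le> l \<and> l < r \<and> r \<le> b \<and> l \<le> x \<and> x \<le> r \<and> r - l < \<delta> \<and>
      M * (r - l) \<le> norm (f r - f l))}" (is "negligible ?S")
proof (rule Vitali_negligible)
  fix e :: real assume e: "0 < e"
  obtain W where W: "\<And>s t. a \<le> s \<Longrightarrow> s \<le> t \<Longrightarrow> t \<le> b \<Longrightarrow> norm (f t - f s) \<le> W t - W s"
    and "\<And>e. 0 < e \<Longrightarrow> \<exists>d. d division_of {a..b} \<and> W b - W a < (\<Sum>K\<in>d. norm (increment f K)) + e"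
    using arc_length_function[OF ab bv] by blast
  have W0: "0 \<le> W b - W a" using W[of a b] ab norm_ge_zero order_trans by blast
  \<comment> \<open>The summand 1 only ensures that \<open>M\<close> is positive.\<close>
  define M where "M = (W b - W a) / e + 1"
  have M: "0 < M" unfolding M_def using W0 e by (simp add: add_nonneg_pos)
  show "\<exists>N Q. negligible N \<and>
     (\<forall>x\<in>?S - N. \<forall>\<delta>>0. \<exists>l r. l < r \<and> l \<le> x \<and> x \<le> r \<and> r - l < \<delta> \<and> Q l r) \<and>
     (\<forall>\<D>. finite \<D> \<longrightarrow> pairwise disjnt \<D> \<longrightarrow> (\<forall>K\<in>\<D>. \<exists>l r. l < r \<and> K = {l..r} \<and> Q l r)
        \<longrightarrow> (\<Sum>K\<in>\<D>. Sup K - Inf K) \<le> e)"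
  proof (rule exI[of _ "{}"], rule exI[of _ "\<lambda>l r. a \<le> l \<and> r \<le> b \<and> M * (r - l) \<le> norm (f r - f l)"],
      intro conjI ballI allI impI)
    show "negligible ({} :: real set)" by simp
  next
    fix x \<delta> :: real assume "x \<in> ?S - {}" "0 < \<delta>"
    then show "\<exists>l r. l < r \<and> l \<le> x \<and> x \<le> r \<and> r - l < \<delta> \<and> (a \<le> l \<and> r \<le> b \<and> M * (r - l) \<le> norm (f r - f l))"
      by blast
  next
    fix \<D> :: "real set set"
    assume fin: "finite \<D>" and disj: "pairwise disjnt \<D>"
      and iv: "\<forall>K\<in>\<D>. \<exists>l r. l < r \<and> K = {l..r} \<and> a \<le> l \<and> r \<le> b \<and> M * (r - l) \<le> norm (f r - f l)"
    have "M * (\<Sum>K\<in>\<D>. Sup K - Inf K) \<le> (\<Sum>K\<in>\<D>. increment W K)"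
      unfolding sum_distrib_left
    proof (rule sum_mono)
      fix K assume "K \<in> \<D>"
      then obtain l r where lr: "l < r" "K = {l..r}" "a \<le> l" "r \<le> b" "M * (r - l) \<le> norm (f r - f l)"
        using iv by blast
      then show "M * (Sup K - Inf K) \<le> increment W K" using W[of l r] by simp
    qed
    also have "\<dots> \<le> W b - W a"
    proof (rule sum_increment_mono_le[OF _ fin pairwise_disjnt_imp_nonoverlapping[OF disj] ab])
      show "W s \<le> W t" if "a \<le> s" "s \<le> t" "t \<le> b" for s t
        using W[OF that] norm_ge_zero[of "f t - f s"] by linarith
      show "\<exists>l r. l \<le> r \<and> K = {l..r} \<and> a \<le> l \<and> r \<le> b" if "K \<in> \<D>" for K
        using iv that less_imp_le by metis
    qed
    also have "\<dots> \<le> M * e" unfolding M_def using e by (simp add: field_simps)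
    finally have le: "M * (\<Sum>K\<in>\<D>. Sup K - Inf K) \<le> M * e" .
    from mult_left_le_imp_le[OF le M] show "(\<Sum>K\<in>\<D>. Sup K - Inf K) \<le> e" .
  qed
qed

text \<open>
  The chords range over all short intervals that contain \<open>x\<close>, in whatever position. This is the form in
  which covering arguments produce difference quotients.
\<close>

lemma vector_derivative_by_chords:
  fixes f :: "real \<Rightarrow> 'a::real_normed_vector"
  assumes chord: "\<And>e. 0 < e \<Longrightarrow> \<exists>\<delta>>0. \<forall>l r. l < r \<and> l \<le> x \<and> x \<le> r \<and> r - l < \<delta> \<longrightarrow>
       norm ((1 / (r - l)) *\<^sub>R (f r - f l) - D) < e"
  shows "(f has_vector_derivative D) (at x)"
  unfolding has_vector_derivative_def has_derivative_at_alt
proof (intro conjI allI impI)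
  show "bounded_linear (\<lambda>h. h *\<^sub>R D)" by (rule bounded_linear_scaleR_left)
  fix e :: real assume "0 < e"
  from chord[OF this] obtain \<delta> where \<delta>: "0 < \<delta>"
    and c: "\<And>l r. l < r \<Longrightarrow> l \<le> x \<Longrightarrow> x \<le> r \<Longrightarrow> r - l < \<delta> \<Longrightarrow> norm ((1 / (r - l)) *\<^sub>R (f r - f l) - D) < e"
    by blast
  have c': "norm (f r - f l - (r - l) *\<^sub>R D) \<le> e * (r - l)"
    if "l < r" "l \<le> x" "x \<le> r" "r - l < \<delta>" for l r
  proof -
    have "f r - f l - (r - l) *\<^sub>R D = (r - l) *\<^sub>R ((1 / (r - l)) *\<^sub>R (f r - f l) - D)"
      using that(1) by (simp add: scaleR_right_diff_distrib)
    then have "norm (f r - f l - (r - l) *\<^sub>R D) = (r - l) * norm ((1 / (r - l)) *\<^sub>R (f r - f l) - D)"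
      using that(1) by simp
    also have "\<dots> \<le> (r - l) * e" using c[OF that] that(1) by (intro mult_left_mono) auto
    finally show ?thesis by (simp add: mult.commute)
  qed
  show "\<exists>d>0. \<forall>y. norm (y - x) < d \<longrightarrow> norm (f y - f x - (y - x) *\<^sub>R D) \<le> e * norm (y - x)"
  proof (intro exI conjI allI impI)
    fix y assume y: "norm (y - x) < \<delta>"
    consider "y < x" | "y = x" | "x < y" by linarith
    then show "norm (f y - f x - (y - x) *\<^sub>R D) \<le> e * norm (y - x)"
    proof cases
      case 1
      have "f y - f x - (y - x) *\<^sub>R D = - (f x - f y - (x - y) *\<^sub>R D)" by (simp add: algebra_simps)
      then have "norm (f y - f x - (y - x) *\<^sub>R D) = norm (f x - f y - (x - y) *\<^sub>R D)"
        by (metis norm_minus_cancel)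
      then show ?thesis using c'[of y x] 1 y by simp
    next
      case 3
      then show ?thesis using c'[of x y] y by simp
    qed simp
  qed (rule \<delta>)
qed

text \<open>
  The graph \<open>t \<mapsto> (t, f t)\<close> has bounded variation, so at almost every time the unit directions of its
  short chords form a Cauchy family and converge to some \<open>w = (\<alpha>, v)\<close>. If \<open>\<alpha> \<noteq> 0\<close>, the slopes of the
  chords converge to \<open>v / \<alpha>\<close>; the case \<open>\<alpha> = 0\<close> is that of infinite slope, which is confined to a null
  set.
\<close>

theorem bounded_variation_ae_differentiable:
  fixes f :: "real \<Rightarrow> 'a::{real_inner, complete_space}"
  assumes ab: "a \<le> b" and bv: "\<And>d. d division_of {a..b} \<Longrightarrow> (\<Sum>K\<in>d. norm (increment f K)) \<le> V"
  shows "negligible {x \<in> {a<..<b}. \<not> (\<exists>D. (f has_vector_derivative D) (at x))}"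
proof -
  define F where "F = (\<lambda>t. (t, f t))"
  have Fd: "F t - F s = (t - s, f t - f s)" for s t unfolding F_def by simp
  have expand: "t - s \<le> norm (F t - F s)" if "a \<le> s" "s \<le> t" "t \<le> b" for s t
    using norm_fst_le[of "t - s" "f t - f s"] that unfolding Fd by simp
  have bvF: "(\<Sum>K\<in>d. norm (increment F K)) \<le> (b - a) + V" if d: "d division_of {a..b}" for d
  proof -
    have "(\<Sum>K\<in>d. norm (increment F K)) \<le> (\<Sum>K\<in>d. increment (\<lambda>t. t) K + norm (increment f K))"
    proof (rule sum_mono)
      fix K assume "K \<in> d"
      then obtain l r where "l \<le> r" "K = {l..r}" using division_of_real_interval[OF d] by blast
      then show "norm (increment F K) \<le> increment (\<lambda>t. t) K + norm (increment f K)"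
        using norm_Pair_le[of "r - l" "f r - f l"] by (simp add: Fd)
    qed
    also have "\<dots> \<le> (b - a) + V"
      unfolding sum.distrib using bv[OF d] sum_increment_division[OF ab d, of "\<lambda>t. t"] by simp
    finally show ?thesis .
  qed
  define osc where "osc = (\<lambda>\<eta>. {x \<in> {a<..<b}. \<forall>\<delta>>0. \<exists>l r l' r'.
      a \<le> l \<and> l < r \<and> r \<le> b \<and> l \<le> x \<and> x \<le> r \<and> r - l < \<delta> \<and>
      a \<le> l' \<and> l' < r' \<and> r' \<le> b \<and> l' \<le> x \<and> x \<le> r' \<and> r' - l' < \<delta> \<and>
      \<eta> \<le> norm (sgn (F r - F l) - sgn (F r' - F l'))})"
  define steep where "steep = {x \<in> {a<..<b}. \<forall>M \<delta>. 0 < \<delta> \<longrightarrow> (\<exists>l r. a \<le> l \<and> l < r \<and> r \<le> b \<and> l \<le> x \<and> x \<le> r \<and> r - l < \<delta> \<and>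
      M * (r - l) \<le> norm (f r - f l))}"
  have neg_osc: "negligible (osc \<eta>)" if "0 < \<eta>" for \<eta>
    unfolding osc_def by (rule chord_direction_oscillation_negligible[OF ab bvF expand that])
  have neg_steep: "negligible steep"
    unfolding steep_def by (rule infinite_slope_negligible[OF ab bv])
  have "negligible (steep \<union> (\<Union>n. osc (1 / real (Suc n))))"
    using neg_osc by (intro negligible_Un neg_steep negligible_countable_Union) auto
  moreover have "{x \<in> {a<..<b}. \<not> (\<exists>D. (f has_vector_derivative D) (at x))} \<subseteq> steep \<union> (\<Union>n. osc (1 / real (Suc n)))"
  proof (rule subsetI, rule ccontr)
    fix x assume x: "x \<in> {x \<in> {a<..<b}. \<not> (\<exists>D. (f has_vector_derivative D) (at x))}"
      and "x \<notin> steep \<union> (\<Union>n. osc (1 / real (Suc n)))"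
    then have xab: "a < x" "x < b" and nst: "x \<notin> steep" and nosc: "\<And>n. x \<notin> osc (1 / real (Suc n))" by auto
    define near where "near = (\<lambda>\<delta> l r. a \<le> l \<and> l < r \<and> r \<le> b \<and> l \<le> x \<and> x \<le> r \<and> r - l < (\<delta>::real))"
    define u where "u = (\<lambda>l r. sgn (F r - F l))"
    have small_osc: "\<exists>\<delta>>0. \<forall>l r l' r'. near \<delta> l r \<longrightarrow> near \<delta> l' r' \<longrightarrow> norm (u l r - u l' r') < \<eta>"
      if \<eta>0: "0 < \<eta>" for \<eta>
    proof -
      obtain n where n: "1 / real (Suc n) < \<eta>"
        using reals_Archimedean[OF \<eta>0] by (auto simp: inverse_eq_divide)
      obtain \<delta> where \<delta>: "0 < \<delta>" "\<And>l r l' r'. near \<delta> l r \<Longrightarrow> near \<delta> l' r' \<Longrightarrow> \<not> 1 / real (Suc n) \<le> norm (u l r - u l' r')"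
      proof -
        have "\<not> (\<forall>\<delta>>0. \<exists>l r l' r'. near \<delta> l r \<and> near \<delta> l' r' \<and> 1 / real (Suc n) \<le> norm (u l r - u l' r'))"
          using nosc[of n] xab unfolding osc_def near_def u_def by simp
        then show thesis using that by blast
      qed
      have "norm (u l r - u l' r') < \<eta>" if "near \<delta> l r" "near \<delta> l' r'" for l r l' r'
        using \<delta>(2)[OF that] n by linarith
      then show ?thesis using \<delta>(1) by blast
    qed
    obtain d where d: "0 < d" "d \<le> x - a" "d \<le> b - x"
      using xab by (metis diff_gt_0_iff_gt le_cases order_refl)
    \<comment> \<open>One particular sequence of shrinking chords determines the limit direction \<open>w\<close>.\<close>
    define \<sigma> where "\<sigma> = (\<lambda>n::nat. d / real (Suc (Suc n)))"
    have \<sigma>: "0 < \<sigma> n" "\<sigma> n \<le> d" "\<sigma> n < d" for n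
      unfolding \<sigma>_def using d(1) by (auto simp: divide_simps)
    have \<sigma>0: "\<exists>N. \<forall>n\<ge>N. \<sigma> n < \<delta>" if \<delta>0: "0 < \<delta>" for \<delta>
    proof -
      obtain N where N: "inverse (real (Suc N)) < \<delta> / d" using reals_Archimedean[of "\<delta> / d"] \<delta>0 d(1) by auto
      have "\<sigma> n < \<delta>" if "n \<ge> N" for n
      proof -
        have "\<sigma> n \<le> d / real (Suc N)" unfolding \<sigma>_def using that d(1) by (intro divide_left_mono) auto
        also have "\<dots> < \<delta>" using N d(1) by (simp add: field_simps)
        finally show ?thesis .
      qed
      then show ?thesis by blast
    qed
    have near\<sigma>: "near \<delta> x (x + \<sigma> n)" if "\<sigma> n < \<delta>" for \<delta> n
      unfolding near_def using that \<sigma>[of n] d xab by auto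
    have "Cauchy (\<lambda>n. u x (x + \<sigma> n))"
    proof (rule CauchyI)
      fix \<eta> :: real assume "0 < \<eta>"
      then obtain \<delta> where \<delta>: "0 < \<delta>" "\<And>l r l' r'. near \<delta> l r \<Longrightarrow> near \<delta> l' r' \<Longrightarrow> norm (u l r - u l' r') < \<eta>"
        using small_osc by blast
      obtain N where "\<forall>n\<ge>N. \<sigma> n < \<delta>" using \<sigma>0[OF \<delta>(1)] by blast
      then show "\<exists>M. \<forall>m\<ge>M. \<forall>n\<ge>M. norm (u x (x + \<sigma> m) - u x (x + \<sigma> n)) < \<eta>"
        using \<delta>(2) near\<sigma> by blast
    qed
    then obtain w where w: "(\<lambda>n. u x (x + \<sigma> n)) \<longlonglongrightarrow> w"
      using Cauchy_convergent_iff convergent_def by blast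
    have dir: "\<exists>\<delta>>0. \<forall>l r. near \<delta> l r \<longrightarrow> norm (u l r - w) \<le> \<eta>" if \<eta>: "0 < \<eta>" for \<eta>
    proof -
      obtain \<delta> where \<delta>: "0 < \<delta>" "\<And>l r l' r'. near \<delta> l r \<Longrightarrow> near \<delta> l' r' \<Longrightarrow> norm (u l r - u l' r') < \<eta>"
        using small_osc[OF \<eta>] by blast
      obtain N where N: "\<forall>n\<ge>N. \<sigma> n < \<delta>" using \<sigma>0[OF \<delta>(1)] by blast
      have "norm (u l r - w) \<le> \<eta>" if "near \<delta> l r" for l r
      proof (rule LIMSEQ_le_const2)
        show "(\<lambda>n. norm (u l r - u x (x + \<sigma> n))) \<longlonglongrightarrow> norm (u l r - w)" by (intro tendsto_intros w)
        show "\<exists>N. \<forall>n\<ge>N. norm (u l r - u x (x + \<sigma> n)) \<le> \<eta>"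
          using \<delta>(2)[OF that near\<sigma>] N less_imp_le by meson
      qed
      then show ?thesis using \<delta>(1) by blast
    qed
    have comp: "fst (u l r) = (r - l) / norm (F r - F l)" "snd (u l r) = (1 / norm (F r - F l)) *\<^sub>R (f r - f l)"
      "0 < norm (F r - F l)" if "near \<delta> l r" for \<delta> l r
      using that expand[of l r] unfolding u_def near_def Fd by (auto simp: sgn_div_norm inverse_eq_divide field_simps)
    have chord: "(1 / (r - l)) *\<^sub>R (f r - f l) = (1 / fst (u l r)) *\<^sub>R snd (u l r)" "0 < fst (u l r)"
      if "near \<delta> l r" for \<delta> l r
      using comp[OF that] that unfolding near_def by auto
    obtain \<alpha> v where av: "w = (\<alpha>, v)" by (cases w)
    have \<alpha>: "\<alpha> \<noteq> 0"
    proof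
      assume \<alpha>0: "\<alpha> = 0"
      have "x \<in> steep"
        unfolding steep_def
      proof (intro CollectI conjI allI impI)
        show "x \<in> {a<..<b}" using xab by simp
        fix M \<delta> :: real assume \<delta>: "0 < \<delta>"
        define M' where "M' = \<bar>M\<bar> + 1"
        have M': "0 < M'" "M \<le> M'" unfolding M'_def by auto
        obtain \<delta>1 where \<delta>1: "0 < \<delta>1" "\<And>l r. near \<delta>1 l r \<Longrightarrow> norm (u l r - w) \<le> 1 / (M' + 1)"
          using dir[of "1 / (M' + 1)"] M' by auto
        obtain n where n: "\<sigma> n < min \<delta> \<delta>1" using \<sigma>0[of "min \<delta> \<delta>1"] \<delta> \<delta>1(1) by auto
        define r where "r = x + \<sigma> n"
        have nr: "near \<delta> x r" "near \<delta>1 x r" unfolding r_def using near\<sigma> n by auto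
        have xr: "x < r" using nr unfolding near_def by simp
        have "\<bar>fst (u x r)\<bar> \<le> norm (u x r - w)"
          using norm_fst_le[of "fst (u x r - w)" "snd (u x r - w)"] av \<alpha>0 by (cases "u x r") simp
        also have "\<dots> \<le> 1 / (M' + 1)" using \<delta>1(2) nr by blast
        finally have "(r - x) / norm (F r - F x) \<le> 1 / (M' + 1)" using comp(1)[OF nr(1)] xr by simp
        then have "(r - x) * (M' + 1) \<le> norm (F r - F x)"
          using comp(3)[OF nr(1)] M' by (simp add: divide_simps mult.commute)
        also have "\<dots> \<le> (r - x) + norm (f r - f x)"
          unfolding Fd using norm_Pair_le[of "r - x" "f r - f x"] xr by simp
        finally have "M' * (r - x) \<le> norm (f r - f x)" by (simp add: algebra_simps)
        moreover have "M * (r - x) \<le> M' * (r - x)" using M' xr by (intro mult_right_mono) auto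
        ultimately have "M * (r - x) \<le> norm (f r - f x)" by linarith
        then show "\<exists>l r. a \<le> l \<and> l < r \<and> r \<le> b \<and> l \<le> x \<and> x \<le> r \<and> r - l < \<delta> \<and> M * (r - l) \<le> norm (f r - f l)"
          using nr(1) unfolding near_def by blast
      qed
      then show False using nst by simp
    qed
    have "(f has_vector_derivative (1 / \<alpha>) *\<^sub>R v) (at x)"
    proof (rule vector_derivative_by_chords)
      fix e :: real assume e: "0 < e"
      have "((\<lambda>p. (1 / fst p) *\<^sub>R snd p) \<longlongrightarrow> (1 / fst w) *\<^sub>R snd w) (nhds w)"
        using \<alpha> av by (intro tendsto_intros) (auto intro: filterlim_ident)
      from tendstoD[OF this e]
      have "eventually (\<lambda>p. dist ((1 / fst p) *\<^sub>R snd p) ((1 / \<alpha>) *\<^sub>R v) < e) (nhds w)" unfolding av by simp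
      then obtain \<eta> where \<eta>: "0 < \<eta>" "\<And>p. dist p w < \<eta> \<Longrightarrow> dist ((1 / fst p) *\<^sub>R snd p) ((1 / \<alpha>) *\<^sub>R v) < e"
        unfolding eventually_nhds_metric by blast
      obtain \<delta> where \<delta>: "0 < \<delta>" "\<And>l r. near \<delta> l r \<Longrightarrow> norm (u l r - w) \<le> \<eta> / 2"
        using dir[of "\<eta> / 2"] \<eta>(1) by auto
      show "\<exists>\<delta>>0. \<forall>l r. l < r \<and> l \<le> x \<and> x \<le> r \<and> r - l < \<delta> \<longrightarrow> norm ((1 / (r - l)) *\<^sub>R (f r - f l) - (1 / \<alpha>) *\<^sub>R v) < e"
      proof (rule exI[of _ "min \<delta> d"], intro conjI allI impI)
        show "0 < min \<delta> d" using \<delta> d by simp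
        fix l r assume lr: "l < r \<and> l \<le> x \<and> x \<le> r \<and> r - l < min \<delta> d"
        then have nr: "near \<delta> l r" unfolding near_def using d by auto
        have "dist (u l r) w < \<eta>" using \<delta>(2)[OF nr] \<eta>(1) by (simp add: dist_norm)
        from \<eta>(2)[OF this] show "norm ((1 / (r - l)) *\<^sub>R (f r - f l) - (1 / \<alpha>) *\<^sub>R v) < e"
          unfolding chord(1)[OF nr] by (simp add: dist_norm)
      qed
    qed
    then show False using x by blast
  qed
  ultimately show ?thesis by (rule negligible_subset)
qed

section \<open>Integration in complete normed spaces\<close>

text \<open>
  Additivity and norm bounds of the integral are known for types of class \<open>banach\<close>. A type of sort \<open>{real_normed_vector, complete_space}\<close> is a Banach space but not of that class; it embeds
  isometrically, as the constants, into the bounded continuous functions on the line, which are, and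
  evaluation at 0 is a bounded linear left inverse. Through this embedding the facts about integrals
  carry over.
\<close>

instance bcontfun :: (metric_space, "{real_normed_vector, complete_space}") banach ..

definition to_banach :: "'a::{real_normed_vector, complete_space} \<Rightarrow> (real, 'a) bcontfun" where
  "to_banach v = const_bcontfun v"

definition from_banach :: "(real, 'a::{real_normed_vector, complete_space}) bcontfun \<Rightarrow> 'a" where
  "from_banach f = apply_bcontfun f 0"

lemma from_to_banach [simp]: "from_banach (to_banach v) = v"
  by (simp add: from_banach_def to_banach_def const_bcontfun.rep_eq)

lemma norm_to_banach [simp]: "norm (to_banach v) = norm v"
proof (rule antisym)
  show "norm (to_banach v) \<le> norm v"
    unfolding to_banach_def by (rule norm_bound) (simp add: const_bcontfun.rep_eq)
  show "norm v \<le> norm (to_banach v)"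
    using norm_bounded[of "to_banach v" 0] by (simp add: to_banach_def const_bcontfun.rep_eq)
qed

lemma bounded_linear_to_banach: "bounded_linear to_banach"
proof (rule bounded_linear_intro[where K = 1])
  show "to_banach (x + y) = to_banach x + to_banach y" for x y :: 'a
    unfolding to_banach_def by (rule bcontfun_eqI) (simp add: const_bcontfun.rep_eq plus_bcontfun.rep_eq)
  show "to_banach (r *\<^sub>R x) = r *\<^sub>R to_banach x" for r and x :: 'a
    unfolding to_banach_def by (rule bcontfun_eqI) (simp add: const_bcontfun.rep_eq scaleR_bcontfun.rep_eq)
qed simp

lemma bounded_linear_from_banach: "bounded_linear from_banach"
proof (rule bounded_linear_intro[where K = 1])
  show "norm (from_banach f) \<le> norm f * 1" for f :: "(real, 'a) bcontfun"
    unfolding from_banach_def using norm_bounded[of f 0] by simp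
qed (simp_all add: from_banach_def plus_bcontfun.rep_eq scaleR_bcontfun.rep_eq)

lemma has_integral_to_banach:
  "((\<lambda>x. to_banach (f x)) has_integral to_banach y) S \<longleftrightarrow> (f has_integral y) S"
proof
  assume "((\<lambda>x. to_banach (f x)) has_integral to_banach y) S"
  from has_integral_linear[OF this bounded_linear_from_banach] show "(f has_integral y) S" by (simp add: o_def)
next
  assume "(f has_integral y) S"
  from has_integral_linear[OF this bounded_linear_to_banach]
  show "((\<lambda>x. to_banach (f x)) has_integral to_banach y) S" by (simp add: o_def)
qed

lemma integrable_to_banach: "(\<lambda>x. to_banach (f x)) integrable_on S \<longleftrightarrow> f integrable_on S"
proof
  assume "(\<lambda>x. to_banach (f x)) integrable_on S"
  from integrable_linear[OF this bounded_linear_from_banach] show "f integrable_on S" by (simp add: o_def)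
next
  assume "f integrable_on S"
  from integrable_linear[OF this bounded_linear_to_banach]
  show "(\<lambda>x. to_banach (f x)) integrable_on S" by (simp add: o_def)
qed

lemma integral_to_banach:
  "f integrable_on S \<Longrightarrow> integral S (\<lambda>x. to_banach (f x)) = to_banach (integral S f)"
  using integral_linear[OF _ bounded_linear_to_banach, of f S] by (simp add: o_def)

lemma complete_integrable_on_subinterval:
  fixes f :: "real \<Rightarrow> 'a::{real_normed_vector, complete_space}"
  assumes "f integrable_on S" "{a..b} \<subseteq> S"
  shows "f integrable_on {a..b}"
  using integrable_on_subinterval[of "\<lambda>x. to_banach (f x)" S a b] assms by (simp add: integrable_to_banach)

lemma complete_integrable_combine:
  fixes f :: "real \<Rightarrow> 'a::{real_normed_vector, complete_space}"
  assumes "a \<le> c" "c \<le> b" "f integrable_on {a..c}" "f integrable_on {c..b}"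
  shows "f integrable_on {a..b}"
  using Henstock_Kurzweil_Integration.integrable_combine[of a c b "\<lambda>x. to_banach (f x)"] assms
  by (simp add: integrable_to_banach)

lemma complete_integral_combine:
  fixes f :: "real \<Rightarrow> 'a::{real_normed_vector, complete_space}"
  assumes "a \<le> c" "c \<le> b" and f: "f integrable_on {a..b}"
  shows "integral {a..c} f + integral {c..b} f = integral {a..b} f"
proof -
  have "f integrable_on {a..c}" "f integrable_on {c..b}"
    using complete_integrable_on_subinterval[OF f] assms(1,2) by auto
  then have "(f has_integral (integral {a..c} f)) {a..c}" "(f has_integral (integral {c..b} f)) {c..b}"
    by (auto intro: integrable_integral)
  then have "((\<lambda>x. to_banach (f x)) has_integral to_banach (integral {a..c} f) + to_banach (integral {c..b} f)) {a..b}"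
    unfolding has_integral_to_banach[symmetric, of f]
    by (rule Henstock_Kurzweil_Integration.has_integral_combine[OF assms(1,2)])
  then have "((\<lambda>x. to_banach (f x)) has_integral to_banach (integral {a..c} f + integral {c..b} f)) {a..b}"
    by (simp add: linear_add[OF bounded_linear.linear[OF bounded_linear_to_banach]])
  then show ?thesis unfolding has_integral_to_banach by (rule integral_unique[symmetric])
qed

lemma complete_integral_norm_bound:
  fixes f :: "real \<Rightarrow> 'a::{real_normed_vector, complete_space}"
  assumes f: "f integrable_on S" and g: "g integrable_on S" and le: "\<And>x. x \<in> S \<Longrightarrow> norm (f x) \<le> g x"
  shows "norm (integral S f) \<le> integral S g"
  using Henstock_Kurzweil_Integration.integral_norm_bound_integral[of "\<lambda>x. to_banach (f x)" S g] f g le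
  by (simp add: integrable_to_banach integral_to_banach)

lemma complete_indefinite_integral_continuous:
  fixes f :: "real \<Rightarrow> 'a::{real_normed_vector, complete_space}"
  assumes f: "f integrable_on {a..b}"
  shows "continuous_on {a..b} (\<lambda>t. integral {a..t} f)"
proof -
  have "continuous_on {a..b} (\<lambda>t. from_banach (integral {a..t} (\<lambda>x. to_banach (f x))))"
    by (intro bounded_linear.continuous_on[OF bounded_linear_from_banach] indefinite_integral_continuous_1)
      (simp add: integrable_to_banach f)
  moreover have "from_banach (integral {a..t} (\<lambda>x. to_banach (f x))) = integral {a..t} f" if "t \<in> {a..b}" for t
    using complete_integrable_on_subinterval[OF f, of a t] that by (simp add: integral_to_banach)
  ultimately show ?thesis by (rule continuous_on_eq)
qed

lemma complete_integral_has_vector_derivative: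
  fixes f :: "real \<Rightarrow> 'a::{real_normed_vector, complete_space}"
  assumes f: "continuous_on {a..b} f" and fi: "f integrable_on {a..b}" and t: "t \<in> {a..b}"
  shows "((\<lambda>u. integral {a..u} f) has_vector_derivative f t) (at t within {a..b})"
proof -
  have "((\<lambda>u. integral {a..u} (\<lambda>x. to_banach (f x))) has_vector_derivative to_banach (f t)) (at t within {a..b})"
    by (intro integral_has_vector_derivative bounded_linear.continuous_on[OF bounded_linear_to_banach] f t)
  from bounded_linear.has_vector_derivative[OF bounded_linear_from_banach this]
  have "((\<lambda>u. from_banach (integral {a..u} (\<lambda>x. to_banach (f x)))) has_vector_derivative f t) (at t within {a..b})" by simp
  then show ?thesis
  proof (rule has_vector_derivative_transform[rotated 2])
    show "integral {a..u} f = from_banach (integral {a..u} (\<lambda>x. to_banach (f x)))" if "u \<in> {a..b}" for u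
      using complete_integrable_on_subinterval[OF fi, of a u] that by (simp add: integral_to_banach)
  qed (rule t)
qed

section \<open>Absolutely continuous functions and the integral\<close>

definition nonoverlapping_in :: "real \<Rightarrow> real \<Rightarrow> 'i set \<Rightarrow> ('i \<Rightarrow> real) \<Rightarrow> ('i \<Rightarrow> real) \<Rightarrow> bool" where
  "nonoverlapping_in a b I l r \<longleftrightarrow> finite I \<and> (\<forall>i\<in>I. a \<le> l i \<and> l i \<le> r i \<and> r i \<le> b) \<and>
     (\<forall>i\<in>I. \<forall>j\<in>I. i \<noteq> j \<longrightarrow> {l i<..<r i} \<inter> {l j<..<r j} = {})"

text \<open>
  The definition of absolute continuity speaks of families indexed by initial segments of the natural
  numbers; arbitrary finite index sets reduce to it by enumeration.
\<close>

lemma absolutely_continuous_family: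
  fixes f :: "real \<Rightarrow> 'a::real_normed_vector"
  assumes ac: "absolutely_continuous_on_interval f a b" and e: "0 < e"
  obtains \<delta> where "0 < \<delta>"
    "\<And>(I :: 'i set) l r. nonoverlapping_in a b I l r \<Longrightarrow> (\<Sum>i\<in>I. r i - l i) < \<delta> \<Longrightarrow> (\<Sum>i\<in>I. norm (f (r i) - f (l i))) < e"
proof -
  obtain \<delta> where \<delta>: "0 < \<delta>"
    and H: "\<forall>(n::nat) l r.
        (\<forall>i<n. a \<le> l i \<and> l i \<le> r i \<and> r i \<le> b) \<and>
        (\<forall>i<n. \<forall>j<n. i \<noteq> j \<longrightarrow> {l i<..<r i} \<inter> {l j<..<r j} = {}) \<and>
        (\<Sum>i<n. r i - l i) < \<delta>
        \<longrightarrow> (\<Sum>i<n. norm (f (r i) - f (l i))) < e"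
    using ac[unfolded absolutely_continuous_on_interval_def, THEN spec, THEN mp, OF e] by (elim exE conjE)
  have ac': "(\<Sum>i<n. norm (f (r i) - f (l i))) < e"
    if "\<forall>i<n. a \<le> l i \<and> l i \<le> r i \<and> r i \<le> b"
      "\<forall>i<n. \<forall>j<n. i \<noteq> j \<longrightarrow> {l i<..<r i} \<inter> {l j<..<r j} = {}" "(\<Sum>i<n. r i - l i) < \<delta>"
    for n :: nat and l r
    by (rule H[THEN spec, THEN spec, THEN spec, THEN mp]) (intro conjI that)
  show ?thesis
  proof (rule that[OF \<delta>])
    fix I :: "'i set" and l r
    assume I: "nonoverlapping_in a b I l r" and small: "(\<Sum>i\<in>I. r i - l i) < \<delta>"
    then have fin: "finite I" and lr: "\<And>i. i \<in> I \<Longrightarrow> a \<le> l i \<and> l i \<le> r i \<and> r i \<le> b"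
      and disj: "\<And>i j. i \<in> I \<Longrightarrow> j \<in> I \<Longrightarrow> i \<noteq> j \<Longrightarrow> {l i<..<r i} \<inter> {l j<..<r j} = {}"
      unfolding nonoverlapping_in_def by blast+
    obtain h where h: "bij_betw h {..<card I} I"
      using ex_bij_betw_nat_finite[OF fin] unfolding atLeast0LessThan by blast
    have hI: "h i \<in> I" if "i < card I" for i using h that by (auto simp: bij_betw_def)
    have inj: "h i \<noteq> h j" if "i < card I" "j < card I" "i \<noteq> j" for i j
      using h that by (auto simp: bij_betw_def inj_on_def)
    have re: "(\<Sum>i<card I. g (h i)) = (\<Sum>i\<in>I. g i)" for g :: "'i \<Rightarrow> real"
      by (rule sum.reindex_bij_betw[OF h])
    have "(\<Sum>i<card I. norm (f (r (h i)) - f (l (h i)))) < e"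
    proof (rule ac')
      show "\<forall>i<card I. a \<le> l (h i) \<and> l (h i) \<le> r (h i) \<and> r (h i) \<le> b" using lr hI by blast
      show "\<forall>i<card I. \<forall>j<card I. i \<noteq> j \<longrightarrow> {l (h i)<..<r (h i)} \<inter> {l (h j)<..<r (h j)} = {}"
        using disj hI inj by blast
      show "(\<Sum>i<card I. r (h i) - l (h i)) < \<delta>" using small re[of "\<lambda>i. r i - l i"] by simp
    qed
    then show "(\<Sum>i\<in>I. norm (f (r i) - f (l i))) < e" using re[of "\<lambda>i. norm (f (r i) - f (l i))"] by simp
  qed
qed

text \<open>
  On intervals shorter than the \<open>\<delta>\<close> that belongs to \<open>\<epsilon> = 1\<close> the variation is at most 1, and countably
  many such intervals cover the given one.
\<close>

lemma absolutely_continuous_ae_differentiable: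
  fixes f :: "real \<Rightarrow> 'a::{real_inner, complete_space}"
  assumes ac: "absolutely_continuous_on_interval f a b"
  shows "negligible {x \<in> {a<..<b}. \<not> (\<exists>D. (f has_vector_derivative D) (at x))}" (is "negligible ?S")
proof -
  obtain \<delta> where \<delta>: "0 < \<delta>"
    and small: "\<And>(I :: real set set) l r. nonoverlapping_in a b I l r \<Longrightarrow> (\<Sum>i\<in>I. r i - l i) < \<delta> \<Longrightarrow> (\<Sum>i\<in>I. norm (f (r i) - f (l i))) < 1"
    using absolutely_continuous_family[OF ac zero_less_one] by blast
  define \<eta> where "\<eta> = \<delta> / 3"
  have \<eta>: "0 < \<eta>" "2 * \<eta> < \<delta>" unfolding \<eta>_def using \<delta> by auto
  \<comment> \<open>Overlapping intervals, so that every point of \<open>{a<..<b}\<close> is interior to one of them.\<close>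
  define c where "c = (\<lambda>k::nat. max a (a + real k * \<eta> - \<eta>))"
  define d where "d = (\<lambda>k::nat. min b (a + real k * \<eta> + \<eta>))"
  define S where "S = (\<lambda>k. {x \<in> {c k<..<d k}. \<not> (\<exists>D. (f has_vector_derivative D) (at x))})"
  have "negligible (S k)" for k
  proof (cases "c k \<le> d k")
    case False
    then have "S k = {}" unfolding S_def by auto
    then show ?thesis by simp
  next
    case True
    show ?thesis
      unfolding S_def
    proof (rule bounded_variation_ae_differentiable[OF True, where V = 1])
      fix D assume D: "D division_of {c k..d k}"
      have "(\<Sum>K\<in>D. norm (f (Sup K) - f (Inf K))) < 1"
      proof (rule small, unfold nonoverlapping_in_def, intro conjI ballI impI)
        show "finite D" using division_ofD(1)[OF D] .
        fix K assume KD: "K \<in> D"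
        obtain l r where lr: "l \<le> r" "K = {l..r}" by (rule division_of_real_interval[OF D KD])
        then have "c k \<le> l" "r \<le> d k" using division_ofD(2)[OF D KD] by auto
        then show "a \<le> Inf K" "Inf K \<le> Sup K" "Sup K \<le> b" using lr unfolding c_def d_def by auto
      next
        fix K K' assume KK: "K \<in> D" "K' \<in> D" "K \<noteq> K'"
        obtain l r where lr: "l \<le> r" "K = {l..r}" by (rule division_of_real_interval[OF D KK(1)])
        obtain l' r' where lr': "l' \<le> r'" "K' = {l'..r'}" by (rule division_of_real_interval[OF D KK(2)])
        show "{Inf K<..<Sup K} \<inter> {Inf K'<..<Sup K'} = {}"
          using division_ofD(5)[OF D KK] lr lr' by (simp add: interior_atLeastAtMost_real)
      next
        have "(\<Sum>K\<in>D. Sup K - Inf K) = d k - c k"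
          using sum_increment_division[OF True D, of "\<lambda>t. t"] unfolding increment_def .
        also have "\<dots> \<le> 2 * \<eta>" unfolding c_def d_def by linarith
        finally show "(\<Sum>K\<in>D. Sup K - Inf K) < \<delta>" using \<eta>(2) by simp
      qed
      then show "(\<Sum>K\<in>D. norm (increment f K)) \<le> 1" unfolding increment_def by simp
    qed
  qed
  then have "negligible (\<Union>k. S k)" by (intro negligible_countable_Union) auto
  moreover have "?S \<subseteq> (\<Union>k. S k)"
  proof
    fix x assume x: "x \<in> ?S"
    define k where "k = nat \<lfloor>(x - a) / \<eta>\<rfloor>"
    have "0 \<le> (x - a) / \<eta>" using x \<eta> by simp
    then have "real k \<le> (x - a) / \<eta>" "(x - a) / \<eta> < real k + 1" unfolding k_def by linarith+
    then have "real k * \<eta> \<le> x - a" "x - a < real k * \<eta> + \<eta>"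
      using \<eta> by (auto simp: field_simps)
    then have "x \<in> S k" using x \<eta> unfolding S_def c_def d_def by auto
    then show "x \<in> (\<Union>k. S k)" by blast
  qed
  ultimately show ?thesis by (rule negligible_subset)
qed

text \<open>
  Let the integrand be 0 on \<open>N\<close>. At points outside \<open>N\<close> the gauge makes the increments of \<open>F\<close> nearly
  equal to those predicted by the derivative. At points of \<open>N\<close> it keeps the intervals inside an open
  set \<open>U\<close> of small measure around \<open>N\<close>, and absolute continuity makes the sum of the increments over
  those intervals small.
\<close>

theorem absolutely_continuous_fundamental_theorem:
  fixes F :: "real \<Rightarrow> 'a::{real_normed_vector, complete_space}"
  assumes ab: "a \<le> b" and ac: "absolutely_continuous_on_interval F a b" and N: "negligible N"
    and deriv: "\<And>t. t \<in> {a..b} - N \<Longrightarrow> (F has_vector_derivative F' t) (at t within {a..b})"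
  shows "(F' has_integral (F b - F a)) {a..b}"
proof -
  define g where "g = (\<lambda>t. if t \<in> N then 0 else F' t)"
  have "(g has_integral (F b - F a)) {a..b}"
    unfolding has_integral_real
  proof (intro allI impI)
    fix e :: real assume e: "0 < e"
    define e1 where "e1 = e / (2 * (b - a + 1))"
    have e1: "0 < e1" unfolding e1_def using e ab by simp
    have "\<forall>t. \<exists>d>0. t \<in> {a..b} - N \<longrightarrow> (\<forall>y\<in>{a..b}. norm (y - t) < d \<longrightarrow> norm (F y - F t - (y - t) *\<^sub>R F' t) \<le> e1 * norm (y - t))"
      using deriv[unfolded has_vector_derivative_def has_derivative_within_alt] e1 zero_less_one by blast
    then obtain d where d: "\<And>t. 0 < d t"
        "\<And>t y. t \<in> {a..b} - N \<Longrightarrow> y \<in> {a..b} \<Longrightarrow> norm (y - t) < d t \<Longrightarrow> norm (F y - F t - (y - t) *\<^sub>R F' t) \<le> e1 * norm (y - t)"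
      by metis
    have e2: "0 < e / 2" using e by simp
    obtain \<delta> where \<delta>: "0 < \<delta>"
      and small: "\<And>(I :: (real \<times> real set) set) l r. nonoverlapping_in a b I l r \<Longrightarrow> (\<Sum>i\<in>I. r i - l i) < \<delta> \<Longrightarrow> (\<Sum>i\<in>I. norm (F (r i) - F (l i))) < e / 2"
      using absolutely_continuous_family[OF ac e2] by blast
    obtain U where U: "open U" "N \<subseteq> U" "U - N \<in> lmeasurable" "emeasure lebesgue (U - N) < ennreal \<delta>"
      using sets_lebesgue_outer_open[OF negligible_imp_sets[OF N] \<delta>] by blast
    have Ul: "U \<in> lmeasurable"
    proof -
      have "(U - N) \<union> N \<in> lmeasurable" using U(3) negligible_imp_measurable[OF N] by (rule fmeasurable.Un)
      moreover have "(U - N) \<union> N = U" using U(2) by blast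
      ultimately show ?thesis by simp
    qed
    have mU: "measure lebesgue U < \<delta>"
    proof -
      have "U = (U - N) \<union> N" using U(2) by blast
      then have "measure lebesgue U \<le> measure lebesgue (U - N) + measure lebesgue N"
        using measure_Un_le[of "U - N" lebesgue N] U(3) negligible_imp_sets[OF N] by (metis fmeasurableD)
      moreover have "measure lebesgue (U - N) < \<delta>"
        using U(4) emeasure_eq_measure2[OF U(3)] \<delta> by (simp add: ennreal_less_iff)
      ultimately show ?thesis using negligible_imp_measure0[OF N] by simp
    qed
    define \<gamma> where "\<gamma> = (\<lambda>t. if t \<in> N then U else ball t (d t))"
    show "\<exists>\<gamma>. gauge \<gamma> \<and> (\<forall>\<D>. \<D> tagged_division_of {a..b} \<and> \<gamma> fine \<D> \<longrightarrow>
        norm ((\<Sum>(x, K)\<in>\<D>. measure lborel K *\<^sub>R g x) - (F b - F a)) < e)"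
    proof (intro exI[of _ \<gamma>] conjI allI impI)
      show "gauge \<gamma>" unfolding gauge_def \<gamma>_def using U d(1) by auto
      fix p assume p: "p tagged_division_of {a..b} \<and> \<gamma> fine p"
      then have pt: "p tagged_division_of {a..b}" and fine: "\<gamma> fine p" by auto
      have finp: "finite p" using pt by blast
      have iv: "\<exists>l r. l \<le> x \<and> x \<le> r \<and> K = {l..r} \<and> a \<le> l \<and> r \<le> b" if xK: "(x, K) \<in> p" for x K
      proof -
        obtain l r where "K = cbox l r" using tagged_division_ofD(4)[OF pt xK] by blast
        moreover have "x \<in> K" "K \<subseteq> {a..b}" using tagged_division_ofD(2,3)[OF pt xK] .
        ultimately show ?thesis by (intro exI[of _ l] exI[of _ r]) auto
      qed
      have nonover: "{Inf K<..<Sup K} \<inter> {Inf K'<..<Sup K'} = {}" if "(x, K) \<in> p" "(x', K') \<in> p" "(x, K) \<noteq> (x', K')" for x K x' K'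
        using tagged_division_ofD(5)[OF pt that] iv[OF that(1)] iv[OF that(2)]
        by (auto simp: interior_atLeastAtMost_real)
      let ?D = "\<lambda>(x, K). measure lborel K *\<^sub>R g x - (F (Sup K) - F (Inf K))"
      let ?A = "{(x, K) \<in> p. x \<in> N}"
      have n1: "norm (\<Sum>i\<in>?A. ?D i) < e / 2"
      proof -
        have "(\<Sum>i\<in>?A. norm (F (Sup (snd i)) - F (Inf (snd i)))) < e / 2"
        proof (rule small)
          have "finite ?A" using finp by (rule rev_finite_subset) auto
          have A1: "a \<le> Inf (snd i) \<and> Inf (snd i) \<le> Sup (snd i) \<and> Sup (snd i) \<le> b" if "i \<in> ?A" for i
            using iv[of "fst i" "snd i"] that by auto
          have dj: "{Inf (snd i)<..<Sup (snd i)} \<inter> {Inf (snd j)<..<Sup (snd j)} = {}" if "i \<in> ?A" "j \<in> ?A" "i \<noteq> j" for i j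
            using nonover[of "fst i" "snd i" "fst j" "snd j"] that by (auto simp: prod_eq_iff)
          show "nonoverlapping_in a b ?A (\<lambda>i. Inf (snd i)) (\<lambda>i. Sup (snd i))"
            unfolding nonoverlapping_in_def using \<open>finite ?A\<close> A1 dj by blast
          have "(\<Sum>i\<in>?A. Sup (snd i) - Inf (snd i)) = (\<Sum>i\<in>?A. measure lebesgue {Inf (snd i)<..<Sup (snd i)})"
          proof (rule sum.cong[OF refl])
            fix i assume "i \<in> ?A"
            then obtain l r where "l \<le> r" "snd i = {l..r}" using iv[of "fst i" "snd i"] by force
            then show "Sup (snd i) - Inf (snd i) = measure lebesgue {Inf (snd i)<..<Sup (snd i)}" by simp
          qed
          also have "\<dots> = measure lebesgue (\<Union>i\<in>?A. {Inf (snd i)<..<Sup (snd i)})"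
          proof (rule measure_finite_Union[symmetric, OF \<open>finite ?A\<close>])
            show "disjoint_family_on (\<lambda>i. {Inf (snd i)<..<Sup (snd i)}) ?A"
              unfolding disjoint_family_on_def using dj by blast
            show "emeasure lebesgue {Inf (snd i)<..<Sup (snd i)} \<noteq> \<infinity>" if "i \<in> ?A" for i
              using A1[OF that] by simp
          qed auto
          also have "\<dots> \<le> measure lebesgue U"
          proof (rule measure_mono_fmeasurable[OF _ _ Ul])
            show "(\<Union>i\<in>?A. {Inf (snd i)<..<Sup (snd i)}) \<in> sets lebesgue"
              using \<open>finite ?A\<close> by (intro sets.finite_UN) auto
            show "(\<Union>i\<in>?A. {Inf (snd i)<..<Sup (snd i)}) \<subseteq> U"
            proof (rule UN_least)
              fix i assume i: "i \<in> ?A"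
              then obtain l r where lr: "l \<le> r" "snd i = {l..r}" using iv[of "fst i" "snd i"] by force
              have "snd i \<subseteq> \<gamma> (fst i)" using fineD[OF fine, of "fst i" "snd i"] i by auto
              then have "snd i \<subseteq> U" using i unfolding \<gamma>_def by auto
              then show "{Inf (snd i)<..<Sup (snd i)} \<subseteq> U" using lr by auto
            qed
          qed
          also note mU
          finally show "(\<Sum>i\<in>?A. Sup (snd i) - Inf (snd i)) < \<delta>" .
        qed
        moreover have "norm (\<Sum>i\<in>?A. ?D i) \<le> (\<Sum>i\<in>?A. norm (F (Sup (snd i)) - F (Inf (snd i))))"
          by (rule sum_norm_le) (auto simp: g_def norm_minus_commute)
        ultimately show ?thesis by simp
      qed
      have n2: "norm (\<Sum>i\<in>p - ?A. ?D i) \<le> e / 2"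
      proof -
        have "norm (\<Sum>i\<in>p - ?A. ?D i) \<le> (\<Sum>i\<in>p - ?A. e1 * (Sup (snd i) - Inf (snd i)))"
        proof (rule sum_norm_le)
          fix i assume i: "i \<in> p - ?A"
          obtain x K where xK: "i = (x, K)" by (cases i)
          have xp: "(x, K) \<in> p" "x \<notin> N" using i xK by auto
          obtain l r where lr: "l \<le> x" "x \<le> r" "K = {l..r}" "a \<le> l" "r \<le> b" using iv[OF xp(1)] by blast
          have "K \<subseteq> ball x (d x)" using fineD[OF fine xp(1)] xp(2) unfolding \<gamma>_def by simp
          moreover have "l \<in> K" "r \<in> K" using lr by auto
          ultimately have near: "norm (l - x) < d x" "norm (r - x) < d x" by (auto simp: dist_real_def)
          have xab: "x \<in> {a..b} - N" using xp(2) lr by auto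
          have bnd: "norm (F r - F x - (r - x) *\<^sub>R F' x) \<le> e1 * norm (r - x)" "norm (F l - F x - (l - x) *\<^sub>R F' x) \<le> e1 * norm (l - x)"
            using d(2)[OF xab, of r] d(2)[OF xab, of l] near lr by auto
          have eq: "(r - l) *\<^sub>R F' x - (F r - F l) = (F l - F x - (l - x) *\<^sub>R F' x) - (F r - F x - (r - x) *\<^sub>R F' x)"
            by (simp add: algebra_simps)
          have "norm ((r - l) *\<^sub>R F' x - (F r - F l)) \<le> e1 * norm (l - x) + e1 * norm (r - x)"
            unfolding eq using bnd norm_triangle_ineq4[of "F l - F x - (l - x) *\<^sub>R F' x" "F r - F x - (r - x) *\<^sub>R F' x"]
            by linarith
          also have "\<dots> = e1 * (r - l)" using lr by (simp add: algebra_simps)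
          finally show "norm (?D i) \<le> e1 * (Sup (snd i) - Inf (snd i))"
            using lr xp(2) xK unfolding g_def by simp
        qed
        also have "\<dots> \<le> (\<Sum>i\<in>p. e1 * (Sup (snd i) - Inf (snd i)))"
        proof (rule sum_mono2[OF finp])
          fix i assume "i \<in> p - (p - ?A)"
          then have ip: "(fst i, snd i) \<in> p" by simp
          obtain l r where "l \<le> fst i" "fst i \<le> r" "snd i = {l..r}" using iv[OF ip] by blast
          then show "0 \<le> e1 * (Sup (snd i) - Inf (snd i))" using e1 by simp
        qed auto
        also have "\<dots> = e1 * (b - a)"
          unfolding sum_distrib_left[symmetric]
          using additive_tagged_division_1[OF ab pt, of "\<lambda>t. t"] by (simp add: case_prod_beta')
        also have "\<dots> \<le> e / 2" unfolding e1_def using e ab by (simp add: field_simps)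
        finally show ?thesis .
      qed
      have split: "(\<Sum>i\<in>p. ?D i) = (\<Sum>i\<in>p - ?A. ?D i) + (\<Sum>i\<in>?A. ?D i)"
        by (rule sum.subset_diff[OF _ finp]) auto
      have "norm (\<Sum>i\<in>p. ?D i) < e"
        unfolding split by (rule norm_triangle_lt) (use n1 n2 in linarith)
      moreover have "(\<Sum>i\<in>p. ?D i) = (\<Sum>(x, K)\<in>p. measure lborel K *\<^sub>R g x) - (F b - F a)"
        using additive_tagged_division_1[OF ab pt, of F] by (simp add: case_prod_beta' sum_subtractf)
      ultimately show "norm ((\<Sum>(x, K)\<in>p. measure lborel K *\<^sub>R g x) - (F b - F a)) < e" by simp
    qed
  qed
  then show ?thesis by (rule has_integral_spike[OF N, rotated]) (auto simp: g_def)
qed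

text \<open>
  At almost every \<open>x\<close> the means of \<open>f\<close> over short intervals around \<open>x\<close> are close to \<open>f x\<close>. By
  Henstock's lemma, the errors \<open>\<bar>(r - l) f x - \<integral>f\<bar>\<close> over disjoint intervals that are fine for a suitable
  gauge have a small sum; intervals with error at least \<open>\<eta> (r - l)\<close> therefore have small total length,
  and Vitali's theorem applies.
\<close>

lemma Lebesgue_points:
  fixes f :: "real \<Rightarrow> real"
  assumes f: "f integrable_on {a..b}"
  shows "negligible {x \<in> {a<..<b}. \<exists>\<eta>>0. \<forall>\<delta>>0. \<exists>l r. a \<le> l \<and> l < r \<and> r \<le> b \<and> l \<le> x \<and> x \<le> r \<and> r - l < \<delta> \<and>
      \<eta> * (r - l) \<le> \<bar>(r - l) * f x - integral {l..r} f\<bar>}" (is "negligible ?B")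
proof -
  define S where "S = (\<lambda>\<eta>. {x \<in> {a<..<b}. \<forall>\<delta>>0. \<exists>l r. a \<le> l \<and> l < r \<and> r \<le> b \<and> l \<le> x \<and> x \<le> r \<and> r - l < \<delta> \<and>
      \<eta> * (r - l) \<le> \<bar>(r - l) * f x - integral {l..r} f\<bar>})"
  have neg: "negligible (S \<eta>)" if \<eta>: "0 < \<eta>" for \<eta>
  proof (rule Vitali_negligible)
    fix e :: real assume "0 < e"
    then have e\<eta>: "0 < \<eta> * e" using \<eta> by simp
    obtain \<gamma> where \<gamma>: "gauge \<gamma>"
      and hen: "\<And>p. p tagged_partial_division_of (cbox a b) \<Longrightarrow> \<gamma> fine p \<Longrightarrow>
             (\<Sum>(x,K)\<in>p. norm (measure lborel K *\<^sub>R f x - integral K f)) < \<eta> * e"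
      using Henstock_lemma[of f a b, OF _ e\<eta>] f by (metis (no_types, lifting) box_real(2))
    define Q where "Q = (\<lambda>l r. a \<le> l \<and> r \<le> b \<and> (\<exists>x\<in>{l..r}. {l..r} \<subseteq> \<gamma> x \<and>
        \<eta> * (r - l) \<le> \<bar>(r - l) * f x - integral {l..r} f\<bar>))"
    show "\<exists>N Q. negligible N \<and>
     (\<forall>x\<in>S \<eta> - N. \<forall>\<delta>>0. \<exists>l r. l < r \<and> l \<le> x \<and> x \<le> r \<and> r - l < \<delta> \<and> Q l r) \<and>
     (\<forall>\<D>. finite \<D> \<longrightarrow> pairwise disjnt \<D> \<longrightarrow> (\<forall>K\<in>\<D>. \<exists>l r. l < r \<and> K = {l..r} \<and> Q l r)
        \<longrightarrow> (\<Sum>K\<in>\<D>. Sup K - Inf K) \<le> e)"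
    proof (rule exI[of _ "{}"], rule exI[of _ Q], intro conjI ballI allI impI)
      fix x \<delta> :: real assume x: "x \<in> S \<eta> - {}" and \<delta>: "0 < \<delta>"
      have "open (\<gamma> x)" "x \<in> \<gamma> x" using \<gamma> unfolding gauge_def by auto
      then obtain \<rho> where \<rho>: "0 < \<rho>" "ball x \<rho> \<subseteq> \<gamma> x" using open_contains_ball by blast
      have "0 < min \<delta> \<rho>" using \<delta> \<rho> by simp
      then obtain l r where lr: "a \<le> l" "l < r" "r \<le> b" "l \<le> x" "x \<le> r" "r - l < min \<delta> \<rho>"
          "\<eta> * (r - l) \<le> \<bar>(r - l) * f x - integral {l..r} f\<bar>"
        using x unfolding S_def by blast
      have "{l..r} \<subseteq> ball x \<rho>" using lr by (auto simp: dist_real_def)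
      then have "Q l r" unfolding Q_def using lr \<rho>(2) by (intro conjI bexI[of _ x]) auto
      then show "\<exists>l r. l < r \<and> l \<le> x \<and> x \<le> r \<and> r - l < \<delta> \<and> Q l r"
        using lr by (intro exI[of _ l] exI[of _ r]) auto
    next
      fix \<D> :: "real set set"
      assume fin: "finite \<D>" and disj: "pairwise disjnt \<D>"
        and iv: "\<forall>K\<in>\<D>. \<exists>l r. l < r \<and> K = {l..r} \<and> Q l r"
      have "\<exists>x. \<exists>l r. l < r \<and> K = {l..r} \<and> a \<le> l \<and> r \<le> b \<and> x \<in> K \<and> K \<subseteq> \<gamma> x \<and>
          \<eta> * (r - l) \<le> \<bar>(r - l) * f x - integral K f\<bar>" if KD: "K \<in> \<D>" for K
      proof -
        obtain l r where lr: "l < r" "K = {l..r}" "Q l r" using iv KD by blast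
        then obtain x where "x \<in> {l..r}" "{l..r} \<subseteq> \<gamma> x" "\<eta> * (r - l) \<le> \<bar>(r - l) * f x - integral {l..r} f\<bar>"
          unfolding Q_def by blast
        then show ?thesis using lr unfolding Q_def by (intro exI[of _ x] exI[of _ l] exI[of _ r]) simp
      qed
      \<comment> \<open>The tag of each interval is the bad point that made it a member of the family.\<close>
      then obtain \<tau> where \<tau>: "\<And>K. K \<in> \<D> \<Longrightarrow> \<exists>l r. l < r \<and> K = {l..r} \<and> a \<le> l \<and> r \<le> b \<and> \<tau> K \<in> K \<and> K \<subseteq> \<gamma> (\<tau> K) \<and>
          \<eta> * (r - l) \<le> \<bar>(r - l) * f (\<tau> K) - integral K f\<bar>"
        by metis
      define p where "p = (\<lambda>K. (\<tau> K, K)) ` \<D>"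
      have "p tagged_partial_division_of cbox a b"
        unfolding tagged_partial_division_of_def
      proof (intro conjI allI impI)
        show "finite p" unfolding p_def using fin by simp
        fix x K assume "(x, K) \<in> p"
        then have K: "K \<in> \<D>" "x = \<tau> K" unfolding p_def by auto
        from \<tau>[OF K(1)] obtain l r where "l < r" "K = {l..r}" "a \<le> l" "r \<le> b" "\<tau> K \<in> K" by blast
        then show "x \<in> K" "K \<subseteq> cbox a b" "\<exists>a b. K = cbox a b" using K by auto
      next
        fix x1 K1 x2 K2 assume "(x1, K1) \<in> p \<and> (x2, K2) \<in> p \<and> (x1, K1) \<noteq> (x2, K2)"
        then have "K1 \<in> \<D>" "K2 \<in> \<D>" "K1 \<noteq> K2" unfolding p_def by auto
        then have "K1 \<inter> K2 = {}" using disj unfolding pairwise_def disjnt_def by blast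
        then show "interior K1 \<inter> interior K2 = {}" using interior_subset by blast
      qed
      moreover have "\<gamma> fine p" unfolding fine_def p_def using \<tau> by blast
      ultimately have small: "(\<Sum>(x,K)\<in>p. norm (measure lborel K *\<^sub>R f x - integral K f)) < \<eta> * e" by (rule hen)
      have "\<eta> * (\<Sum>K\<in>\<D>. Sup K - Inf K) \<le> (\<Sum>K\<in>\<D>. norm (measure lborel K *\<^sub>R f (\<tau> K) - integral K f))"
        unfolding sum_distrib_left
      proof (rule sum_mono)
        fix K assume "K \<in> \<D>"
        from \<tau>[OF this] obtain l r where "l < r" "K = {l..r}" "\<eta> * (r - l) \<le> \<bar>(r - l) * f (\<tau> K) - integral K f\<bar>" by blast
        then show "\<eta> * (Sup K - Inf K) \<le> norm (measure lborel K *\<^sub>R f (\<tau> K) - integral K f)" by simp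
      qed
      also have "\<dots> = (\<Sum>(x,K)\<in>p. norm (measure lborel K *\<^sub>R f x - integral K f))"
        unfolding p_def by (subst sum.reindex) (auto simp: inj_on_def)
      also note small
      finally have "\<eta> * (\<Sum>K\<in>\<D>. Sup K - Inf K) \<le> \<eta> * e" by simp
      from mult_left_le_imp_le[OF this \<eta>] show "(\<Sum>K\<in>\<D>. Sup K - Inf K) \<le> e" .
    qed simp
  qed
  have "negligible (\<Union>n. S (1 / real (Suc n)))"
    using neg by (intro negligible_countable_Union) auto
  moreover have "?B \<subseteq> (\<Union>n. S (1 / real (Suc n)))"
  proof
    fix x assume "x \<in> ?B"
    then obtain \<eta> where \<eta>: "0 < \<eta>" and x: "x \<in> {a<..<b}"
      and far: "\<And>\<delta>. 0 < \<delta> \<Longrightarrow> \<exists>l r. a \<le> l \<and> l < r \<and> r \<le> b \<and> l \<le> x \<and> x \<le> r \<and> r - l < \<delta> \<and>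
        \<eta> * (r - l) \<le> \<bar>(r - l) * f x - integral {l..r} f\<bar>" by blast
    obtain n where n: "1 / real (Suc n) < \<eta>" using reals_Archimedean[OF \<eta>] by (auto simp: inverse_eq_divide)
    have "x \<in> S (1 / real (Suc n))"
      unfolding S_def
    proof (intro CollectI conjI allI impI x)
      fix \<delta> :: real assume "0 < \<delta>"
      from far[OF this] obtain l r where lr: "a \<le> l" "l < r" "r \<le> b" "l \<le> x" "x \<le> r" "r - l < \<delta>"
          "\<eta> * (r - l) \<le> \<bar>(r - l) * f x - integral {l..r} f\<bar>" by blast
      moreover have "1 / real (Suc n) * (r - l) \<le> \<eta> * (r - l)" using n lr(2) by (intro mult_right_mono) auto
      ultimately show "\<exists>l r. a \<le> l \<and> l < r \<and> r \<le> b \<and> l \<le> x \<and> x \<le> r \<and> r - l < \<delta> \<and>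
        1 / real (Suc n) * (r - l) \<le> \<bar>(r - l) * f x - integral {l..r} f\<bar>" by (meson order_trans)
    qed
    then show "x \<in> (\<Union>n. S (1 / real (Suc n)))" by blast
  qed
  ultimately show ?thesis by (rule negligible_subset)
qed

text \<open>
  Riemann sums of \<open>f\<close> differ from those of \<open>\<phi>\<close> by at most \<open>e\<close> times those of \<open>h\<close>, which are bounded for
  fine divisions. So the Cauchy criterion passes from \<open>\<phi>\<close> to \<open>f\<close>.
\<close>

lemma integrable_dominated_approx:
  fixes f :: "real \<Rightarrow> 'a::{real_normed_vector, complete_space}" and h :: "real \<Rightarrow> real"
  assumes h: "h integrable_on {a..b}"
    and approx: "\<And>e. 0 < e \<Longrightarrow> \<exists>\<phi>. \<phi> integrable_on {a..b} \<and> (\<forall>x\<in>{a..b}. norm (f x - \<phi> x) \<le> e * h x)"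
  shows "f integrable_on {a..b}"
proof -
  define H where "H = integral {a..b} h"
  have h0: "0 \<le> h x" if "x \<in> {a..b}" for x
    using approx[OF zero_less_one] that by (metis mult_1 norm_ge_zero order_trans)
  have H0: "0 \<le> H" unfolding H_def using h h0 by (intro integral_nonneg) auto
  have "f integrable_on cbox a b"
    unfolding integrable_Cauchy
  proof (intro allI impI)
    fix e :: real assume e: "0 < e"
    define e' where "e' = e / (4 * (H + 1))"
    have e': "0 < e'" unfolding e'_def using e H0 by simp
    have e'H: "e' * (H + 1) = e / 4" unfolding e'_def using H0 by (simp add: field_simps)
    obtain \<phi> where \<phi>: "\<phi> integrable_on {a..b}" and close: "\<And>x. x \<in> {a..b} \<Longrightarrow> norm (f x - \<phi> x) \<le> e' * h x"
      using approx[OF e'] by blast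
    obtain \<gamma>1 where \<gamma>1: "gauge \<gamma>1" "\<And>\<D>. \<D> tagged_division_of {a..b} \<Longrightarrow> \<gamma>1 fine \<D> \<Longrightarrow>
        norm ((\<Sum>(x,K)\<in>\<D>. measure lborel K *\<^sub>R \<phi> x) - integral {a..b} \<phi>) < e / 8"
      using integrable_integral[OF \<phi>] e unfolding has_integral_real by (metis divide_pos_pos zero_less_numeral)
    obtain \<gamma>2 where \<gamma>2: "gauge \<gamma>2" "\<And>\<D>. \<D> tagged_division_of {a..b} \<Longrightarrow> \<gamma>2 fine \<D> \<Longrightarrow>
        norm ((\<Sum>(x,K)\<in>\<D>. measure lborel K *\<^sub>R h x) - H) < 1"
      using integrable_integral[OF h] unfolding has_integral_real H_def by (metis zero_less_one)
    define \<gamma> where "\<gamma> = (\<lambda>x. \<gamma>1 x \<inter> \<gamma>2 x)"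
    have near: "norm ((\<Sum>(x,K)\<in>\<D>. measure lborel K *\<^sub>R f x) - integral {a..b} \<phi>) < e / 4 + e / 8"
      if D: "\<D> tagged_division_of {a..b}" "\<gamma> fine \<D>" for \<D>
    proof -
      have fine: "\<gamma>1 fine \<D>" "\<gamma>2 fine \<D>" using D(2) unfolding \<gamma>_def by (auto simp: fine_Int)
      have "norm ((\<Sum>(x,K)\<in>\<D>. measure lborel K *\<^sub>R f x) - (\<Sum>(x,K)\<in>\<D>. measure lborel K *\<^sub>R \<phi> x))
          \<le> (\<Sum>(x,K)\<in>\<D>. e' * (measure lborel K *\<^sub>R h x))"
        unfolding sum_subtractf[symmetric]
      proof (rule sum_norm_le, clarify)
        fix x K assume "(x, K) \<in> \<D>"
        then have "x \<in> {a..b}" using tagged_division_ofD(2,3)[OF D(1)] by blast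
        then have "measure lborel K * norm (f x - \<phi> x) \<le> measure lborel K * (e' * h x)"
          using close by (intro mult_left_mono) auto
        then show "norm (measure lborel K *\<^sub>R f x - measure lborel K *\<^sub>R \<phi> x) \<le> e' * (measure lborel K *\<^sub>R h x)"
          by (simp add: scaleR_right_diff_distrib[symmetric] mult_ac)
      qed
      also have "\<dots> = e' * (\<Sum>(x,K)\<in>\<D>. measure lborel K *\<^sub>R h x)"
        by (simp add: sum_distrib_left case_prod_beta')
      also have "\<dots> \<le> e' * (H + 1)"
        using \<gamma>2(2)[OF D(1) fine(2)] e' by (intro mult_left_mono) (auto simp: abs_less_iff)
      finally have "norm ((\<Sum>(x,K)\<in>\<D>. measure lborel K *\<^sub>R f x) - (\<Sum>(x,K)\<in>\<D>. measure lborel K *\<^sub>R \<phi> x)) \<le> e / 4"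
        unfolding e'H .
      moreover have "norm ((\<Sum>(x,K)\<in>\<D>. measure lborel K *\<^sub>R f x) - integral {a..b} \<phi>)
          \<le> norm ((\<Sum>(x,K)\<in>\<D>. measure lborel K *\<^sub>R f x) - (\<Sum>(x,K)\<in>\<D>. measure lborel K *\<^sub>R \<phi> x))
            + norm ((\<Sum>(x,K)\<in>\<D>. measure lborel K *\<^sub>R \<phi> x) - integral {a..b} \<phi>)"
        using norm_triangle_ineq[of "(\<Sum>(x,K)\<in>\<D>. measure lborel K *\<^sub>R f x) - (\<Sum>(x,K)\<in>\<D>. measure lborel K *\<^sub>R \<phi> x)"
            "(\<Sum>(x,K)\<in>\<D>. measure lborel K *\<^sub>R \<phi> x) - integral {a..b} \<phi>"] by simp
      ultimately show ?thesis
        using \<gamma>1(2)[OF D(1) fine(1)] by linarith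
    qed
    show "\<exists>\<gamma>. gauge \<gamma> \<and> (\<forall>\<D>1 \<D>2. \<D>1 tagged_division_of cbox a b \<and> \<gamma> fine \<D>1 \<and>
        \<D>2 tagged_division_of cbox a b \<and> \<gamma> fine \<D>2 \<longrightarrow>
        norm ((\<Sum>(x,K)\<in>\<D>1. measure lborel K *\<^sub>R f x) - (\<Sum>(x,K)\<in>\<D>2. measure lborel K *\<^sub>R f x)) < e)"
    proof (intro exI[of _ \<gamma>] conjI allI impI)
      show "gauge \<gamma>" unfolding \<gamma>_def using \<gamma>1(1) \<gamma>2(1) by (rule gauge_Int)
      fix \<D>1 \<D>2 assume "\<D>1 tagged_division_of cbox a b \<and> \<gamma> fine \<D>1 \<and> \<D>2 tagged_division_of cbox a b \<and> \<gamma> fine \<D>2"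
      then have "norm ((\<Sum>(x,K)\<in>\<D>1. measure lborel K *\<^sub>R f x) - integral {a..b} \<phi>) < e / 4 + e / 8"
        "norm ((\<Sum>(x,K)\<in>\<D>2. measure lborel K *\<^sub>R f x) - integral {a..b} \<phi>) < e / 4 + e / 8"
        using near by auto
      moreover let ?S = "\<lambda>\<D>. \<Sum>(x,K)\<in>\<D>. measure lborel K *\<^sub>R f x"
      have "norm (?S \<D>1 - ?S \<D>2) \<le> norm (?S \<D>1 - integral {a..b} \<phi>) + norm (?S \<D>2 - integral {a..b} \<phi>)"
        using norm_triangle_ineq4[of "?S \<D>1 - integral {a..b} \<phi>" "?S \<D>2 - integral {a..b} \<phi>"] by simp
      ultimately show "norm (?S \<D>1 - ?S \<D>2) < e"
        using e by linarith
    qed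
  qed
  then show ?thesis by simp
qed

text \<open>
  The range of \<open>c\<close> need not lie in a finite-dimensional space, so measurability arguments are
  replaced by approximation: \<open>g c\<close> is approximated, up to a small multiple of \<open>\<bar>g\<bar>\<close>, by a function in
  which \<open>c\<close> is constant on short intervals.
\<close>

lemma integrable_scaleR_continuous:
  fixes g :: "real \<Rightarrow> real" and c :: "real \<Rightarrow> 'a::{real_normed_vector, complete_space}"
  assumes g: "g absolutely_integrable_on {a..b}" and c: "continuous_on {a..b} c"
  shows "(\<lambda>x. g x *\<^sub>R c x) integrable_on {a..b}"
proof (cases "a \<le> b")
  case False
  then show ?thesis by (simp add: integrable_on_empty)
next
  case ab: True
  show ?thesis
  proof (rule integrable_dominated_approx[where h = "\<lambda>x. \<bar>g x\<bar>"])
    show "(\<lambda>x. \<bar>g x\<bar>) integrable_on {a..b}" using g unfolding absolutely_integrable_on_def by simp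
    fix e :: real assume e: "0 < e"
    have gi: "g integrable_on {a..b}" using g unfolding absolutely_integrable_on_def by simp
    have "uniformly_continuous_on {a..b} c" by (intro compact_uniformly_continuous c) simp
    then obtain \<delta> where \<delta>: "0 < \<delta>" and uc: "\<And>x y. x \<in> {a..b} \<Longrightarrow> y \<in> {a..b} \<Longrightarrow> dist x y < \<delta> \<Longrightarrow> dist (c x) (c y) < e"
      unfolding uniformly_continuous_on_def using e by metis
    have step: "\<exists>\<phi>. \<phi> integrable_on {a..t} \<and> (\<forall>x\<in>{a..t}. norm (g x *\<^sub>R c x - \<phi> x) \<le> e * \<bar>g x\<bar>)"
      if "a \<le> t" "t \<le> b" "t - a \<le> real n * (\<delta> / 2)" for t n
      using that
    proof (induction n arbitrary: t)
      case 0
      then have "t = a" by simp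
      have "norm (g x *\<^sub>R c x - g x *\<^sub>R c x) \<le> e * \<bar>g x\<bar>" for x using e by simp
      moreover have "(\<lambda>x. g x *\<^sub>R c x) integrable_on {a..a}" by (metis box_real(2) integrable_on_refl)
      ultimately show ?case unfolding \<open>t = a\<close> by blast
    next
      case (Suc n)
      define s where "s = max a (t - \<delta> / 2)"
      have s: "a \<le> s" "s \<le> t" "s \<le> b" "s - a \<le> real n * (\<delta> / 2)" "t - s < \<delta>"
        using Suc.prems \<delta> unfolding s_def by (auto simp: algebra_simps max_def)
      obtain \<phi> where \<phi>: "\<phi> integrable_on {a..s}" "\<And>x. x \<in> {a..s} \<Longrightarrow> norm (g x *\<^sub>R c x - \<phi> x) \<le> e * \<bar>g x\<bar>"
        using Suc.IH[OF s(1,3,4)] by blast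
      define \<psi> where "\<psi> = (\<lambda>x. if x \<le> s then \<phi> x else g x *\<^sub>R c t)"
      have 1: "\<psi> integrable_on {a..s}" by (rule integrable_eq[OF \<phi>(1)]) (auto simp: \<psi>_def)
      have "g integrable_on {s..t}" by (rule complete_integrable_on_subinterval[OF gi]) (use s Suc.prems in auto)
      then have "(\<lambda>x. g x *\<^sub>R c t) integrable_on {s..t}" by (rule integrable_on_scaleR_left)
      then have 2: "\<psi> integrable_on {s..t}"
        by (rule integrable_spike_finite[of "{s}", rotated 2]) (auto simp: \<psi>_def)
      have "\<psi> integrable_on {a..t}" by (rule complete_integrable_combine[OF s(1,2) 1 2])
      moreover have "norm (g x *\<^sub>R c x - \<psi> x) \<le> e * \<bar>g x\<bar>" if "x \<in> {a..t}" for x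
      proof (cases "x \<le> s")
        case True
        then show ?thesis using \<phi>(2)[of x] that unfolding \<psi>_def by simp
      next
        case False
        then have "dist (c x) (c t) < e" using uc[of x t] that s Suc.prems by (simp add: dist_real_def)
        then have "\<bar>g x\<bar> * norm (c x - c t) \<le> \<bar>g x\<bar> * e" by (intro mult_left_mono) (auto simp: dist_norm)
        then show ?thesis using False unfolding \<psi>_def by (simp add: scaleR_right_diff_distrib[symmetric] mult.commute)
      qed
      ultimately show ?case by blast
    qed
    obtain n where "(b - a) / (\<delta> / 2) \<le> real n" using real_arch_simple by blast
    then have "b - a \<le> real n * (\<delta> / 2)" using \<delta> by (simp add: field_simps)
    from step[OF ab order_refl this]
    show "\<exists>\<phi>. \<phi> integrable_on {a..b} \<and> (\<forall>x\<in>{a..b}. norm (g x *\<^sub>R c x - \<phi> x) \<le> e * \<bar>g x\<bar>)" .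
  qed
qed

text \<open>
  At a Lebesgue point \<open>x\<close> of both \<open>g\<close> and \<open>\<bar>g\<bar>\<close>, split \<open>g s c s = g s (c s - c x) + g s c x\<close>. The mean of
  the first summand is small since \<open>c\<close> is continuous at \<open>x\<close> and the means of \<open>\<bar>g\<bar>\<close> stay bounded.
\<close>

lemma indefinite_integral_scaleR_derivative:
  fixes g :: "real \<Rightarrow> real" and c :: "real \<Rightarrow> 'a::{real_normed_vector, complete_space}"
  assumes g: "g absolutely_integrable_on {a..b}" and c: "continuous_on {a..b} c"
  shows "negligible {x \<in> {a<..<b}.
    \<not> ((\<lambda>t. integral {a..t} (\<lambda>s. g s *\<^sub>R c s)) has_vector_derivative g x *\<^sub>R c x) (at x)}"
proof -
  define Leb where "Leb = (\<lambda>f::real\<Rightarrow>real. {x \<in> {a<..<b}. \<exists>\<eta>>0. \<forall>\<delta>>0. \<exists>l r. a \<le> l \<and> l < r \<and> r \<le> b \<and> l \<le> x \<and> x \<le> r \<and> r - l < \<delta> \<and>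
      \<eta> * (r - l) \<le> \<bar>(r - l) * f x - integral {l..r} f\<bar>})"
  have gi: "g integrable_on {a..b}" "(\<lambda>x. \<bar>g x\<bar>) integrable_on {a..b}"
    using g unfolding absolutely_integrable_on_def by auto
  have point: "\<exists>\<delta>>0. \<forall>l r. a \<le> l \<and> l < r \<and> r \<le> b \<and> l \<le> x \<and> x \<le> r \<and> r - l < \<delta>
      \<longrightarrow> \<bar>(r - l) * f x - integral {l..r} f\<bar> < \<eta> * (r - l)"
    if "x \<in> {a<..<b}" "x \<notin> Leb f" "0 < \<eta>" for x f \<eta>
    using that unfolding Leb_def by (auto simp: not_le) (meson not_le)
  have "negligible (Leb g \<union> Leb (\<lambda>x. \<bar>g x\<bar>))"
    unfolding Leb_def by (intro negligible_Un Lebesgue_points gi)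
  moreover have "{x \<in> {a<..<b}. \<not> ((\<lambda>t. integral {a..t} (\<lambda>s. g s *\<^sub>R c s)) has_vector_derivative g x *\<^sub>R c x) (at x)}
      \<subseteq> Leb g \<union> Leb (\<lambda>x. \<bar>g x\<bar>)"
  proof (rule subsetI, rule ccontr)
    fix x assume x: "x \<in> {x \<in> {a<..<b}. \<not> ((\<lambda>t. integral {a..t} (\<lambda>s. g s *\<^sub>R c s)) has_vector_derivative g x *\<^sub>R c x) (at x)}"
      and nin: "x \<notin> Leb g \<union> Leb (\<lambda>x. \<bar>g x\<bar>)"
    then have xab: "x \<in> {a<..<b}" by simp
    let ?W = "\<lambda>t. integral {a..t} (\<lambda>s. g s *\<^sub>R c s)"
    have gc: "(\<lambda>s. g s *\<^sub>R c s) integrable_on {a..b}" by (rule integrable_scaleR_continuous[OF g c])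
    have "(?W has_vector_derivative g x *\<^sub>R c x) (at x)"
    proof (rule vector_derivative_by_chords)
      fix e :: real assume e: "0 < e"
      \<comment> \<open>The summands 1 keep the two constants positive; each of the two error terms is at most \<open>e/3\<close>.\<close>
      define M where "M = norm (c x) + 1"
      define k where "k = \<bar>g x\<bar> + 1"
      have M: "0 < M" "norm (c x) \<le> M" and k: "0 < k" unfolding M_def k_def using norm_ge_zero[of "c x"] by linarith+
      have e3: "0 < e / (3 * M)" "0 < e / (3 * k)" using e M k by auto
      obtain \<delta>1 where \<delta>1: "0 < \<delta>1" "\<And>l r. a \<le> l \<and> l < r \<and> r \<le> b \<and> l \<le> x \<and> x \<le> r \<and> r - l < \<delta>1
          \<Longrightarrow> \<bar>(r - l) * g x - integral {l..r} g\<bar> < e / (3 * M) * (r - l)"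
        using point[OF xab _ e3(1), of g] nin by blast
      obtain \<delta>2 where \<delta>2: "0 < \<delta>2" "\<And>l r. a \<le> l \<and> l < r \<and> r \<le> b \<and> l \<le> x \<and> x \<le> r \<and> r - l < \<delta>2
          \<Longrightarrow> \<bar>(r - l) * \<bar>g x\<bar> - integral {l..r} (\<lambda>x. \<bar>g x\<bar>)\<bar> < 1 * (r - l)"
        using point[OF xab _ zero_less_one, of "\<lambda>x. \<bar>g x\<bar>"] nin by blast
      obtain \<delta>3 where \<delta>3: "0 < \<delta>3" "\<And>s. s \<in> {a..b} \<Longrightarrow> dist s x < \<delta>3 \<Longrightarrow> dist (c s) (c x) < e / (3 * k)"
        using c xab e3(2) unfolding continuous_on_iff by (metis greaterThanLessThan_iff atLeastAtMost_iff less_imp_le)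
      define \<delta> where "\<delta> = min (min \<delta>1 \<delta>2) (min \<delta>3 (min (x - a) (b - x)))"
      have \<delta>: "0 < \<delta>" unfolding \<delta>_def using \<delta>1 \<delta>2 \<delta>3 xab by auto
      show "\<exists>\<delta>>0. \<forall>l r. l < r \<and> l \<le> x \<and> x \<le> r \<and> r - l < \<delta> \<longrightarrow>
          norm ((1 / (r - l)) *\<^sub>R (?W r - ?W l) - g x *\<^sub>R c x) < e"
      proof (intro exI[of _ \<delta>] conjI allI impI \<delta>)
        fix l r assume "l < r \<and> l \<le> x \<and> x \<le> r \<and> r - l < \<delta>"
        then have lr: "l < r" "l \<le> x" "x \<le> r" "r - l < \<delta>1" "r - l < \<delta>2" "r - l < \<delta>3" "a \<le> l" "r \<le> b"
          unfolding \<delta>_def by auto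
        have sub: "{l..r} \<subseteq> {a..b}" using lr by auto
        have i1: "(\<lambda>s. g s *\<^sub>R (c s - c x)) integrable_on {l..r}"
          using lr continuous_on_subset[OF c sub] absolutely_integrable_on_subinterval[OF g sub]
          by (intro integrable_scaleR_continuous continuous_intros) auto
        have gl: "g integrable_on {l..r}" "(\<lambda>x. \<bar>g x\<bar>) integrable_on {l..r}"
          using complete_integrable_on_subinterval[OF _ sub] gi by auto
        have i2: "(\<lambda>s. g s *\<^sub>R c x) integrable_on {l..r}"
          using gl(1) by (rule integrable_on_scaleR_left)
        have "?W r - ?W l = integral {l..r} (\<lambda>s. g s *\<^sub>R c s)"
        proof -
          have "(\<lambda>s. g s *\<^sub>R c s) integrable_on {a..r}"
            by (rule complete_integrable_on_subinterval[OF gc]) (use lr in auto)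
          from complete_integral_combine[OF _ _ this, of l] lr show ?thesis by (simp add: algebra_simps)
        qed
        also have "\<dots> = integral {l..r} (\<lambda>s. g s *\<^sub>R (c s - c x) + g s *\<^sub>R c x)"
          by (simp add: scaleR_right_diff_distrib)
        also have "\<dots> = integral {l..r} (\<lambda>s. g s *\<^sub>R (c s - c x)) + integral {l..r} (\<lambda>s. g s *\<^sub>R c x)"
          by (rule Henstock_Kurzweil_Integration.integral_add[OF i1 i2])
        also have "integral {l..r} (\<lambda>s. g s *\<^sub>R c x) = integral {l..r} g *\<^sub>R c x"
          using has_integral_scaleR_left[OF integrable_integral[OF gl(1)], of "c x"] by (rule integral_unique)
        finally have W: "?W r - ?W l = integral {l..r} (\<lambda>s. g s *\<^sub>R (c s - c x)) + integral {l..r} g *\<^sub>R c x" .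
        have n1: "norm (integral {l..r} (\<lambda>s. g s *\<^sub>R (c s - c x))) \<le> e / 3 * (r - l)"
        proof -
          have "norm (integral {l..r} (\<lambda>s. g s *\<^sub>R (c s - c x))) \<le> integral {l..r} (\<lambda>s. (e / (3 * k)) * \<bar>g s\<bar>)"
          proof (rule complete_integral_norm_bound[OF i1])
            show "(\<lambda>s. (e / (3 * k)) * \<bar>g s\<bar>) integrable_on {l..r}" using gl(2) by (rule integrable_on_mult_right)
            fix s assume s: "s \<in> {l..r}"
            then have "dist s x < \<delta>3" using lr by (auto simp: dist_real_def)
            then have "norm (c s - c x) \<le> e / (3 * k)" using \<delta>3(2)[of s] s sub by (auto simp: dist_norm intro: less_imp_le)
            then have "\<bar>g s\<bar> * norm (c s - c x) \<le> \<bar>g s\<bar> * (e / (3 * k))" by (intro mult_left_mono) auto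
            then show "norm (g s *\<^sub>R (c s - c x)) \<le> (e / (3 * k)) * \<bar>g s\<bar>" by (simp add: mult.commute)
          qed
          also have "\<dots> = (e / (3 * k)) * integral {l..r} (\<lambda>x. \<bar>g x\<bar>)" by simp
          also have "\<dots> \<le> (e / (3 * k)) * (k * (r - l))"
          proof (rule mult_left_mono)
            show "integral {l..r} (\<lambda>x. \<bar>g x\<bar>) \<le> k * (r - l)"
              using \<delta>2(2)[of l r] lr unfolding k_def by (auto simp: algebra_simps abs_less_iff)
          qed (use e3 in auto)
          also have "\<dots> = e / 3 * (r - l)" using k by (simp add: field_simps)
          finally show ?thesis .
        qed
        have n2: "norm ((integral {l..r} g - (r - l) * g x) *\<^sub>R c x) \<le> e / 3 * (r - l)"
        proof -
          have "\<bar>integral {l..r} g - (r - l) * g x\<bar> \<le> e / (3 * M) * (r - l)"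
            using \<delta>1(2)[of l r] lr by (auto simp: abs_minus_commute)
          then have "\<bar>integral {l..r} g - (r - l) * g x\<bar> * norm (c x) \<le> (e / (3 * M) * (r - l)) * M"
            using M e lr by (intro mult_mono) auto
          also have "\<dots> = e / 3 * (r - l)" using M by (simp add: field_simps)
          finally show ?thesis by simp
        qed
        have "(1 / (r - l)) *\<^sub>R (?W r - ?W l) - g x *\<^sub>R c x
            = (1 / (r - l)) *\<^sub>R (integral {l..r} (\<lambda>s. g s *\<^sub>R (c s - c x)) + (integral {l..r} g - (r - l) * g x) *\<^sub>R c x)"
          unfolding W using lr(1) by (simp add: scaleR_right_distrib scaleR_left_diff_distrib scaleR_right_diff_distrib)
        then have "norm ((1 / (r - l)) *\<^sub>R (?W r - ?W l) - g x *\<^sub>R c x)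
            = (1 / (r - l)) * norm (integral {l..r} (\<lambda>s. g s *\<^sub>R (c s - c x)) + (integral {l..r} g - (r - l) * g x) *\<^sub>R c x)"
          using lr(1) by simp
        also have "\<dots> \<le> (1 / (r - l)) * (e / 3 * (r - l) + e / 3 * (r - l))"
          using lr(1) norm_triangle_le[OF add_mono[OF n1 n2]] by (intro mult_left_mono) auto
        also have "\<dots> < e" using lr(1) e by (simp add: field_simps)
        finally show "norm ((1 / (r - l)) *\<^sub>R (?W r - ?W l) - g x *\<^sub>R c x) < e" .
      qed
    qed
    then show False using x by blast
  qed
  ultimately show ?thesis by (rule negligible_subset)
qed

lemma nonoverlapping_sum_increments_le:
  fixes \<phi> :: "real \<Rightarrow> real"
  assumes mono: "\<And>s t. a \<le> s \<Longrightarrow> s \<le> t \<Longrightarrow> t \<le> b \<Longrightarrow> \<phi> s \<le> \<phi> t" and ab: "a \<le> b"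
    and I: "nonoverlapping_in a b I l r"
  shows "(\<Sum>i\<in>I. \<phi> (r i) - \<phi> (l i)) \<le> \<phi> b - \<phi> a"
proof -
  have fin: "finite I" and lr: "\<And>i. i \<in> I \<Longrightarrow> a \<le> l i \<and> l i \<le> r i \<and> r i \<le> b"
    and disj: "\<And>i j. i \<in> I \<Longrightarrow> j \<in> I \<Longrightarrow> i \<noteq> j \<Longrightarrow> {l i<..<r i} \<inter> {l j<..<r j} = {}"
    using I unfolding nonoverlapping_in_def by blast+
  define J where "J = {i\<in>I. l i < r i}"
  have J: "finite J" "J \<subseteq> I" unfolding J_def using fin by auto
  have ne: "{l i<..<r i} \<noteq> {}" if "i \<in> J" for i using that unfolding J_def by simp
  have inj: "inj_on (\<lambda>i. {l i..r i}) J"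
  proof (rule inj_onI, rule ccontr)
    fix i j assume ij: "i \<in> J" "j \<in> J" "{l i..r i} = {l j..r j}" "i \<noteq> j"
    then have "l i = l j" "r i = r j" unfolding J_def by (auto simp: Icc_eq_Icc)
    then show False using disj[of i j] ne[OF ij(1)] ij J by auto
  qed
  have "(\<Sum>i\<in>I. \<phi> (r i) - \<phi> (l i)) = (\<Sum>i\<in>J. \<phi> (r i) - \<phi> (l i))"
  proof (rule sum.mono_neutral_right[OF fin J(2)], intro ballI)
    fix i assume "i \<in> I - J"
    then have "l i = r i" using lr[of i] unfolding J_def by auto
    then show "\<phi> (r i) - \<phi> (l i) = 0" by simp
  qed
  also have "\<dots> = (\<Sum>i\<in>J. increment \<phi> {l i..r i})" unfolding J_def by (rule sum.cong) auto
  also have "\<dots> = (\<Sum>K\<in>(\<lambda>i. {l i..r i}) ` J. increment \<phi> K)" by (simp add: sum.reindex[OF inj])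
  also have "\<dots> \<le> \<phi> b - \<phi> a"
  proof (rule sum_increment_mono_le[OF mono _ _ ab])
    show "pairwise (\<lambda>K K'. interior K \<inter> interior K' = {}) ((\<lambda>i. {l i..r i}) ` J)"
    proof (rule pairwiseI)
      fix K K' assume "K \<in> (\<lambda>i. {l i..r i}) ` J" "K' \<in> (\<lambda>i. {l i..r i}) ` J" "K \<noteq> K'"
      then obtain i j where "i \<in> J" "j \<in> J" "i \<noteq> j" "K = {l i..r i}" "K' = {l j..r j}" by blast
      then show "interior K \<inter> interior K' = {}"
        using disj[of i j] J by (auto simp: interior_atLeastAtMost_real)
    qed
    fix K assume "K \<in> (\<lambda>i. {l i..r i}) ` J"
    then show "\<exists>l r. l \<le> r \<and> K = {l..r} \<and> a \<le> l \<and> r \<le> b" using lr J by blast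
  qed (use J in auto)
  finally show ?thesis .
qed

lemma absolutely_continuous_on_intervalI:
  fixes f :: "real \<Rightarrow> 'a::real_normed_vector"
  assumes "\<And>e. 0 < e \<Longrightarrow> \<exists>\<delta>>0. \<forall>n (l :: nat \<Rightarrow> real) r. nonoverlapping_in a b {..<n} l r \<longrightarrow> (\<Sum>i<n. r i - l i) < \<delta>
     \<longrightarrow> (\<Sum>i<n. norm (f (r i) - f (l i))) < e"
  shows "absolutely_continuous_on_interval f a b"
  unfolding absolutely_continuous_on_interval_def
proof (intro allI impI)
  fix e :: real assume "0 < e"
  from assms[OF this] obtain \<delta> where \<delta>: "0 < \<delta>"
    "\<And>n (l :: nat \<Rightarrow> real) r. nonoverlapping_in a b {..<n} l r \<Longrightarrow> (\<Sum>i<n. r i - l i) < \<delta>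
     \<Longrightarrow> (\<Sum>i<n. norm (f (r i) - f (l i))) < e" by blast
  show "\<exists>\<delta>>0. \<forall>(n::nat) l r.
        (\<forall>i<n. a \<le> l i \<and> l i \<le> r i \<and> r i \<le> b) \<and>
        (\<forall>i<n. \<forall>j<n. i \<noteq> j \<longrightarrow> {l i<..<r i} \<inter> {l j<..<r j} = {}) \<and>
        (\<Sum>i<n. r i - l i) < \<delta>
        \<longrightarrow> (\<Sum>i<n. norm (f (r i) - f (l i))) < e"
  proof (intro exI[of _ \<delta>] conjI allI impI \<delta>(1))
    fix n :: nat and l r
    assume h: "(\<forall>i<n. a \<le> l i \<and> l i \<le> r i \<and> r i \<le> b) \<and>
        (\<forall>i<n. \<forall>j<n. i \<noteq> j \<longrightarrow> {l i<..<r i} \<inter> {l j<..<r j} = {}) \<and> (\<Sum>i<n. r i - l i) < \<delta>"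
    show "(\<Sum>i<n. norm (f (r i) - f (l i))) < e"
    proof (rule \<delta>(2))
      show "nonoverlapping_in a b {..<n} l r" unfolding nonoverlapping_in_def using h by simp
    qed (use h in blast)
  qed
qed

text \<open>
  Split \<open>h\<close> into its truncation at height \<open>M\<close> and the excess \<open>u M\<close>. For large \<open>M\<close> the excess has a
  small integral over the whole interval, and the truncated part contributes at most \<open>M\<close> times the
  total length.
\<close>

lemma absolutely_continuous_if_dominated_by_integral:
  fixes W :: "real \<Rightarrow> 'a::real_normed_vector" and h :: "real \<Rightarrow> real"
  assumes ab: "a \<le> b" and h: "h integrable_on {a..b}" and h0: "\<And>x. x \<in> {a..b} \<Longrightarrow> 0 \<le> h x"
    and dom: "\<And>s t. a \<le> s \<Longrightarrow> s \<le> t \<Longrightarrow> t \<le> b \<Longrightarrow> norm (W t - W s) \<le> integral {s..t} h"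
  shows "absolutely_continuous_on_interval W a b"
proof (rule absolutely_continuous_on_intervalI)
  fix e :: real assume e: "0 < e"
  define u where "u = (\<lambda>M x. h x - min (h x) M)"
  have ha: "h absolutely_integrable_on {a..b}" by (rule nonnegative_absolutely_integrable_1[OF h h0])
  have ui: "u M integrable_on {a..b}" for M
  proof -
    have "(\<lambda>x. min (h x) M) absolutely_integrable_on {a..b}"
      by (intro absolutely_integrable_min_1 ha absolutely_integrable_on_const) simp
    then show ?thesis unfolding u_def
      using h by (intro Henstock_Kurzweil_Integration.integrable_diff) (auto simp: absolutely_integrable_on_def)
  qed
  have u0: "0 \<le> u M x" for M x unfolding u_def by simp
  have "(\<lambda>n. integral {a..b} (u (real n))) \<longlonglongrightarrow> integral {a..b} (\<lambda>x. 0)"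
  proof (rule dominated_convergence(2)[OF ui h])
    show "norm (u (real n) x) \<le> h x" if "x \<in> {a..b}" for n x
      using h0[OF that] unfolding u_def by auto
    fix x assume "x \<in> {a..b}"
    have "eventually (\<lambda>n. u (real n) x = 0) sequentially"
      using eventually_ge_at_top[of "nat \<lceil>h x\<rceil>"]
    proof eventually_elim
      fix n assume "nat \<lceil>h x\<rceil> \<le> n"
      then have "h x \<le> real n" by linarith
      then show "u (real n) x = 0" by (simp add: u_def)
    qed
    then show "(\<lambda>n. u (real n) x) \<longlonglongrightarrow> 0" by (rule tendsto_eventually)
  qed
  then have "(\<lambda>n. integral {a..b} (u (real n))) \<longlonglongrightarrow> 0" by simp
  from order_tendstoD(2)[OF this, of "e / 2"] e obtain n0 :: nat where n0: "integral {a..b} (u (real n0)) < e / 2"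
    by (auto simp: eventually_sequentially)
  define M where "M = real n0 + 1"
  have M: "0 < M" unfolding M_def by simp
  have uM: "u M x \<le> u (real n0) x" for x unfolding u_def M_def by auto
  have small: "integral {a..b} (u M) < e / 2"
    using n0 integral_le[OF ui ui, of M "real n0"] uM by (meson le_less_trans)
  define \<phi> where "\<phi> = (\<lambda>t. integral {a..t} (u M))"
  have \<phi>d: "\<phi> t - \<phi> s = integral {s..t} (u M)" if "a \<le> s" "s \<le> t" "t \<le> b" for s t
  proof -
    have "u M integrable_on {a..t}" by (rule complete_integrable_on_subinterval[OF ui]) (use that in auto)
    from complete_integral_combine[OF that(1,2) this] show ?thesis unfolding \<phi>_def by simp
  qed
  have subi: "u M integrable_on {s..t}" if "a \<le> s" "s \<le> t" "t \<le> b" for s t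
    by (rule complete_integrable_on_subinterval[OF ui]) (use that in auto)
  have step: "norm (W t - W s) \<le> (\<phi> t - \<phi> s) + M * (t - s)" if st: "a \<le> s" "s \<le> t" "t \<le> b" for s t
  proof -
    have "integral {s..t} h \<le> integral {s..t} (\<lambda>x. u M x + M)"
    proof (rule integral_le)
      show "h integrable_on {s..t}" by (rule complete_integrable_on_subinterval[OF h]) (use st in auto)
      show "(\<lambda>x. u M x + M) integrable_on {s..t}"
        by (intro Henstock_Kurzweil_Integration.integrable_add subi st integrable_const_ivl)
      show "h x \<le> u M x + M" for x unfolding u_def by auto
    qed
    also have "\<dots> = integral {s..t} (u M) + M * (t - s)"
      using Henstock_Kurzweil_Integration.integral_add[OF subi[OF st] integrable_const_ivl, of M] st by simp
    finally show ?thesis using dom[OF st] \<phi>d[OF st] by simp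
  qed
  show "\<exists>\<delta>>0. \<forall>n (l :: nat \<Rightarrow> real) r. nonoverlapping_in a b {..<n} l r \<longrightarrow> (\<Sum>i<n. r i - l i) < \<delta>
     \<longrightarrow> (\<Sum>i<n. norm (W (r i) - W (l i))) < e"
  proof (intro exI[of _ "e / (2 * M)"] conjI allI impI)
    show "0 < e / (2 * M)" using e M by simp
    fix n and l r :: "nat \<Rightarrow> real"
    assume I: "nonoverlapping_in a b {..<n} l r" and sm: "(\<Sum>i<n. r i - l i) < e / (2 * M)"
    have "(\<Sum>i<n. norm (W (r i) - W (l i))) \<le> (\<Sum>i<n. (\<phi> (r i) - \<phi> (l i)) + M * (r i - l i))"
      using I step unfolding nonoverlapping_in_def by (intro sum_mono) auto
    also have "\<dots> = (\<Sum>i<n. \<phi> (r i) - \<phi> (l i)) + M * (\<Sum>i<n. r i - l i)"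
      by (simp add: sum.distrib sum_distrib_left)
    also have "(\<Sum>i<n. \<phi> (r i) - \<phi> (l i)) \<le> \<phi> b - \<phi> a"
    proof (rule nonoverlapping_sum_increments_le[OF _ ab I])
      show "\<phi> s \<le> \<phi> t" if st: "a \<le> s" "s \<le> t" "t \<le> b" for s t
        using \<phi>d[OF st] integral_nonneg[OF subi[OF st]] u0 by simp
    qed
    also have "\<phi> b - \<phi> a < e / 2" using small \<phi>d[OF order_refl ab order_refl] by simp
    also have "M * (\<Sum>i<n. r i - l i) < e / 2" using sm M by (simp add: field_simps)
    finally show "(\<Sum>i<n. norm (W (r i) - W (l i))) < e" by simp
  qed
qed

text \<open>
  One criterion for sums, products and Lipschitz images of absolutely continuous functions.
\<close>

lemma absolutely_continuous_dominated:
  fixes f :: "real \<Rightarrow> 'a::real_normed_vector" and x :: "real \<Rightarrow> 'b::real_normed_vector"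
    and y :: "real \<Rightarrow> 'c::real_normed_vector"
  assumes x: "absolutely_continuous_on_interval x a b" and y: "absolutely_continuous_on_interval y a b"
    and dom: "\<And>s t. a \<le> s \<Longrightarrow> s \<le> t \<Longrightarrow> t \<le> b \<Longrightarrow> norm (f t - f s) \<le> K * (norm (x t - x s) + norm (y t - y s))"
    and K: "0 < K"
  shows "absolutely_continuous_on_interval f a b"
proof (rule absolutely_continuous_on_intervalI)
  fix e :: real assume "0 < e"
  then have e: "0 < e / (2 * K)" using K by simp
  obtain \<delta>1 where \<delta>1: "0 < \<delta>1" "\<And>(I :: nat set) l r. nonoverlapping_in a b I l r \<Longrightarrow>
      (\<Sum>i\<in>I. r i - l i) < \<delta>1 \<Longrightarrow> (\<Sum>i\<in>I. norm (x (r i) - x (l i))) < e / (2 * K)"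
    using absolutely_continuous_family[OF x e] by blast
  obtain \<delta>2 where \<delta>2: "0 < \<delta>2" "\<And>(I :: nat set) l r. nonoverlapping_in a b I l r \<Longrightarrow>
      (\<Sum>i\<in>I. r i - l i) < \<delta>2 \<Longrightarrow> (\<Sum>i\<in>I. norm (y (r i) - y (l i))) < e / (2 * K)"
    using absolutely_continuous_family[OF y e] by blast
  show "\<exists>\<delta>>0. \<forall>n (l :: nat \<Rightarrow> real) r. nonoverlapping_in a b {..<n} l r \<longrightarrow> (\<Sum>i<n. r i - l i) < \<delta>
     \<longrightarrow> (\<Sum>i<n. norm (f (r i) - f (l i))) < e"
  proof (intro exI[of _ "min \<delta>1 \<delta>2"] conjI allI impI)
    show "0 < min \<delta>1 \<delta>2" using \<delta>1 \<delta>2 by simp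
    fix n and l r :: "nat \<Rightarrow> real"
    assume I: "nonoverlapping_in a b {..<n} l r" and sm: "(\<Sum>i<n. r i - l i) < min \<delta>1 \<delta>2"
    have "(\<Sum>i<n. norm (f (r i) - f (l i))) \<le> (\<Sum>i<n. K * (norm (x (r i) - x (l i)) + norm (y (r i) - y (l i))))"
      using I dom unfolding nonoverlapping_in_def by (intro sum_mono) auto
    also have "\<dots> = K * ((\<Sum>i<n. norm (x (r i) - x (l i))) + (\<Sum>i<n. norm (y (r i) - y (l i))))"
      by (simp only: sum_distrib_left[symmetric] sum.distrib[symmetric])
    also have "\<dots> < K * (e / (2 * K) + e / (2 * K))"
      using \<delta>1(2)[OF I] \<delta>2(2)[OF I] sm K by (intro mult_strict_left_mono add_strict_mono) auto
    also have "\<dots> = e" using K by (simp add: field_simps)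
    finally show "(\<Sum>i<n. norm (f (r i) - f (l i))) < e" .
  qed
qed

lemma absolutely_continuous_imp_continuous:
  fixes f :: "real \<Rightarrow> 'a::real_normed_vector"
  assumes ac: "absolutely_continuous_on_interval f a b"
  shows "continuous_on {a..b} f"
  unfolding continuous_on_iff
proof (intro ballI allI impI)
  fix x e :: real assume x: "x \<in> {a..b}" and e: "0 < e"
  obtain \<delta> where \<delta>: "0 < \<delta>" "\<And>(I :: nat set) l r. nonoverlapping_in a b I l r \<Longrightarrow>
      (\<Sum>i\<in>I. r i - l i) < \<delta> \<Longrightarrow> (\<Sum>i\<in>I. norm (f (r i) - f (l i))) < e"
    using absolutely_continuous_family[OF ac e] by blast
  have "dist (f y) (f x) < e" if y: "y \<in> {a..b}" "dist y x < \<delta>" for y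
  proof -
    have "norm (f (max x y) - f (min x y)) < e"
      using \<delta>(2)[of "{0}" "\<lambda>_. min x y" "\<lambda>_. max x y"] x y
      by (auto simp: nonoverlapping_in_def dist_real_def max_def min_def split: if_splits)
    then show ?thesis by (auto simp: dist_norm max_def min_def norm_minus_commute split: if_splits)
  qed
  then show "\<exists>d>0. \<forall>x'\<in>{a..b}. dist x' x < d \<longrightarrow> dist (f x') (f x) < e" using \<delta>(1) by blast
qed

section \<open>Caratheodory equations with an integrable Lipschitz modulus\<close>

lemma continuous_on_halfline:
  fixes f :: "real \<Rightarrow> 'a::metric_space"
  assumes "\<And>T. t0 \<le> T \<Longrightarrow> continuous_on {t0..T} f"
  shows "continuous_on {t0..} f"
  unfolding continuous_on_iff
proof (intro ballI allI impI)
  fix x e :: real assume x: "x \<in> {t0..}" and e: "0 < e"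
  have "continuous_on {t0..x + 1} f" using assms[of "x + 1"] x by simp
  then obtain d where d: "0 < d" "\<And>y. y \<in> {t0..x + 1} \<Longrightarrow> dist y x < d \<Longrightarrow> dist (f y) (f x) < e"
    unfolding continuous_on_iff using x e by (metis atLeastAtMost_iff atLeast_iff le_add_same_cancel1 zero_le_one)
  show "\<exists>d>0. \<forall>y\<in>{t0..}. dist y x < d \<longrightarrow> dist (f y) (f x) < e"
  proof (intro exI[of _ "min d 1"] conjI ballI impI)
    fix y assume "y \<in> {t0..}" "dist y x < min d 1"
    then show "dist (f y) (f x) < e" by (intro d(2)) (auto simp: dist_real_def)
  qed (use d(1) in simp)
qed

text \<open>
  The equation \<open>z' = F t z\<close> in integrated form. Measurability of \<open>F\<close> in time enters only through the
  integrability of \<open>F\<close> along continuous curves.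
\<close>

locale caratheodory =
  fixes t0 :: real and k :: "real \<Rightarrow> real" and F :: "real \<Rightarrow> 'z::{real_normed_vector, complete_space} \<Rightarrow> 'z" and z0 :: 'z
  assumes k_int: "\<And>T. k integrable_on {t0..T}"
    and k_nonneg: "\<And>t. t0 \<le> t \<Longrightarrow> 0 \<le> k t"
    and lip: "\<And>t u v. t0 \<le> t \<Longrightarrow> norm (F t u - F t v) \<le> k t * norm (u - v)"
    and F_int: "\<And>z T. continuous_on {t0..} z \<Longrightarrow> (\<lambda>s. F s (z s)) integrable_on {t0..T}"
begin

definition modulus_int :: "real \<Rightarrow> real" where "modulus_int t = integral {t0..t} k"

definition weight :: "real \<Rightarrow> real" where "weight t = exp (2 * modulus_int t)"

definition picard :: "(real \<Rightarrow> 'z) \<Rightarrow> real \<Rightarrow> 'z" where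
  "picard z t = z0 + integral {t0..t} (\<lambda>s. F s (z s))"

lemma modulus_int_diff: "t0 \<le> s \<Longrightarrow> s \<le> t \<Longrightarrow> modulus_int t - modulus_int s = integral {s..t} k"
  unfolding modulus_int_def using complete_integral_combine[of t0 s t k] k_int by simp

lemma modulus_int_mono: "t0 \<le> s \<Longrightarrow> s \<le> t \<Longrightarrow> modulus_int s \<le> modulus_int t"
proof -
  assume st: "t0 \<le> s" "s \<le> t"
  have "k integrable_on {s..t}" by (rule complete_integrable_on_subinterval[OF k_int[of t]]) (use st in auto)
  then have "0 \<le> integral {s..t} k" using k_nonneg st by (intro integral_nonneg) auto
  then show ?thesis using modulus_int_diff[OF st] by simp
qed

lemma modulus_int_nonneg: "t0 \<le> t \<Longrightarrow> 0 \<le> modulus_int t"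
  using modulus_int_mono[of t0 t] by (simp add: modulus_int_def)

lemma weight_ge_1: "t0 \<le> t \<Longrightarrow> 1 \<le> weight t"
  unfolding weight_def using modulus_int_nonneg[of t] by simp

lemma k_abs: "k absolutely_integrable_on {t0..T}"
  by (rule nonnegative_absolutely_integrable_1[OF k_int]) (use k_nonneg in auto)

lemma modulus_int_absolutely_continuous:
  assumes "t0 \<le> T" shows "absolutely_continuous_on_interval modulus_int t0 T"
proof (rule absolutely_continuous_if_dominated_by_integral[OF assms k_int])
  show "norm (modulus_int t - modulus_int s) \<le> integral {s..t} k" if "t0 \<le> s" "s \<le> t" for s t
    using modulus_int_diff[OF that] modulus_int_mono[OF that] by simp
qed (use k_nonneg in auto)

text \<open>
  The weight is chosen so that \<open>weight' = 2 k weight\<close> almost everywhere; the factor 2 becomes the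
  contraction constant \<open>1/2\<close>.
\<close>

lemma weight_integral:
  assumes T: "t0 \<le> T"
  shows "((\<lambda>s. k s * weight s) has_integral (weight T - 1) / 2) {t0..T}"
proof -
  have acN: "absolutely_continuous_on_interval modulus_int t0 T" by (rule modulus_int_absolutely_continuous[OF T])
  have acw: "absolutely_continuous_on_interval weight t0 T"
  proof (rule absolutely_continuous_dominated[OF acN acN])
    fix s t assume st: "t0 \<le> s" "s \<le> t" "t \<le> T"
    have "weight s = weight t * exp (- (2 * (modulus_int t - modulus_int s)))" unfolding weight_def by (simp add: exp_add[symmetric])
    moreover have "1 + - (2 * (modulus_int t - modulus_int s)) \<le> exp (- (2 * (modulus_int t - modulus_int s)))" by (rule exp_ge_add_one_self)
    moreover have "0 < weight t" unfolding weight_def by simp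
    ultimately have "weight t * (1 + - (2 * (modulus_int t - modulus_int s))) \<le> weight s" by simp
    then have "weight t - weight s \<le> weight t * (2 * (modulus_int t - modulus_int s))" by (simp add: algebra_simps)
    also have "\<dots> \<le> weight T * (2 * (modulus_int t - modulus_int s))"
      using modulus_int_mono[OF st(1,2)] modulus_int_mono[of t T] st unfolding weight_def by (intro mult_right_mono) auto
    finally have "weight t - weight s \<le> weight T * (2 * (modulus_int t - modulus_int s))" .
    moreover have "weight s \<le> weight t" unfolding weight_def using modulus_int_mono[OF st(1,2)] by simp
    ultimately show "norm (weight t - weight s) \<le> weight T * (norm (modulus_int t - modulus_int s) + norm (modulus_int t - modulus_int s))"
      using modulus_int_mono[OF st(1,2)] by simp
  qed (simp add: weight_def)
  define Z where "Z = {x \<in> {t0<..<T}. \<not> (modulus_int has_vector_derivative k x *\<^sub>R (1::real)) (at x)} \<union> {t0, T}"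
  have "negligible Z"
  proof -
    have "negligible {x \<in> {t0<..<T}. \<not> ((\<lambda>t. integral {t0..t} (\<lambda>s. k s *\<^sub>R (1::real))) has_vector_derivative k x *\<^sub>R 1) (at x)}"
      by (rule indefinite_integral_scaleR_derivative[OF k_abs]) (rule continuous_on_const)
    then have "negligible {x \<in> {t0<..<T}. \<not> (modulus_int has_vector_derivative k x *\<^sub>R (1::real)) (at x)}"
      by (simp add: modulus_int_def[abs_def])
    then show ?thesis unfolding Z_def by (rule negligible_Un) simp
  qed
  then have "((\<lambda>s. weight s * (2 * k s)) has_integral (weight T - weight t0)) {t0..T}"
  proof (rule absolutely_continuous_fundamental_theorem[OF T acw])
    fix t assume "t \<in> {t0..T} - Z"
    then have "(modulus_int has_vector_derivative k t) (at t)" unfolding Z_def by auto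
    then have "(modulus_int has_field_derivative k t) (at t)" by (simp add: has_real_derivative_iff_has_vector_derivative)
    then have "(weight has_field_derivative weight t * (2 * k t)) (at t)"
      unfolding weight_def[abs_def] by (auto intro!: derivative_eq_intros)
    then show "(weight has_vector_derivative weight t * (2 * k t)) (at t within {t0..T})"
      by (simp add: has_real_derivative_iff_has_vector_derivative has_vector_derivative_at_within)
  qed
  then have "((\<lambda>s. (1/2) * (weight s * (2 * k s))) has_integral (1/2) * (weight T - weight t0)) {t0..T}"
    by (rule has_integral_mult_right)
  then show ?thesis by (simp add: weight_def modulus_int_def mult.commute)
qed

lemma picard_continuous:
  assumes "continuous_on {t0..} z" shows "continuous_on {t0..} (picard z)"
  unfolding picard_def[abs_def]
  by (intro continuous_on_halfline continuous_intros complete_indefinite_integral_continuous F_int assms)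

lemma picard_contraction:
  assumes u: "continuous_on {t0..} u" and v: "continuous_on {t0..} v"
    and close: "\<And>s. t0 \<le> s \<Longrightarrow> s \<le> T \<Longrightarrow> norm (u s - v s) \<le> C * weight s" and t: "t0 \<le> t" "t \<le> T"
  shows "norm (picard u t - picard v t) \<le> C / 2 * weight t"
proof -
  have C: "0 \<le> C"
    using close[of t] t weight_ge_1[of t] by (smt (verit) norm_ge_zero mult_neg_pos)
  have "picard u t - picard v t = integral {t0..t} (\<lambda>s. F s (u s) - F s (v s))"
    unfolding picard_def using F_int[OF u] F_int[OF v] by (simp add: Henstock_Kurzweil_Integration.integral_diff)
  also have "norm \<dots> \<le> integral {t0..t} (\<lambda>s. C * (k s * weight s))"
  proof (rule complete_integral_norm_bound)
    show "(\<lambda>s. F s (u s) - F s (v s)) integrable_on {t0..t}"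
      using F_int[OF u] F_int[OF v] by (rule Henstock_Kurzweil_Integration.integrable_diff)
    show "(\<lambda>s. C * (k s * weight s)) integrable_on {t0..t}"
      using weight_integral[OF t(1)] by (intro integrable_on_mult_right) blast
    fix s assume s: "s \<in> {t0..t}"
    have "norm (F s (u s) - F s (v s)) \<le> k s * norm (u s - v s)" using s by (intro lip) simp
    also have "\<dots> \<le> k s * (C * weight s)" using s t close k_nonneg by (intro mult_left_mono) auto
    finally show "norm (F s (u s) - F s (v s)) \<le> C * (k s * weight s)" by (simp add: mult_ac)
  qed
  also have "\<dots> = C * ((weight t - 1) / 2)"
    using has_integral_mult_right[OF weight_integral[OF t(1)], of C] by (rule integral_unique)
  also have "\<dots> \<le> C / 2 * weight t" using C by (simp add: algebra_simps)
  finally show ?thesis .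
qed

lemma bounded_by_weight:
  assumes "continuous_on {t0..} u"
  obtains C :: real where "0 \<le> C" "\<And>s. t0 \<le> s \<Longrightarrow> s \<le> T \<Longrightarrow> norm (u s) \<le> C * weight s"
proof -
  have "compact (u ` {t0..T})"
    by (intro compact_continuous_image continuous_on_subset[OF assms]) auto
  then have "bounded (u ` {t0..T})" by (rule compact_imp_bounded)
  then obtain C where C: "0 < C" "\<forall>x\<in>u ` {t0..T}. norm x \<le> C" using bounded_pos by metis
  show ?thesis
  proof (rule that[of C])
    fix s assume s: "t0 \<le> s" "s \<le> T"
    then have "norm (u s) \<le> C * 1" using C by auto
    also have "\<dots> \<le> C * weight s" using C weight_ge_1[OF s(1)] by (intro mult_left_mono) auto
    finally show "norm (u s) \<le> C * weight s" .
  qed (use C in simp)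
qed

lemma fixed_point_unique:
  assumes u: "continuous_on {t0..} u" "\<And>t. t0 \<le> t \<Longrightarrow> u t = picard u t"
    and v: "continuous_on {t0..} v" "\<And>t. t0 \<le> t \<Longrightarrow> v t = picard v t" and T: "t0 \<le> T"
  shows "u T = v T"
proof -
  have "continuous_on {t0..} (\<lambda>t. u t - v t)" by (intro continuous_intros u v)
  then obtain C where C: "0 \<le> C" "\<And>s. t0 \<le> s \<Longrightarrow> s \<le> T \<Longrightarrow> norm (u s - v s) \<le> C * weight s"
    using bounded_by_weight[where T = T] by blast
  have "norm (u s - v s) \<le> C * (1/2) ^ n * weight s" if "t0 \<le> s" "s \<le> T" for s n
    using that
  proof (induction n arbitrary: s)
    case 0
    then show ?case using C by simp
  next
    case (Suc n)
    have "norm (picard u s - picard v s) \<le> (C * (1/2) ^ n) / 2 * weight s"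
      by (rule picard_contraction[OF u(1) v(1) Suc.IH Suc.prems])
    then show ?case using u(2) v(2) Suc.prems by simp
  qed
  from this[OF T order_refl] have le: "norm (u T - v T) \<le> C * (1/2) ^ n * weight T" for n .
  have "(\<lambda>n. C * (1/2) ^ n * weight T) \<longlonglongrightarrow> C * 0 * weight T"
    by (intro tendsto_intros) auto
  then have "norm (u T - v T) \<le> C * 0 * weight T"
    by (rule LIMSEQ_le_const) (use le in blast)
  then show ?thesis by simp
qed

text \<open>
  The Picard iterates satisfy \<open>\<parallel>\<zeta>\<^sub>n\<^sub>+\<^sub>1 - \<zeta>\<^sub>n\<parallel> \<le> C 2\<^sup>-\<^sup>n weight\<close> on every bounded interval, with \<open>C\<close>
  depending on the interval only, so they converge uniformly on every bounded interval.
\<close>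

lemma fixed_point_exists:
  obtains z where "continuous_on {t0..} z" "\<And>t. t0 \<le> t \<Longrightarrow> z t = picard z t"
proof -
  define \<zeta> where "\<zeta> = (\<lambda>n. (picard ^^ n) (\<lambda>_. z0))"
  have \<zeta>S: "\<zeta> (Suc n) = picard (\<zeta> n)" for n unfolding \<zeta>_def by simp
  have cont: "continuous_on {t0..} (\<zeta> n)" for n
  proof (induction n)
    case 0 then show ?case unfolding \<zeta>_def by simp
  next
    case (Suc n) then show ?case unfolding \<zeta>S by (rule picard_continuous)
  qed
  have "\<exists>C\<ge>0. \<forall>s. t0 \<le> s \<and> s \<le> T \<longrightarrow> norm (\<zeta> 1 s - \<zeta> 0 s) \<le> C * weight s" for T
  proof -
    have "continuous_on {t0..} (\<lambda>s. \<zeta> 1 s - \<zeta> 0 s)" by (intro continuous_intros cont)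
    then obtain C0 where "0 \<le> C0" "\<And>s. t0 \<le> s \<Longrightarrow> s \<le> T \<Longrightarrow> norm (\<zeta> 1 s - \<zeta> 0 s) \<le> C0 * weight s"
      using bounded_by_weight[where T = T] by blast
    then show ?thesis by blast
  qed
  then obtain C where C: "\<And>T. 0 \<le> C T" "\<And>T s. t0 \<le> s \<Longrightarrow> s \<le> T \<Longrightarrow> norm (\<zeta> 1 s - \<zeta> 0 s) \<le> C T * weight s"
    by metis
  have step: "norm (\<zeta> (Suc n) s - \<zeta> n s) \<le> C T * (1/2) ^ n * weight s" if "t0 \<le> s" "s \<le> T" for s T n
    using that
  proof (induction n arbitrary: s)
    case 0
    then show ?case using C by simp
  next
    case (Suc n)
    have "norm (picard (\<zeta> (Suc n)) s - picard (\<zeta> n) s) \<le> (C T * (1/2) ^ n) / 2 * weight s"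
      by (rule picard_contraction[OF cont cont Suc.IH Suc.prems])
    then show ?case unfolding \<zeta>S[of "Suc n"] \<zeta>S[of n, symmetric] by simp
  qed
  have far: "norm (\<zeta> p s - \<zeta> n s) \<le> 2 * C T * ((1/2) ^ n - (1/2) ^ p) * weight s"
    if s: "t0 \<le> s" "s \<le> T" and np: "n \<le> p" for s T n p
    using np
  proof (induction p rule: dec_induct)
    case (step p)
    have "norm (\<zeta> (Suc p) s - \<zeta> n s) \<le> norm (\<zeta> (Suc p) s - \<zeta> p s) + norm (\<zeta> p s - \<zeta> n s)"
      using norm_triangle_ineq[of "\<zeta> (Suc p) s - \<zeta> p s" "\<zeta> p s - \<zeta> n s"] by simp
    also have "\<dots> \<le> C T * (1/2) ^ p * weight s + 2 * C T * ((1/2) ^ n - (1/2) ^ p) * weight s"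
      using \<open>\<And>s T n. t0 \<le> s \<Longrightarrow> s \<le> T \<Longrightarrow> norm (\<zeta> (Suc n) s - \<zeta> n s) \<le> C T * (1/2) ^ n * weight s\<close>[OF s] step.IH
      by (intro add_mono)
    also have "\<dots> = 2 * C T * ((1/2) ^ n - (1/2) ^ Suc p) * weight s" by (simp add: algebra_simps)
    finally show ?case .
  qed simp
  have far': "norm (\<zeta> p s - \<zeta> n s) \<le> 2 * C T * (1/2) ^ n * weight s"
    if s: "t0 \<le> s" "s \<le> T" and np: "n \<le> p" for s T n p
  proof -
    have w: "0 \<le> weight s" unfolding weight_def by simp
    have "2 * C T * ((1/2) ^ n - (1/2) ^ p) * weight s \<le> 2 * C T * (1/2) ^ n * weight s"
      using C(1)[of T] w by (intro mult_right_mono mult_left_mono) auto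
    then show ?thesis using far[OF that] by linarith
  qed
  have half0: "(\<lambda>n. c * (1/2) ^ n * w) \<longlonglongrightarrow> 0" for c w :: real
    using tendsto_mult[OF tendsto_mult[OF tendsto_const[of c] LIMSEQ_power_zero[of "1/2::real"]] tendsto_const[of w]] by simp
  have "convergent (\<lambda>n. \<zeta> n s)" if s: "t0 \<le> s" for s
  proof -
    have "Cauchy (\<lambda>n. \<zeta> n s)"
    proof (rule CauchyI')
      fix e :: real assume e: "0 < e"
      from order_tendstoD(2)[OF half0 e, of "2 * C s" "weight s"]
      obtain M where M: "\<And>n. n \<ge> M \<Longrightarrow> 2 * C s * (1/2) ^ n * weight s < e"
        unfolding eventually_sequentially by blast
      have "dist (\<zeta> n s) (\<zeta> p s) < e" if "n \<ge> M" "p > n" for n p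
        using far'[OF s order_refl, of n p] M[OF that(1)] that(2) by (simp add: dist_norm norm_minus_commute)
      then show "\<exists>M. \<forall>m\<ge>M. \<forall>n>m. dist (\<zeta> m s) (\<zeta> n s) < e" by blast
    qed
    then show ?thesis by (simp add: Cauchy_convergent_iff)
  qed
  then have "\<exists>z. \<forall>s\<ge>t0. (\<lambda>n. \<zeta> n s) \<longlonglongrightarrow> z s" unfolding convergent_def by metis
  then obtain z where z: "\<And>s. t0 \<le> s \<Longrightarrow> (\<lambda>n. \<zeta> n s) \<longlonglongrightarrow> z s" by blast
  have lim: "norm (\<zeta> n s - z s) \<le> 2 * C T * (1/2) ^ n * weight s" if s: "t0 \<le> s" "s \<le> T" for s T n
  proof -
    have "norm (z s - \<zeta> n s) \<le> 2 * C T * (1/2) ^ n * weight s"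
    proof (rule LIMSEQ_le_const2)
      show "(\<lambda>p. norm (\<zeta> p s - \<zeta> n s)) \<longlonglongrightarrow> norm (z s - \<zeta> n s)" by (intro tendsto_intros z s)
      show "\<exists>M. \<forall>p\<ge>M. norm (\<zeta> p s - \<zeta> n s) \<le> 2 * C T * (1/2) ^ n * weight s" using far'[OF s] by blast
    qed
    then show ?thesis by (simp add: norm_minus_commute)
  qed
  have zc: "continuous_on {t0..} z"
  proof (rule continuous_on_halfline)
    fix T assume T: "t0 \<le> T"
    have "uniform_limit {t0..T} \<zeta> z sequentially"
    proof (rule uniform_limitI)
      fix e :: real assume e: "0 < e"
      from order_tendstoD(2)[OF half0 e, of "2 * C T" "weight T"]
      show "\<forall>\<^sub>F n in sequentially. \<forall>s\<in>{t0..T}. dist (\<zeta> n s) (z s) < e"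
      proof eventually_elim
        fix n assume n: "2 * C T * (1/2) ^ n * weight T < e"
        show "\<forall>s\<in>{t0..T}. dist (\<zeta> n s) (z s) < e"
        proof
          fix s assume s: "s \<in> {t0..T}"
          have "weight s \<le> weight T" unfolding weight_def using modulus_int_mono[of s T] s by simp
          then have "2 * C T * (1/2) ^ n * weight s \<le> 2 * C T * (1/2) ^ n * weight T"
            using C(1)[of T] by (intro mult_left_mono) auto
          then show "dist (\<zeta> n s) (z s) < e" using lim[of s T n] s n by (simp add: dist_norm)
        qed
      qed
    qed
    then show "continuous_on {t0..T} z"
      by (rule uniform_limit_theorem[rotated]) (auto intro!: always_eventually continuous_on_subset[OF cont])
  qed
  show thesis
  proof (rule that[OF zc])
    fix t assume t: "t0 \<le> t"
    have "(\<lambda>n. picard (\<zeta> n) t) \<longlonglongrightarrow> picard z t"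
    proof (rule LIM_zero_cancel, rule Lim_null_comparison)
      show "\<forall>\<^sub>F n in sequentially. norm (picard (\<zeta> n) t - picard z t) \<le> (2 * C t) * (1/2) ^ n * (weight t / 2)"
      proof (intro always_eventually allI)
        fix n
        have "norm (picard (\<zeta> n) t - picard z t) \<le> (2 * C t * (1/2) ^ n) / 2 * weight t"
          by (rule picard_contraction[OF cont zc lim t order_refl])
        then show "norm (picard (\<zeta> n) t - picard z t) \<le> (2 * C t) * (1/2) ^ n * (weight t / 2)" by simp
      qed
      show "(\<lambda>n. (2 * C t) * (1/2) ^ n * (weight t / 2)) \<longlonglongrightarrow> 0" by (rule half0)
    qed
    moreover have "(\<lambda>n. picard (\<zeta> n) t) \<longlonglongrightarrow> z t"
      using LIMSEQ_Suc[OF z[OF t]] unfolding \<zeta>S .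
    ultimately show "z t = picard z t" using LIMSEQ_unique by blast
  qed
qed

end

section \<open>Primitives in the almost everywhere sense\<close>

text \<open>
  The relation \<open>f = F'\<close> in \<open>W\<^sup>1\<^sup>,\<^sup>1\<close> of an interval. Two-sided derivatives at interior points suffice,
  so that only the values of \<open>F\<close> on \<open>{a..b}\<close> matter.
\<close>

definition is_primitive :: "real \<Rightarrow> real \<Rightarrow> (real \<Rightarrow> 'a::real_normed_vector) \<Rightarrow> (real \<Rightarrow> 'a) \<Rightarrow> bool" where
  "is_primitive a b F f \<longleftrightarrow> absolutely_continuous_on_interval F a b \<and>
     negligible {x \<in> {a<..<b}. \<not> (F has_vector_derivative f x) (at x)}"

lemma is_primitive_indefinite_integral:
  fixes g :: "real \<Rightarrow> real" and c :: "real \<Rightarrow> 'a::{real_normed_vector, complete_space}"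
  assumes ab: "a \<le> b" and g: "g absolutely_integrable_on {a..b}" and c: "continuous_on {a..b} c"
  shows "is_primitive a b (\<lambda>t. integral {a..t} (\<lambda>s. g s *\<^sub>R c s)) (\<lambda>t. g t *\<^sub>R c t)"
  unfolding is_primitive_def
proof
  have "compact (c ` {a..b})" by (intro compact_continuous_image c) auto
  then have "bounded (c ` {a..b})" by (rule compact_imp_bounded)
  then obtain M where M: "0 < M" "\<forall>x\<in>c ` {a..b}. norm x \<le> M" using bounded_pos by metis
  have gi: "(\<lambda>x. \<bar>g x\<bar>) integrable_on {a..b}" using g unfolding absolutely_integrable_on_def by simp
  have gc: "(\<lambda>s. g s *\<^sub>R c s) integrable_on {a..b}" by (rule integrable_scaleR_continuous[OF g c])
  show "absolutely_continuous_on_interval (\<lambda>t. integral {a..t} (\<lambda>s. g s *\<^sub>R c s)) a b"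
  proof (rule absolutely_continuous_if_dominated_by_integral[OF ab])
    show "(\<lambda>x. M * \<bar>g x\<bar>) integrable_on {a..b}" using gi by (rule integrable_on_mult_right)
    show "0 \<le> M * \<bar>g x\<bar>" for x using M by simp
    fix s t assume st: "a \<le> s" "s \<le> t" "t \<le> b"
    have sub: "{s..t} \<subseteq> {a..b}" "{a..t} \<subseteq> {a..b}" using st by auto
    have "integral {a..t} (\<lambda>s. g s *\<^sub>R c s) - integral {a..s} (\<lambda>s. g s *\<^sub>R c s) = integral {s..t} (\<lambda>s. g s *\<^sub>R c s)"
      using complete_integral_combine[OF st(1,2) complete_integrable_on_subinterval[OF gc sub(2)]]
      by (simp add: algebra_simps)
    also have "norm \<dots> \<le> integral {s..t} (\<lambda>x. M * \<bar>g x\<bar>)"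
    proof (rule complete_integral_norm_bound)
      show "(\<lambda>s. g s *\<^sub>R c s) integrable_on {s..t}" by (rule complete_integrable_on_subinterval[OF gc sub(1)])
      show "(\<lambda>x. M * \<bar>g x\<bar>) integrable_on {s..t}"
        by (rule integrable_on_mult_right[OF complete_integrable_on_subinterval[OF gi sub(1)]])
      fix x assume "x \<in> {s..t}"
      then have "norm (c x) \<le> M" using M sub by blast
      then have "\<bar>g x\<bar> * norm (c x) \<le> \<bar>g x\<bar> * M" by (intro mult_left_mono) auto
      then show "norm (g x *\<^sub>R c x) \<le> M * \<bar>g x\<bar>" by (simp add: mult.commute)
    qed
    finally show "norm (integral {a..t} (\<lambda>s. g s *\<^sub>R c s) - integral {a..s} (\<lambda>s. g s *\<^sub>R c s)) \<le> integral {s..t} (\<lambda>x. M * \<bar>g x\<bar>)" .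
  qed
qed (rule indefinite_integral_scaleR_derivative[OF g c])

lemma is_primitive_add:
  assumes "is_primitive a b F f" "is_primitive a b G g"
  shows "is_primitive a b (\<lambda>t. F t + G t) (\<lambda>t. f t + g t)"
  unfolding is_primitive_def
proof
  show "absolutely_continuous_on_interval (\<lambda>t. F t + G t) a b"
  proof (rule absolutely_continuous_dominated[where x = F and y = G and K = 1])
    show "norm (F t + G t - (F s + G s)) \<le> 1 * (norm (F t - F s) + norm (G t - G s))" for s t
      using norm_diff_triangle_ineq[of "F t" "G t" "F s" "G s"] by simp
  qed (use assms in \<open>auto simp: is_primitive_def\<close>)
  have "negligible ({x \<in> {a<..<b}. \<not> (F has_vector_derivative f x) (at x)} \<union> {x \<in> {a<..<b}. \<not> (G has_vector_derivative g x) (at x)})"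
    using assms unfolding is_primitive_def by (intro negligible_Un) auto
  then show "negligible {x \<in> {a<..<b}. \<not> ((\<lambda>t. F t + G t) has_vector_derivative f x + g x) (at x)}"
    by (rule negligible_subset) (auto intro: has_vector_derivative_add)
qed

lemma is_primitive_bounded_linear:
  assumes h: "bounded_linear h" and F: "is_primitive a b F f"
  shows "is_primitive a b (\<lambda>t. h (F t)) (\<lambda>t. h (f t))"
  unfolding is_primitive_def
proof
  obtain K where K: "0 < K" "\<And>x. norm (h x) \<le> norm x * K" using bounded_linear.pos_bounded[OF h] by blast
  show "absolutely_continuous_on_interval (\<lambda>t. h (F t)) a b"
  proof (rule absolutely_continuous_dominated[where x = F and y = F and K = K])
    show "norm (h (F t) - h (F s)) \<le> K * (norm (F t - F s) + norm (F t - F s))" for s t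
    proof -
      have "norm (h (F t) - h (F s)) \<le> norm (F t - F s) * K"
        using K(2)[of "F t - F s"] by (simp add: linear_diff[OF bounded_linear.linear[OF h]])
      also have "\<dots> \<le> K * (norm (F t - F s) + norm (F t - F s))" using K(1) by (simp add: mult.commute)
      finally show ?thesis .
    qed
  qed (use F K in \<open>auto simp: is_primitive_def\<close>)
  have "negligible {x \<in> {a<..<b}. \<not> (F has_vector_derivative f x) (at x)}"
    using F unfolding is_primitive_def by blast
  then show "negligible {x \<in> {a<..<b}. \<not> ((\<lambda>t. h (F t)) has_vector_derivative h (f x)) (at x)}"
    by (rule negligible_subset) (auto intro: bounded_linear.has_vector_derivative[OF h])
qed

lemma absolutely_continuous_cong:
  assumes "absolutely_continuous_on_interval F a b" and eq: "\<And>t. t \<in> {a..b} \<Longrightarrow> G t = F t"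
  shows "absolutely_continuous_on_interval G a b"
proof (rule absolutely_continuous_dominated[OF assms(1) assms(1), where K = 1])
  show "norm (G t - G s) \<le> 1 * (norm (F t - F s) + norm (F t - F s))" if "a \<le> s" "s \<le> t" "t \<le> b" for s t
    using that by (simp add: eq)
qed simp

lemma is_primitive_transform:
  assumes F: "is_primitive a b F f" and eq: "\<And>t. t \<in> {a..b} \<Longrightarrow> G t = F t" and "\<And>t. t \<in> {a..b} \<Longrightarrow> g t = f t"
  shows "is_primitive a b G g"
  unfolding is_primitive_def
proof
  show "absolutely_continuous_on_interval G a b"
    using F unfolding is_primitive_def by (blast intro: absolutely_continuous_cong eq)
  have "negligible {x \<in> {a<..<b}. \<not> (F has_vector_derivative f x) (at x)}"
    using F unfolding is_primitive_def by blast
  then show "negligible {x \<in> {a<..<b}. \<not> (G has_vector_derivative g x) (at x)}"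
  proof (rule negligible_subset, intro subsetI CollectI conjI)
    fix x assume x: "x \<in> {x \<in> {a<..<b}. \<not> (G has_vector_derivative g x) (at x)}"
    then show "x \<in> {a<..<b}" by simp
    have "(G has_vector_derivative f x) (at x)" if "(F has_vector_derivative f x) (at x)"
      by (rule has_vector_derivative_transform_within_open[OF that, of "{a<..<b}"]) (use x eq in auto)
    then show "\<not> (F has_vector_derivative f x) (at x)" using x assms(3)[of x] by auto
  qed
qed

lemma is_primitive_const:
  "is_primitive a b (\<lambda>_. c) (\<lambda>_. 0)"
  unfolding is_primitive_def
proof
  show "absolutely_continuous_on_interval (\<lambda>_. c) a b"
    unfolding absolutely_continuous_on_interval_def by (auto intro: exI[of _ 1])
qed simp

lemma AE_halfline_iff:
  "(AE t in lebesgue. t0 \<le> t \<longrightarrow> P t) \<longleftrightarrow> negligible {t. t0 \<le> t \<and> \<not> P t}" for t0 :: real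
proof
  assume "AE t in lebesgue. t0 \<le> t \<longrightarrow> P t"
  then obtain N where N: "N \<in> null_sets lebesgue" "{t \<in> space lebesgue. \<not> (t0 \<le> t \<longrightarrow> P t)} \<subseteq> N"
    unfolding eventually_ae_filter by blast
  have "negligible N" using N(1) by (simp add: negligible_iff_null_sets)
  then show "negligible {t. t0 \<le> t \<and> \<not> P t}" by (rule negligible_subset) (use N(2) in auto)
next
  assume "negligible {t. t0 \<le> t \<and> \<not> P t}"
  then have "{t. t0 \<le> t \<and> \<not> P t} \<in> null_sets lebesgue" by (simp add: negligible_iff_null_sets)
  from AE_not_in[OF this] show "AE t in lebesgue. t0 \<le> t \<longrightarrow> P t" by eventually_elim simp
qed

lemma AE_halflineI:
  fixes t0 :: real
  assumes "\<And>T. negligible {x \<in> {t0<..<T}. \<not> P x}"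
  shows "AE t in lebesgue. t0 \<le> t \<longrightarrow> P t"
  unfolding AE_halfline_iff
proof (rule negligible_subset)
  show "negligible ({t0} \<union> (\<Union>n::nat. {x \<in> {t0<..<t0 + real n}. \<not> P x}))"
  proof (rule negligible_Un)
    show "negligible (\<Union>n::nat. {x \<in> {t0<..<t0 + real n}. \<not> P x})"
    proof (rule negligible_countable_Union)
      fix S assume "S \<in> range (\<lambda>n::nat. {x \<in> {t0<..<t0 + real n}. \<not> P x})"
      then obtain n :: nat where S: "S = {x \<in> {t0<..<t0 + real n}. \<not> P x}" by blast
      show "negligible S" unfolding S by (rule assms)
    qed simp
  qed simp
  show "{t. t0 \<le> t \<and> \<not> P t} \<subseteq> {t0} \<union> (\<Union>n::nat. {x \<in> {t0<..<t0 + real n}. \<not> P x})"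
  proof
    fix t assume t: "t \<in> {t. t0 \<le> t \<and> \<not> P t}"
    obtain n :: nat where n: "t - t0 < real n" using reals_Archimedean2 by blast
    show "t \<in> {t0} \<union> (\<Union>n::nat. {x \<in> {t0<..<t0 + real n}. \<not> P x})"
    proof (cases "t = t0")
      case False
      then have "t \<in> {x \<in> {t0<..<t0 + real n}. \<not> P x}" using t n by simp
      then show ?thesis by blast
    qed simp
  qed
qed

lemma at_within_halfline:
  fixes t :: real assumes "t0 \<le> t" "t < T"
  shows "at t within {t0..T} = at t within {t0..}"
  by (rule at_within_nhd[of t "{..<T}"]) (use assms in auto)

lemma absolutely_continuous_on_subinterval:
  assumes f: "absolutely_continuous_on_interval f a b" and sub: "a \<le> c" "d \<le> b"
  shows "absolutely_continuous_on_interval f c d"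
proof (rule absolutely_continuous_on_intervalI)
  fix e :: real assume "0 < e"
  then obtain \<delta> where \<delta>: "0 < \<delta>" "\<And>(I :: nat set) l r. nonoverlapping_in a b I l r \<Longrightarrow>
      (\<Sum>i\<in>I. r i - l i) < \<delta> \<Longrightarrow> (\<Sum>i\<in>I. norm (f (r i) - f (l i))) < e"
    using absolutely_continuous_family[OF f] by blast
  have "nonoverlapping_in a b I l r" if "nonoverlapping_in c d I l r" for I :: "nat set" and l r
    using that sub unfolding nonoverlapping_in_def by force
  then show "\<exists>\<delta>>0. \<forall>n (l :: nat \<Rightarrow> real) r. nonoverlapping_in c d {..<n} l r \<longrightarrow> (\<Sum>i<n. r i - l i) < \<delta>
     \<longrightarrow> (\<Sum>i<n. norm (f (r i) - f (l i))) < e" using \<delta> by blast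
qed

lemma locally_absolutely_continuousI:
  assumes "\<And>T. t0 \<le> T \<Longrightarrow> absolutely_continuous_on_interval f t0 T"
  shows "locally_absolutely_continuous t0 f"
  unfolding locally_absolutely_continuous_def
proof (intro allI impI, elim conjE)
  fix a b assume "t0 \<le> a" "a \<le> b"
  then show "absolutely_continuous_on_interval f a b"
    using absolutely_continuous_on_subinterval[OF assms[of b], of a b] by simp
qed

lemma locally_absolutely_continuous_continuous:
  assumes "locally_absolutely_continuous t0 f"
  shows "continuous_on {t0..} f"
  using assms unfolding locally_absolutely_continuous_def
  by (intro continuous_on_halfline absolutely_continuous_imp_continuous) simp

lemma has_vector_derivative_Pair:
  assumes "(f has_vector_derivative f') (at x within S)" "(g has_vector_derivative g') (at x within S)"
  shows "((\<lambda>x. (f x, g x)) has_vector_derivative (f', g')) (at x within S)"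
  using has_derivative_Pair[OF assms[unfolded has_vector_derivative_def]]
  unfolding has_vector_derivative_def by simp

section \<open>The inertial system\<close>

text \<open>
  The reduced system: \<open>G\<close> below is the term \<open>T\<^bsub>m x\<^esub>\<close> of the equation, and \<open>F\<close> is the right-hand side
  of the first order system for \<open>(x, w)\<close> with \<open>w = x' + \<omega> G\<close>.
\<close>

locale inertial_system =
  fixes t0 \<omega> K c :: real and \<nu> lam :: "real \<Rightarrow> real" and R :: "'a::{real_inner, complete_space} \<Rightarrow> 'a"
  assumes \<omega>: "0 \<le> \<omega>" and c: "0 < c" and K: "0 \<le> K"
    and lam_ge: "\<And>t. t0 \<le> t \<Longrightarrow> c \<le> lam t"
    and \<nu>_pos: "\<And>t. t0 \<le> t \<Longrightarrow> 0 < \<nu> t"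
    and \<nu>_reg: "\<And>T. \<nu> absolutely_integrable_on {t0..T}"
    and lam_meas: "lam \<in> borel_measurable (lebesgue_on {t0..})"
    and lam_reg: "0 < \<omega> \<Longrightarrow> locally_absolutely_continuous t0 lam"
    and R_lip: "\<And>u v. norm (R u - R v) \<le> K * norm (u - v)"
begin

definition G :: "real \<Rightarrow> 'a \<Rightarrow> 'a" where "G t u = (1 / lam t) *\<^sub>R R u"

definition F :: "real \<Rightarrow> 'a \<times> 'a \<Rightarrow> 'a \<times> 'a" where
  "F t z = (snd z - \<omega> *\<^sub>R G t (fst z), (\<omega> * \<nu> t - 1) *\<^sub>R G t (fst z) - \<nu> t *\<^sub>R snd z)"

text \<open>
  A Lipschitz modulus of \<open>F\<close>: \<open>K / c\<close> is a Lipschitz constant of \<open>G\<close>, and \<open>\<bar>\<omega> \<nu> - 1\<bar> \<le> \<omega> \<nu> + 1\<close>.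
\<close>

definition k :: "real \<Rightarrow> real" where
  "k t = (1 + K / c * (\<omega> + 1)) + (1 + K / c * \<omega>) * \<nu> t"

lemma lam_pos: "t0 \<le> t \<Longrightarrow> 0 < lam t"
  using lam_ge[of t] c by simp

lemma inverse_lam_bound: "t0 \<le> t \<Longrightarrow> 1 / lam t \<le> 1 / c"
  using lam_ge[of t] c by (simp add: frac_le)

lemma R_continuous: "continuous_on S R"
proof -
  have "K-lipschitz_on UNIV R" using R_lip K by (intro lipschitz_onI) (auto simp: dist_norm)
  then have "continuous_on UNIV R" by (rule lipschitz_on_continuous_on)
  then show ?thesis by (rule continuous_on_subset) simp
qed

lemma R_comp_continuous: "continuous_on S x \<Longrightarrow> continuous_on S (\<lambda>t. R (x t))"
  using continuous_on_compose2[OF R_continuous[of UNIV], of S x] by simp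

lemma inverse_lam_measurable: "(\<lambda>t. 1 / lam t) \<in> borel_measurable (lebesgue_on {t0..T})"
proof -
  have "lam \<in> borel_measurable (lebesgue_on {t0..T})"
    by (rule measurable_restrict_mono[OF lam_meas]) auto
  then show ?thesis by measurable
qed

lemma inverse_lam_integrable: "(\<lambda>t. 1 / lam t) absolutely_integrable_on {t0..T}"
proof (rule measurable_bounded_by_integrable_imp_absolutely_integrable[OF inverse_lam_measurable])
  show "(\<lambda>t. 1 / c) integrable_on {t0..T}" by (rule integrable_const_ivl)
  show "norm (1 / lam t) \<le> 1 / c" if "t \<in> {t0..T}" for t
    using inverse_lam_bound[of t] lam_pos[of t] that by simp
qed simp

lemma \<nu>_over_lam_integrable: "(\<lambda>t. 1 / lam t * \<nu> t) absolutely_integrable_on {t0..T}"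
proof (rule absolutely_integrable_bounded_measurable_product_real[OF inverse_lam_measurable _ _ \<nu>_reg])
  show "bounded ((\<lambda>t. 1 / lam t) ` {t0..T})"
    unfolding bounded_iff
  proof (intro exI[of _ "1 / c"] ballI)
    fix y assume "y \<in> (\<lambda>t. 1 / lam t) ` {t0..T}"
    then obtain t where "t0 \<le> t" "y = 1 / lam t" by auto
    then show "norm y \<le> 1 / c" using inverse_lam_bound[of t] lam_pos[of t] by simp
  qed
qed simp

text \<open>
  All dependence on time alone is moved into the four real factors 1, \<open>1/lam\<close>, \<open>\<nu>\<close> and \<open>\<nu>/lam\<close>, which are
  locally integrable, while the vector factors are continuous along continuous curves.
\<close>

lemma F_decompose:
  "F t z = 1 *\<^sub>R (snd z, 0) + (1 / lam t) *\<^sub>R (- (\<omega> *\<^sub>R R (fst z)), - R (fst z))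
     + (\<nu> t *\<^sub>R (0, - snd z) + (1 / lam t * \<nu> t) *\<^sub>R (0, \<omega> *\<^sub>R R (fst z)))"
  unfolding F_def G_def by (simp add: algebra_simps)

lemma F_lipschitz:
  assumes t: "t0 \<le> t"
  shows "norm (F t z - F t z') \<le> k t * norm (z - z')"
proof -
  define p where "p = norm (fst z - fst z')"
  define q where "q = norm (snd z - snd z')"
  have pq: "p \<le> norm (z - z')" "q \<le> norm (z - z')" "0 \<le> p" "0 \<le> q"
    unfolding p_def q_def using norm_fst_le[of "fst (z - z')" "snd (z - z')"] norm_snd_le[of "snd (z - z')" "fst (z - z')"]
    by (simp_all flip: fst_diff snd_diff)
  have g: "norm (G t (fst z) - G t (fst z')) \<le> K / c * p"
  proof -
    have "norm (G t (fst z) - G t (fst z')) = (1 / lam t) * norm (R (fst z) - R (fst z'))"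
      unfolding G_def using lam_pos[OF t] by (simp add: scaleR_right_diff_distrib[symmetric])
    also have "\<dots> \<le> (1 / c) * (K * p)"
      unfolding p_def using inverse_lam_bound[OF t] c lam_pos[OF t] R_lip by (intro mult_mono) auto
    finally show ?thesis by simp
  qed
  have \<nu>: "0 < \<nu> t" by (rule \<nu>_pos[OF t])
  have 1: "norm (fst (F t z - F t z')) \<le> q + \<omega> * (K / c * p)"
  proof -
    have "fst (F t z - F t z') = (snd z - snd z') - \<omega> *\<^sub>R (G t (fst z) - G t (fst z'))"
      unfolding F_def by (simp add: algebra_simps)
    also have "norm \<dots> \<le> q + \<omega> * norm (G t (fst z) - G t (fst z'))"
      unfolding q_def using norm_triangle_ineq4[of "snd z - snd z'" "\<omega> *\<^sub>R (G t (fst z) - G t (fst z'))"] \<omega> by simp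
    also have "\<dots> \<le> q + \<omega> * (K / c * p)" using g \<omega> by (intro add_left_mono mult_left_mono) auto
    finally show ?thesis .
  qed
  have 2: "norm (snd (F t z - F t z')) \<le> (\<omega> * \<nu> t + 1) * (K / c * p) + \<nu> t * q"
  proof -
    have "snd (F t z - F t z') = (\<omega> * \<nu> t - 1) *\<^sub>R (G t (fst z) - G t (fst z')) - \<nu> t *\<^sub>R (snd z - snd z')"
      unfolding F_def by (simp add: scaleR_right_diff_distrib)
    also have "norm \<dots> \<le> \<bar>\<omega> * \<nu> t - 1\<bar> * norm (G t (fst z) - G t (fst z')) + \<nu> t * q"
      unfolding q_def using norm_triangle_ineq4[of "(\<omega> * \<nu> t - 1) *\<^sub>R (G t (fst z) - G t (fst z'))" "\<nu> t *\<^sub>R (snd z - snd z')"] \<nu> by simp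
    also have "\<dots> \<le> (\<omega> * \<nu> t + 1) * (K / c * p) + \<nu> t * q"
    proof -
      have "0 \<le> \<omega> * \<nu> t" using \<omega> \<nu> by simp
      then have "\<bar>\<omega> * \<nu> t - 1\<bar> \<le> \<omega> * \<nu> t + 1" by linarith
      then show ?thesis using g \<omega> \<nu> by (intro add_right_mono mult_mono) auto
    qed
    finally show ?thesis .
  qed
  have "norm (F t z - F t z') \<le> norm (fst (F t z - F t z')) + norm (snd (F t z - F t z'))"
    using norm_Pair_le[of "fst (F t z - F t z')" "snd (F t z - F t z')"] by (simp only: prod.collapse)
  also have "\<dots> \<le> (1 + \<nu> t) * q + (\<omega> + (\<omega> * \<nu> t + 1)) * (K / c) * p"
    using 1 2 by (simp add: algebra_simps)
  also have "\<dots> \<le> (1 + \<nu> t) * norm (z - z') + (\<omega> + (\<omega> * \<nu> t + 1)) * (K / c) * norm (z - z')"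
    using pq \<nu> \<omega> K c by (intro add_mono mult_left_mono) auto
  also have "\<dots> = k t * norm (z - z')"
  proof -
    have "(1 + n) * D + (\<omega> + (\<omega> * n + 1)) * \<kappa> * D = ((1 + \<kappa> * (\<omega> + 1)) + (1 + \<kappa> * \<omega>) * n) * D" for n \<kappa> D :: real
      by (simp add: algebra_simps)
    then show ?thesis unfolding k_def .
  qed
  finally show ?thesis .
qed

lemma coefficients_continuous:
  fixes z :: "real \<Rightarrow> 'a \<times> 'a"
  assumes "continuous_on S z"
  shows "continuous_on S (\<lambda>s. (snd (z s), 0::'a))"
    "continuous_on S (\<lambda>s. (- (\<omega> *\<^sub>R R (fst (z s))), - R (fst (z s))))"
    "continuous_on S (\<lambda>s. (0::'a, - snd (z s)))"
    "continuous_on S (\<lambda>s. (0::'a, \<omega> *\<^sub>R R (fst (z s))))"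
  using assms by (intro continuous_intros R_comp_continuous; assumption)+

lemma F_integrable:
  assumes z: "continuous_on {t0..} z"
  shows "(\<lambda>s. F s (z s)) integrable_on {t0..T}"
proof -
  have zT: "continuous_on {t0..T} z" by (rule continuous_on_subset[OF z]) auto
  have one: "(\<lambda>_. 1::real) absolutely_integrable_on {t0..T}" by (rule absolutely_integrable_on_const) simp
  show ?thesis
    unfolding F_decompose
    by (intro Henstock_Kurzweil_Integration.integrable_add integrable_scaleR_continuous
        coefficients_continuous zT one inverse_lam_integrable \<nu>_reg \<nu>_over_lam_integrable)
qed

lemma F_primitive:
  assumes z: "continuous_on {t0..} z" and T: "t0 \<le> T"
  shows "is_primitive t0 T (\<lambda>t. integral {t0..t} (\<lambda>s. F s (z s))) (\<lambda>t. F t (z t))"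
proof -
  have zT: "continuous_on {t0..T} z" for T by (rule continuous_on_subset[OF z]) auto
  have one: "(\<lambda>_. 1::real) absolutely_integrable_on {t0..T}" for T by (rule absolutely_integrable_on_const) simp
  note cc = coefficients_continuous[OF zT]
  note prims = is_primitive_indefinite_integral[OF T one cc(1)]
      is_primitive_indefinite_integral[OF T inverse_lam_integrable cc(2)]
      is_primitive_indefinite_integral[OF T \<nu>_reg cc(3)]
      is_primitive_indefinite_integral[OF T \<nu>_over_lam_integrable cc(4)]
  note ints = integrable_scaleR_continuous[OF one cc(1)]
      integrable_scaleR_continuous[OF inverse_lam_integrable cc(2)]
      integrable_scaleR_continuous[OF \<nu>_reg cc(3)]
      integrable_scaleR_continuous[OF \<nu>_over_lam_integrable cc(4)]
  note p = is_primitive_add[OF is_primitive_add[OF prims(1,2)] is_primitive_add[OF prims(3,4)]]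
  show ?thesis
  proof (rule is_primitive_transform[OF p])
    fix t
    show "integral {t0..t} (\<lambda>s. F s (z s)) =
      integral {t0..t} (\<lambda>s. 1 *\<^sub>R (snd (z s), 0)) +
      integral {t0..t} (\<lambda>s. (1 / lam s) *\<^sub>R (- (\<omega> *\<^sub>R R (fst (z s))), - R (fst (z s)))) +
      (integral {t0..t} (\<lambda>s. \<nu> s *\<^sub>R (0, - snd (z s))) +
       integral {t0..t} (\<lambda>s. (1 / lam s * \<nu> s) *\<^sub>R (0, \<omega> *\<^sub>R R (fst (z s)))))"
      unfolding F_decompose
      by (simp only: Henstock_Kurzweil_Integration.integral_add[OF Henstock_Kurzweil_Integration.integrable_add[OF ints(1,2)]
            Henstock_Kurzweil_Integration.integrable_add[OF ints(3,4)]]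
          Henstock_Kurzweil_Integration.integral_add[OF ints(1,2)] Henstock_Kurzweil_Integration.integral_add[OF ints(3,4)])
    show "F t (z t) = 1 *\<^sub>R (snd (z t), 0) + (1 / lam t) *\<^sub>R (- (\<omega> *\<^sub>R R (fst (z t))), - R (fst (z t)))
     + (\<nu> t *\<^sub>R (0, - snd (z t)) + (1 / lam t * \<nu> t) *\<^sub>R (0, \<omega> *\<^sub>R R (fst (z t))))"
      by (rule F_decompose)
  qed
qed

lemma k_integrable: "k integrable_on {t0..T}"
  unfolding k_def[abs_def]
  by (intro Henstock_Kurzweil_Integration.integrable_add integrable_const_ivl integrable_on_mult_right
      set_lebesgue_integral_eq_integral(1)[OF \<nu>_reg])

lemma k_nonneg: "t0 \<le> t \<Longrightarrow> 0 \<le> k t"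
  unfolding k_def using \<nu>_pos[of t] K c \<omega> by (intro add_nonneg_nonneg mult_nonneg_nonneg) auto

sublocale caratheodory t0 k F z0 for z0
  by unfold_locales (rule k_integrable k_nonneg F_lipschitz F_integrable | assumption)+

text \<open>
  This serves for both terms of the equation: \<open>S\<close> is the residual of the current measure or of the
  measure at the equilibrium.
\<close>

lemma residual_absolutely_continuous:
  fixes S :: "'a \<Rightarrow> 'a" and x :: "real \<Rightarrow> 'a"
  assumes \<omega>: "0 < \<omega>" and S: "\<And>u v. norm (S u - S v) \<le> K' * norm (u - v)"
    and x: "locally_absolutely_continuous t0 x"
  shows "locally_absolutely_continuous t0 (\<lambda>t. (1 / lam t) *\<^sub>R S (x t))"
  unfolding locally_absolutely_continuous_def
proof (intro allI impI, elim conjE)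
  fix a b assume ab: "t0 \<le> a" "a \<le> b"
  have acx: "absolutely_continuous_on_interval x a b" and acl: "absolutely_continuous_on_interval lam a b"
    using x lam_reg[OF \<omega>] ab unfolding locally_absolutely_continuous_def by auto
  have "compact (x ` {a..b})"
    by (intro compact_continuous_image absolutely_continuous_imp_continuous[OF acx]) simp
  then obtain M where M: "0 < M" "\<And>t. t \<in> {a..b} \<Longrightarrow> norm (x t) \<le> M"
    using compact_imp_bounded[of "x ` {a..b}"] unfolding bounded_pos by auto
  define D where "D = norm (S 0) + \<bar>K'\<bar> * M"
  have D: "norm (S (x t)) \<le> D" if "t \<in> {a..b}" for t
  proof -
    have "norm (S (x t)) \<le> norm (S 0) + norm (S (x t) - S 0)" using norm_triangle_ineq[of "S 0" "S (x t) - S 0"] by simp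
    also have "norm (S (x t) - S 0) \<le> K' * norm (x t)" using S[of "x t" 0] by simp
    also have "\<dots> \<le> \<bar>K'\<bar> * M" using M that by (intro mult_mono) auto
    finally show ?thesis unfolding D_def by simp
  qed
  have D0: "0 \<le> D" unfolding D_def using M by simp
  define L where "L = \<bar>K'\<bar> / c + D / (c * c) + 1"
  have L: "0 < L" "\<bar>K'\<bar> / c \<le> L" "D / (c * c) \<le> L" unfolding L_def using D0 c
    by (auto intro!: add_nonneg_pos add_nonneg_nonneg)
  show "absolutely_continuous_on_interval (\<lambda>t. (1 / lam t) *\<^sub>R S (x t)) a b"
  proof (rule absolutely_continuous_dominated[OF acx acl _ L(1)])
    fix s t assume st: "a \<le> s" "s \<le> t" "t \<le> b"
    have ls: "c \<le> lam s" "c \<le> lam t" using lam_ge st ab by auto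
    have "(1 / lam t) *\<^sub>R S (x t) - (1 / lam s) *\<^sub>R S (x s)
        = (1 / lam t) *\<^sub>R (S (x t) - S (x s)) + (1 / lam t - 1 / lam s) *\<^sub>R S (x s)"
      by (simp add: algebra_simps)
    also have "norm \<dots> \<le> (1 / lam t) * norm (S (x t) - S (x s)) + \<bar>1 / lam t - 1 / lam s\<bar> * norm (S (x s))"
      using norm_triangle_ineq[of "(1 / lam t) *\<^sub>R (S (x t) - S (x s))" "(1 / lam t - 1 / lam s) *\<^sub>R S (x s)"] ls c by simp
    also have "\<dots> \<le> (1 / c) * (\<bar>K'\<bar> * norm (x t - x s)) + (\<bar>lam t - lam s\<bar> / (c * c)) * D"
    proof (intro add_mono mult_mono)
      show "1 / lam t \<le> 1 / c" using ls c by (simp add: frac_le)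
      show "norm (S (x t) - S (x s)) \<le> \<bar>K'\<bar> * norm (x t - x s)"
        using S[of "x t" "x s"] by (meson abs_ge_self mult_right_mono norm_ge_zero order_trans)
      have "1 / lam t - 1 / lam s = (lam s - lam t) / (lam t * lam s)" using ls c by (simp add: field_simps)
      then have "\<bar>1 / lam t - 1 / lam s\<bar> = \<bar>lam t - lam s\<bar> / (lam t * lam s)" using ls c by (simp add: abs_mult abs_minus_commute)
      also have "\<dots> \<le> \<bar>lam t - lam s\<bar> / (c * c)" using ls c by (intro divide_left_mono mult_mono) auto
      finally show "\<bar>1 / lam t - 1 / lam s\<bar> \<le> \<bar>lam t - lam s\<bar> / (c * c)" .
    qed (use D[of s] st c in auto)
    also have "\<dots> = (\<bar>K'\<bar> / c) * norm (x t - x s) + (D / (c * c)) * norm (lam t - lam s)" by simp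
    also have "\<dots> \<le> L * norm (x t - x s) + L * norm (lam t - lam s)"
      using L by (intro add_mono mult_right_mono) auto
    finally show "norm ((1 / lam t) *\<^sub>R S (x t) - (1 / lam s) *\<^sub>R S (x s)) \<le> L * (norm (x t - x s) + norm (lam t - lam s))"
      by (simp add: distrib_left)
  qed
qed

end

context inertial_system
begin

text \<open>
  The equation at one instant. Here \<open>Rb\<close> is the residual for the measure at the equilibrium, so that
  \<open>Rb / lam\<close> and \<open>(R - Rb) / lam\<close> are the terms \<open>T\<close> and \<open>E\<close>.
\<close>

definition equation_at :: "('a \<Rightarrow> 'a) \<Rightarrow> (real \<Rightarrow> 'a) \<Rightarrow> (real \<Rightarrow> 'a) \<Rightarrow> real \<Rightarrow> bool" where
  "equation_at Rb x v t \<longleftrightarrow>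
     (\<exists>a p q. (v has_vector_derivative a) (at t within {t0..}) \<and>
        (\<omega> \<noteq> 0 \<longrightarrow>
           ((\<lambda>s. (1 / lam s) *\<^sub>R Rb (x s)) has_vector_derivative p) (at t within {t0..}) \<and>
           ((\<lambda>s. (1 / lam s) *\<^sub>R R (x s) - (1 / lam s) *\<^sub>R Rb (x s)) has_vector_derivative q) (at t within {t0..})) \<and>
        a + \<nu> t *\<^sub>R v t + (1 / lam t) *\<^sub>R Rb (x t) + \<omega> *\<^sub>R p
          + ((1 / lam t) *\<^sub>R R (x t) - (1 / lam t) *\<^sub>R Rb (x t)) + \<omega> *\<^sub>R q = 0)"

definition solution :: "('a \<Rightarrow> 'a) \<Rightarrow> (real \<Rightarrow> 'a) \<Rightarrow> (real \<Rightarrow> 'a) \<Rightarrow> bool" where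
  "solution Rb x v \<longleftrightarrow>
     (\<forall>t\<ge>t0. (x has_vector_derivative v t) (at t within {t0..})) \<and>
     locally_absolutely_continuous t0 x \<and> locally_absolutely_continuous t0 v \<and>
     (AE t in lebesgue. t0 \<le> t \<longrightarrow> equation_at Rb x v t)"

lemma G_absolutely_continuous:
  assumes "0 < \<omega>" "locally_absolutely_continuous t0 x"
  shows "locally_absolutely_continuous t0 (\<lambda>t. G t (x t))"
  unfolding G_def by (rule residual_absolutely_continuous[OF assms(1) R_lip assms(2)])

text \<open>
  With \<open>s = \<omega>\<close> this passes from the velocity to the unknown \<open>w\<close>, with \<open>s = - \<omega>\<close> it passes back.
\<close>

lemma velocity_shift_absolutely_continuous:
  assumes x: "locally_absolutely_continuous t0 x" and y: "locally_absolutely_continuous t0 y"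
    and s: "\<bar>s\<bar> = \<omega>"
  shows "locally_absolutely_continuous t0 (\<lambda>t. y t + s *\<^sub>R G t (x t))"
proof (cases "\<omega> = 0")
  case True
  then show ?thesis using y s by simp
next
  case False
  then have "0 < \<omega>" using \<omega> by simp
  note g = G_absolutely_continuous[OF this x]
  show ?thesis
    unfolding locally_absolutely_continuous_def
  proof (intro allI impI)
    fix a b assume ab: "t0 \<le> a \<and> a \<le> b"
    show "absolutely_continuous_on_interval (\<lambda>t. y t + s *\<^sub>R G t (x t)) a b"
    proof (rule absolutely_continuous_dominated[where x = y and y = "\<lambda>t. G t (x t)" and K = "1 + \<omega>"])
      fix u t
      have "y t + s *\<^sub>R G t (x t) - (y u + s *\<^sub>R G u (x u)) = (y t - y u) + s *\<^sub>R (G t (x t) - G u (x u))"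
        by (simp add: algebra_simps)
      also have "norm \<dots> \<le> norm (y t - y u) + \<omega> * norm (G t (x t) - G u (x u))"
        using norm_triangle_ineq[of "y t - y u" "s *\<^sub>R (G t (x t) - G u (x u))"] s by simp
      also have "\<dots> \<le> (1 + \<omega>) * norm (y t - y u) + (1 + \<omega>) * norm (G t (x t) - G u (x u))"
        using \<omega> by (intro add_mono mult_right_mono) (auto simp: mult_le_cancel_right1 algebra_simps)
      finally show "norm (y t + s *\<^sub>R G t (x t) - (y u + s *\<^sub>R G u (x u)))
          \<le> (1 + \<omega>) * (norm (y t - y u) + norm (G t (x t) - G u (x u)))" by (simp add: distrib_left)
    qed (use ab y g \<omega> in \<open>auto simp: locally_absolutely_continuous_def\<close>)
  qed
qed

text \<open>
  For \<open>\<omega> \<noteq> 0\<close>, at almost every time the two derivatives \<open>p\<close> and \<open>q\<close> add up to the derivative of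
  \<open>G t (x t)\<close>. So \<open>Z\<close> satisfies the first order system there; being absolutely continuous, it is the integral of its
  derivative.
\<close>

lemma solution_is_fixed_point:
  assumes sol: "solution Rb x v" and init: "x t0 = x0" "(x has_vector_derivative u0) (at t0 within {t0..})"
  defines "Z \<equiv> \<lambda>t. (x t, v t + \<omega> *\<^sub>R G t (x t))"
  shows "continuous_on {t0..} Z" and "\<And>T. t0 \<le> T \<Longrightarrow> Z T = picard (x0, u0 + \<omega> *\<^sub>R G t0 x0) Z T"
proof -
  have xv: "\<And>t. t0 \<le> t \<Longrightarrow> (x has_vector_derivative v t) (at t within {t0..})"
    and acx: "locally_absolutely_continuous t0 x" and acv: "locally_absolutely_continuous t0 v"
    using sol[unfolded solution_def, THEN conjunct1] sol[unfolded solution_def, THEN conjunct2, THEN conjunct1]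
      sol[unfolded solution_def, THEN conjunct2, THEN conjunct2, THEN conjunct1] by blast+
  have N: "negligible {t. t0 \<le> t \<and> \<not> equation_at Rb x v t}"
    using sol[unfolded solution_def, THEN conjunct2, THEN conjunct2, THEN conjunct2]
    unfolding AE_halfline_iff .
  have acw: "locally_absolutely_continuous t0 (\<lambda>t. v t + \<omega> *\<^sub>R G t (x t))"
    by (rule velocity_shift_absolutely_continuous[OF acx acv]) (use \<omega> in simp)
  have acZ: "absolutely_continuous_on_interval Z t0 T" if T: "t0 \<le> T" for T
  proof (rule absolutely_continuous_dominated[where x = x and y = "\<lambda>t. v t + \<omega> *\<^sub>R G t (x t)" and K = 1])
    show "norm (Z t - Z s) \<le> 1 * (norm (x t - x s) + norm (v t + \<omega> *\<^sub>R G t (x t) - (v s + \<omega> *\<^sub>R G s (x s))))" for s t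
      unfolding Z_def using norm_Pair_le by simp
  qed (use acx acw T in \<open>auto simp: locally_absolutely_continuous_def\<close>)
  show "continuous_on {t0..} Z"
    by (intro continuous_on_halfline absolutely_continuous_imp_continuous acZ)
  have deriv: "(Z has_vector_derivative F t (Z t)) (at t within {t0..})" if t: "t0 \<le> t" "equation_at Rb x v t" for t
  proof -
    obtain a p q where a: "(v has_vector_derivative a) (at t within {t0..})"
      and pq: "\<omega> \<noteq> 0 \<Longrightarrow> ((\<lambda>s. (1 / lam s) *\<^sub>R Rb (x s)) has_vector_derivative p) (at t within {t0..})"
        "\<omega> \<noteq> 0 \<Longrightarrow> ((\<lambda>s. (1 / lam s) *\<^sub>R R (x s) - (1 / lam s) *\<^sub>R Rb (x s)) has_vector_derivative q) (at t within {t0..})"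
      and eq: "a + \<nu> t *\<^sub>R v t + (1 / lam t) *\<^sub>R Rb (x t) + \<omega> *\<^sub>R p
             + ((1 / lam t) *\<^sub>R R (x t) - (1 / lam t) *\<^sub>R Rb (x t)) + \<omega> *\<^sub>R q = 0"
      using t(2) unfolding equation_at_def by blast
    have "((\<lambda>s. v s + \<omega> *\<^sub>R G s (x s)) has_vector_derivative a + \<omega> *\<^sub>R (p + q)) (at t within {t0..})"
    proof (cases "\<omega> = 0")
      case True
      then show ?thesis using a by simp
    next
      case False
      have "((\<lambda>s. G s (x s)) has_vector_derivative p + q) (at t within {t0..})"
        using has_vector_derivative_add[OF pq[OF False]] by (simp add: G_def)
      from has_vector_derivative_scaleR[OF DERIV_const this, of \<omega>]
      have "((\<lambda>s. \<omega> *\<^sub>R G s (x s)) has_vector_derivative \<omega> *\<^sub>R (p + q)) (at t within {t0..})" by simp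
      from has_vector_derivative_add[OF a this] show ?thesis .
    qed
    from has_vector_derivative_Pair[OF xv[OF t(1)] this]
    have "(Z has_vector_derivative (v t, a + \<omega> *\<^sub>R (p + q))) (at t within {t0..})" unfolding Z_def .
    moreover have "(v t, a + \<omega> *\<^sub>R (p + q)) = F t (Z t)"
    proof -
      have "a + \<omega> *\<^sub>R p + \<omega> *\<^sub>R q + \<nu> t *\<^sub>R v t + G t (x t) = 0"
        using eq by (simp add: G_def algebra_simps)
      then have "a + \<omega> *\<^sub>R (p + q) = - (\<nu> t *\<^sub>R v t + G t (x t))"
        by (metis (no_types, lifting) add.assoc eq_neg_iff_add_eq_0 scaleR_right_distrib)
      then show ?thesis unfolding F_def Z_def by (simp add: algebra_simps)
    qed
    ultimately show ?thesis by simp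
  qed
  have "v t0 = u0"
  proof (rule vector_derivative_unique_within_closed_interval[of t0 "t0 + 1" t0 x])
    show "(x has_vector_derivative v t0) (at t0 within cbox t0 (t0 + 1))"
      by (rule has_vector_derivative_within_subset[OF xv]) auto
    show "(x has_vector_derivative u0) (at t0 within cbox t0 (t0 + 1))"
      by (rule has_vector_derivative_within_subset[OF init(2)]) auto
  qed auto
  then have Z0: "Z t0 = (x0, u0 + \<omega> *\<^sub>R G t0 x0)" unfolding Z_def using init(1) by simp
  show "Z T = picard (x0, u0 + \<omega> *\<^sub>R G t0 x0) Z T" if T: "t0 \<le> T" for T
  proof -
    have "((\<lambda>t. F t (Z t)) has_integral (Z T - Z t0)) {t0..T}"
    proof (rule absolutely_continuous_fundamental_theorem[OF T acZ[OF T] N])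
      fix t assume "t \<in> {t0..T} - {t. t0 \<le> t \<and> \<not> equation_at Rb x v t}"
      then show "(Z has_vector_derivative F t (Z t)) (at t within {t0..T})"
        by (intro has_vector_derivative_within_subset[OF deriv]) auto
    qed
    then have "integral {t0..T} (\<lambda>t. F t (Z t)) = Z T - Z t0" by (rule integral_unique)
    then show ?thesis unfolding picard_def Z0 by simp
  qed
qed

lemma solution_unique:
  assumes "solution Rb x v" "x t0 = x0" "(x has_vector_derivative u0) (at t0 within {t0..})"
    and "solution Rb y w" "y t0 = x0" "(y has_vector_derivative u0) (at t0 within {t0..})" and t: "t0 \<le> t"
  shows "y t = x t"
  using fixed_point_unique[OF solution_is_fixed_point[OF assms(4-6)] solution_is_fixed_point[OF assms(1-3)] t] by simp

text \<open>
  The first component of the fixed point is the trajectory. Its velocity \<open>w - \<omega> G\<close> is continuous, so the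
  first equation holds at every time. The second holds almost everywhere, and for \<open>\<omega> \<noteq> 0\<close> the
  derivatives of \<open>R / lam\<close> and \<open>Rb / lam\<close> along the trajectory exist almost everywhere by absolute
  continuity.
\<close>

lemma solution_exists:
  assumes Rb: "\<And>u v. norm (Rb u - Rb v) \<le> K' * norm (u - v)"
  obtains x v where "solution Rb x v" "x t0 = x0" "(x has_vector_derivative u0) (at t0 within {t0..})"
proof -
  obtain z where z: "continuous_on {t0..} z" and fp: "\<And>t. t0 \<le> t \<Longrightarrow> z t = picard (x0, u0 + \<omega> *\<^sub>R G t0 x0) z t"
    using fixed_point_exists[of "(x0, u0 + \<omega> *\<^sub>R G t0 x0)"] by blast
  define x where "x = (\<lambda>t. fst (z t))"
  define w where "w = (\<lambda>t. snd (z t))"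
  define v where "v = (\<lambda>t. w t - \<omega> *\<^sub>R G t (x t))"
  have z0: "z t0 = (x0, u0 + \<omega> *\<^sub>R G t0 x0)" using fp[of t0] by (simp add: picard_def)
  have prim: "is_primitive t0 T z (\<lambda>t. F t (z t))" if T: "t0 \<le> T" for T
    by (rule is_primitive_transform[OF is_primitive_add[OF is_primitive_const F_primitive[OF z T]]])
      (auto simp: fp picard_def)
  have primx: "is_primitive t0 T x (\<lambda>t. fst (F t (z t)))" if T: "t0 \<le> T" for T
    unfolding x_def by (rule is_primitive_bounded_linear[OF bounded_linear_fst prim[OF T]])
  have primw: "is_primitive t0 T w (\<lambda>t. snd (F t (z t)))" if T: "t0 \<le> T" for T
    unfolding w_def by (rule is_primitive_bounded_linear[OF bounded_linear_snd prim[OF T]])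
  have Fv: "fst (F t (z t)) = v t" for t unfolding F_def v_def w_def x_def by simp
  have acx: "locally_absolutely_continuous t0 x" and acw: "locally_absolutely_continuous t0 w"
    using primx primw unfolding is_primitive_def by (auto intro: locally_absolutely_continuousI)
  have acv: "locally_absolutely_continuous t0 v"
    using velocity_shift_absolutely_continuous[OF acx acw, of "- \<omega>"] \<omega> unfolding v_def by simp
  have vc: "continuous_on {t0..} v" by (rule locally_absolutely_continuous_continuous[OF acv])
  have vi: "v integrable_on {t0..T}" for T
    using integrable_linear[OF F_integrable[OF z] bounded_linear_fst, of T] by (simp add: o_def Fv)
  have xi: "x t = x0 + integral {t0..t} v" if t: "t0 \<le> t" for t
  proof -
    have "integral {t0..t} (\<lambda>s. fst (F s (z s))) = fst (integral {t0..t} (\<lambda>s. F s (z s)))"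
      using integral_linear[OF F_integrable[OF z] bounded_linear_fst, of t] by (simp add: o_def)
    then show ?thesis unfolding x_def using fp[OF t] by (simp add: picard_def Fv)
  qed
  have xv: "(x has_vector_derivative v t) (at t within {t0..})" if t: "t0 \<le> t" for t
  proof -
    have "((\<lambda>u. integral {t0..u} v) has_vector_derivative v t) (at t within {t0..t + 1})"
      by (rule complete_integral_has_vector_derivative[OF continuous_on_subset[OF vc] vi]) (use t in auto)
    then have "((\<lambda>u. x0 + integral {t0..u} v) has_vector_derivative v t) (at t within {t0..})"
      unfolding at_within_halfline[OF t less_add_one]
      using has_vector_derivative_add[OF has_vector_derivative_const] by force
    then show ?thesis by (rule has_vector_derivative_transform[rotated 2]) (use t xi in auto)
  qed
  have AE: "AE t in lebesgue. t0 \<le> t \<longrightarrow> equation_at Rb x v t"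
  proof (rule AE_halflineI)
    fix T
    show "negligible {t \<in> {t0<..<T}. \<not> equation_at Rb x v t}"
    proof (cases "t0 \<le> T")
      case False
      then have empty: "{t0<..<T} = {}" by simp
      show ?thesis unfolding empty by simp
    next
      case T: True
      have wneg: "negligible {t \<in> {t0<..<T}. \<not> (w has_vector_derivative snd (F t (z t))) (at t)}"
        using primw[OF T] unfolding is_primitive_def by blast
      have Fw: "snd (F t (z t)) = (\<omega> * \<nu> t - 1) *\<^sub>R G t (x t) - \<nu> t *\<^sub>R (v t + \<omega> *\<^sub>R G t (x t))" for t
        unfolding F_def v_def w_def x_def by simp
      show ?thesis
      proof (cases "\<omega> = 0")
        case True
        show ?thesis
        proof (rule negligible_subset[OF wneg], intro subsetI CollectI conjI)
          fix t assume t: "t \<in> {t \<in> {t0<..<T}. \<not> equation_at Rb x v t}"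
          then show "t \<in> {t0<..<T}" by simp
          show "\<not> (w has_vector_derivative snd (F t (z t))) (at t)"
          proof
            assume "(w has_vector_derivative snd (F t (z t))) (at t)"
            then have v': "(v has_vector_derivative snd (F t (z t))) (at t within {t0..})"
              using True unfolding v_def by (simp add: has_vector_derivative_at_within)
            have eq: "snd (F t (z t)) + \<nu> t *\<^sub>R v t + (1 / lam t) *\<^sub>R Rb (x t) + \<omega> *\<^sub>R 0
             + ((1 / lam t) *\<^sub>R R (x t) - (1 / lam t) *\<^sub>R Rb (x t)) + \<omega> *\<^sub>R 0 = 0"
              unfolding Fw using True by (simp add: G_def)
            have "equation_at Rb x v t"
              unfolding equation_at_def
              by (rule exI[of _ "snd (F t (z t))"], rule exI[of _ 0], rule exI[of _ 0])
                (intro conjI impI v' eq; simp add: True)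
            with t[unfolded mem_Collect_eq, THEN conjunct2] show False by (rule notE)
          qed
        qed
      next
        case False
        then have \<omega>0: "0 < \<omega>" using \<omega> by simp
        let ?G = "\<lambda>s. (1 / lam s) *\<^sub>R R (x s)"
        let ?Gb = "\<lambda>s. (1 / lam s) *\<^sub>R Rb (x s)"
        have "absolutely_continuous_on_interval ?G t0 T" "absolutely_continuous_on_interval ?Gb t0 T"
          using residual_absolutely_continuous[OF \<omega>0 R_lip acx] residual_absolutely_continuous[OF \<omega>0 Rb acx] T
          unfolding locally_absolutely_continuous_def by auto
        note neg = this[THEN absolutely_continuous_ae_differentiable]
        have un: "negligible ({t \<in> {t0<..<T}. \<not> (w has_vector_derivative snd (F t (z t))) (at t)} \<union>
            ({t \<in> {t0<..<T}. \<not> (\<exists>D. (?G has_vector_derivative D) (at t))} \<union>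
             {t \<in> {t0<..<T}. \<not> (\<exists>D. (?Gb has_vector_derivative D) (at t))}))"
          by (intro negligible_Un wneg neg)
        show ?thesis
        proof (rule negligible_subset[OF un], rule subsetI, rule ccontr)
          fix t assume t: "t \<in> {t \<in> {t0<..<T}. \<not> equation_at Rb x v t}"
            and nin: "t \<notin> {t \<in> {t0<..<T}. \<not> (w has_vector_derivative snd (F t (z t))) (at t)} \<union>
            ({t \<in> {t0<..<T}. \<not> (\<exists>D. (?G has_vector_derivative D) (at t))} \<union>
             {t \<in> {t0<..<T}. \<not> (\<exists>D. (?Gb has_vector_derivative D) (at t))})"
          then obtain D Db where w': "(w has_vector_derivative snd (F t (z t))) (at t within {t0..})"
            and D: "(?G has_vector_derivative D) (at t within {t0..})"
            and Db: "(?Gb has_vector_derivative Db) (at t within {t0..})"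
            by (auto intro: has_vector_derivative_at_within)
          have "((\<lambda>s. \<omega> *\<^sub>R ?G s) has_vector_derivative \<omega> *\<^sub>R D) (at t within {t0..})"
            using has_vector_derivative_scaleR[OF DERIV_const D, of \<omega>] by simp
          from has_vector_derivative_diff[OF w' this]
          have v': "(v has_vector_derivative snd (F t (z t)) - \<omega> *\<^sub>R D) (at t within {t0..})"
            unfolding v_def G_def .
          have q: "((\<lambda>s. ?G s - ?Gb s) has_vector_derivative D - Db) (at t within {t0..})"
            by (rule has_vector_derivative_diff[OF D Db])
          have eq: "(snd (F t (z t)) - \<omega> *\<^sub>R D) + \<nu> t *\<^sub>R v t + ?Gb t + \<omega> *\<^sub>R Db
             + (?G t - ?Gb t) + \<omega> *\<^sub>R (D - Db) = 0"
            unfolding Fw by (simp add: G_def algebra_simps)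
          have "equation_at Rb x v t"
            unfolding equation_at_def
            by (rule exI[of _ "snd (F t (z t)) - \<omega> *\<^sub>R D"], rule exI[of _ Db], rule exI[of _ "D - Db"])
              (intro conjI impI v' Db q eq)
          with t[unfolded mem_Collect_eq, THEN conjunct2] show False by (rule notE)
        qed
      qed
    qed
  qed
  have "solution Rb x v"
    unfolding solution_def by (intro conjI allI impI xv acx acv AE)
  moreover have "x t0 = x0" unfolding x_def using z0 by simp
  moreover have "v t0 = u0" unfolding v_def w_def x_def using z0 by simp
  then have "(x has_vector_derivative u0) (at t0 within {t0..})" using xv[of t0] by simp
  ultimately show thesis by (rule that)
qed

end

section \<open>Existence and uniqueness of the trajectory\<close>

theorem theorem1:
  fixes A :: "'a::{real_inner, complete_space} \<Rightarrow> 'a set"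
    and B :: "'a \<Rightarrow> 'b::polish_space \<Rightarrow> 'a"
    and m :: "'a \<Rightarrow> 'b measure"
    and t0 \<omega> \<beta> \<theta> \<tau> L \<gamma> :: real
    and \<nu> lam :: "real \<Rightarrow> real"
    and x0 u0 :: 'a
  assumes t0: "0 < t0" and \<omega>: "0 \<le> \<omega>"
    and m: "\<And>x. prob_space (m x)" "\<And>x. sets (m x) = sets borel"
    and \<nu>_pos: "\<And>t. t0 \<le> t \<Longrightarrow> 0 < \<nu> t"
    and lam_pos: "\<And>t. t0 \<le> t \<Longrightarrow> 0 < lam t"
    and a: "maximally_monotone A" "0 < \<beta>"
      "\<And>x. (\<lambda>\<xi>. B x \<xi>) \<in> borel_measurable (m x)"
      "\<And>x. \<beta>-lipschitz_on UNIV (\<lambda>\<xi>. B x \<xi>)"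
    and b: "0 < \<theta>"
      "\<And>x. AE \<xi> in m x. \<forall>y z. \<theta> * (norm (B y \<xi> - B z \<xi>))\<^sup>2 \<le> (B y \<xi> - B z \<xi>) \<bullet> (y - z)"
    and c: "0 < \<tau>" "\<And>x y. wasserstein1 (m x) (m y) \<le> ennreal (\<tau> * norm (x - y))"
    and d: "0 < L" "\<And>x. AE \<xi> in m x. L-lipschitz_on UNIV (\<lambda>y. B y \<xi>)"
    and \<gamma>: "0 < \<gamma>" "\<gamma> < 2 * \<theta>"
    and lam_bdd: "0 < (INF t\<in>{t0..}. lam t)"
    and e: "(\<exists>\<phi>. uniformly_monotone A \<phi> \<and> continuous_on {0..} \<phi> \<and> strict_mono_on {0..} \<phi> \<and>
               \<phi> 0 = 0 \<and> mono_on {0<..} (\<lambda>t. \<phi> t / t) \<and> (\<forall>t>0. \<beta> * \<tau> * t\<^sup>2 < \<phi> t)) \<or>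
            (\<exists>\<mu>\<^sub>A>0. strongly_monotone A \<mu>\<^sub>A \<and> \<beta> * \<tau> / \<mu>\<^sub>A < 1)"
    and \<nu>_reg: "\<And>T. \<nu> absolutely_integrable_on {t0..T}"
    and lam_meas: "lam \<in> borel_measurable (lebesgue_on {t0..})"
    and lam_reg: "0 < \<omega> \<Longrightarrow> locally_absolutely_continuous t0 lam"
  shows "\<exists>x. solves_initial_value_problem t0 \<omega> \<nu> lam \<gamma> A B m (equilibrium A B m) x0 u0 x \<and>
           (\<forall>y. solves_initial_value_problem t0 \<omega> \<nu> lam \<gamma> A B m (equilibrium A B m) x0 u0 y
                  \<longrightarrow> (\<forall>t\<ge>t0. y t = x t))"
proof -
  define xbar where "xbar = equilibrium A B m"
  define R where "R = (\<lambda>x. x - resolvent \<gamma> A (x - \<gamma> *\<^sub>R mean_map B (m x) x))"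
  define Rb where "Rb = (\<lambda>x. x - resolvent \<gamma> A (x - \<gamma> *\<^sub>R mean_map B (m xbar) x))"
  have mean: "norm (mean_map B (m x) y - mean_map B (m x') y') \<le> L * norm (y - y') + \<beta> * (\<tau> * norm (x - x'))" for x y x' y'
    by (rule mean_map_lipschitz[OF m a(2,4) less_imp_le[OF c(1)] c(2) d(2)])
  have R_lip: "norm (R x - R y) \<le> (2 + \<gamma> * (L + \<beta> * \<tau>)) * norm (x - y)" for x y
    unfolding R_def
    by (rule forward_backward_residual_lipschitz[OF a(1) \<gamma>(1)]) (use mean in \<open>simp add: distrib_right mult.assoc\<close>)
  have Rb_lip: "norm (Rb x - Rb y) \<le> (2 + \<gamma> * L) * norm (x - y)" for x y
    unfolding Rb_def
    by (rule forward_backward_residual_lipschitz[OF a(1) \<gamma>(1)]) (use mean[of xbar _ xbar] in simp)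
  have lam_ge: "(INF t\<in>{t0..}. lam t) \<le> lam t" if "t0 \<le> t" for t
    using that by (intro cINF_lower bdd_belowI2[of _ 0]) (auto intro: less_imp_le lam_pos)
  interpret inertial_system t0 \<omega> "2 + \<gamma> * (L + \<beta> * \<tau>)" "INF t\<in>{t0..}. lam t" \<nu> lam R
  proof
    show "0 \<le> 2 + \<gamma> * (L + \<beta> * \<tau>)" using \<gamma>(1) d(1) a(2) c(1) by (intro add_nonneg_nonneg mult_nonneg_nonneg) auto
  qed (use \<omega> lam_bdd lam_ge \<nu>_pos \<nu>_reg lam_meas lam_reg R_lip in auto)
  have T_eq: "T_op A B (m xbar) (lam s) \<gamma> u = (1 / lam s) *\<^sub>R Rb u"
    and gap_eq: "gap A B m xbar (lam s) \<gamma> u = (1 / lam s) *\<^sub>R R u - (1 / lam s) *\<^sub>R Rb u" for s u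
    unfolding T_op_def gap_def R_def Rb_def by simp_all
  have sol_iff: "solves_initial_value_problem t0 \<omega> \<nu> lam \<gamma> A B m xbar x0 u0 x \<longleftrightarrow>
      (\<exists>v. solution Rb x v) \<and> x t0 = x0 \<and> (x has_vector_derivative u0) (at t0 within {t0..})" for x
    unfolding solves_initial_value_problem_def strong_global_solution_def solution_def equation_at_def T_eq gap_eq ..
  obtain x v where x: "solution Rb x v" "x t0 = x0" "(x has_vector_derivative u0) (at t0 within {t0..})"
    by (rule solution_exists[OF Rb_lip])
  show ?thesis
    unfolding xbar_def[symmetric] sol_iff using x solution_unique by blast
qed

end
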